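(* Let $(\alpha,p)\in\Pi_2$. Let $F:\mathbb{T}\to\mathbb{C}$ be absolutely continuous on $\mathbb{T}$ with $\dot F\in\mathcal{L}^p(\mathbb{T})$, and let $f=\mathcal{K}_\alpha[F]$ in $\mathbb{D}$. Then $$\|\partial_{r} f\|_{\mathcal{B}^{p}_{\mathcal{G}}(\mathbb{D})}+\|\partial_{z} f\|_{\mathcal{B}^{p}_{\mathcal{G}}(\mathbb{D})}+\|\partial_{\overline{z}} f\|_{\mathcal{B}^{p}_{\mathcal{G}}(\mathbb{D})}\lesssim \|F\|_{\mathcal{L}^{\infty}(\mathbb{T})}+\|\dot F\|_{\mathcal{L}^p(\mathbb{T})}.$$
   Context: $\mathbb{D}=\{z\in\mathbb{C}:|z|<1\}$, $\mathbb{T}=\partial\mathbb{D}$. Parameter set: $\Pi_2=\{(\alpha,p):-1<\alpha<0,\ 1\le p<-\frac1\alpha\}\cup\{(0,1)\}$. Poisson type integral: for $\alpha>-1$ and $F\in\mathcal{L}^1(\mathbb{T})$, $$\mathcal{K}_{\alpha}[F](z)=\frac{1}{2\pi}\int_{0}^{2\pi}\mathcal{K}_{\alpha}(ze^{-it})F(e^{it})\,dt,\quad \mathcal{K}_{\alpha}(z)=\mathcal{C}_{\alpha}\frac{(1-|z|^2)^{\alpha+1}}{|1-z|^{\alpha+2}},\quad \mathcal{C}_{\alpha}=\frac{\Gamma^2(1+\frac{\alpha}{2})}{\Gamma(1+\alpha)},\quad z\in\mathbb{D}.$$ Absolute continuity of $F$ on $\mathbb{T}$ refers to $\theta\mapsto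 F(e^{i\theta})$ on $[0,2\pi]$, and $\dot F(e^{i\theta})=\frac{d}{d\theta}F(e^{i\theta})$, which exists a.e. $\|G\|_{\mathcal{L}^p(\mathbb{T})}=\big(\frac1{2\pi}\int_0^{2\pi}|G(e^{i\theta})|^p\,d\theta\big)^{1/p}$ for $p<\infty$, and $\|G\|_{\mathcal{L}^\infty(\mathbb{T})}$ is the essential supremum. Derivatives: $\partial_z=\frac12(\partial_x-i\partial_y)$, $\partial_{\overline z}=\frac12(\partial_x+i\partial_y)$, and for $z=re^{i\theta}$, $\partial_r f(z)=\partial_zf(z)e^{i\theta}+\partial_{\overline z}f(z)e^{-i\theta}$. Bergman type norm: for a measurable complex-valued $g$ on $\mathbb{D}$ and $p<\infty$, $\|g\|_{\mathcal{B}^p_{\mathcal{G}}(\mathbb{D})}=\big(\int_{\mathbb{D}}|g(z)|^p\,d\sigma(z)\big)^{1/p}$, where $d\sigma=dx\,dy/\pi$. Notation $\lesssim$: for nonnegative quantities $X,Y$, $X\lesssim Y$ means that there exist constants $M_1\ge1$ and $M_2\ge0$ with $X\le M_1Y+M_2$. The constants may depend on all the data ($\alpha,p$ and on the given mapping $f$); in particular, the left-hand side is finite whenever the right-hand side is. *)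

theory Defs
  imports "HOL-Analysis.Analysis" "HOL-Probability.Essential_Supremum"
begin

definition Pi2 :: "(real \<times> real) set" where
  "Pi2 = {(\<alpha>, p). -1 < \<alpha> \<and> \<alpha> < 0 \<and> 1 \<le> p \<and> p < - 1 / \<alpha>} \<union> {(0, 1)}"


(* Functions on the unit circle are represented by functions on the complex plane of
   which only the values at the points cis t are used.  Functions on the unit disc are
   likewise total; only their values on ball 0 1 matter. *)

definition poisson_const :: "real \<Rightarrow> real" where
  "poisson_const \<alpha> = (Gamma (1 + \<alpha> / 2))\<^sup>2 / Gamma (1 + \<alpha>)"

definition poisson_kernel :: "real \<Rightarrow> complex \<Rightarrow> real" where
  "poisson_kernel \<alpha> z =
     poisson_const \<alpha> * ((1 - (cmod z)\<^sup>2) powr (\<alpha> + 1) / cmod (1 - z) powr (\<alpha> + 2))"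

definition poisson_integral :: "real \<Rightarrow> (complex \<Rightarrow> complex) \<Rightarrow> complex \<Rightarrow> complex" where
  "poisson_integral \<alpha> F z =
     1 / (2 * of_real pi) *
     (LINT t|lebesgue_on {0..2 * pi}. of_real (poisson_kernel \<alpha> (z * cis (- t))) * F (cis t))"


definition absolutely_continuous_on :: "real set \<Rightarrow> (real \<Rightarrow> complex) \<Rightarrow> bool" where
  "absolutely_continuous_on I g \<longleftrightarrow>
     (\<forall>\<epsilon>>0. \<exists>\<delta>>0. \<forall>S :: (real \<times> real) set.
        finite S \<and> (\<forall>(a, b)\<in>S. a < b \<and> {a..b} \<subseteq> I) \<and>
        disjoint_family_on (\<lambda>(a, b). {a<..<b}) S \<and> (\<Sum>(a, b)\<in>S. b - a) < \<delta>
        \<longrightarrow> (\<Sum>(a, b)\<in>S. norm (g b - g a)) < \<epsilon>)"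

definition absolutely_continuous_circle :: "(complex \<Rightarrow> complex) \<Rightarrow> bool" where
  "absolutely_continuous_circle F \<longleftrightarrow>
     absolutely_continuous_on {0..2 * pi} (\<lambda>\<theta>. F (cis \<theta>))"

(* By periodicity of cis the derivative does not depend on the choice of the argument.
   Where the derivative does not exist, vector_derivative is a fixed arbitrary value; for
   absolutely continuous F this concerns a null set only. *)
definition circle_deriv :: "(complex \<Rightarrow> complex) \<Rightarrow> complex \<Rightarrow> complex" where
  "circle_deriv F \<zeta> = vector_derivative (\<lambda>\<theta>. F (cis \<theta>)) (at (Arg \<zeta>))"


definition partial_x :: "(complex \<Rightarrow> complex) \<Rightarrow> complex \<Rightarrow> complex" where
  "partial_x f z = vector_derivative (\<lambda>t::real. f (z + of_real t)) (at 0)"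

definition partial_y :: "(complex \<Rightarrow> complex) \<Rightarrow> complex \<Rightarrow> complex" where
  "partial_y f z = vector_derivative (\<lambda>t::real. f (z + \<i> * of_real t)) (at 0)"

definition partial_z :: "(complex \<Rightarrow> complex) \<Rightarrow> complex \<Rightarrow> complex" where
  "partial_z f z = 1 / 2 * (partial_x f z - \<i> * partial_y f z)"

definition partial_zbar :: "(complex \<Rightarrow> complex) \<Rightarrow> complex \<Rightarrow> complex" where
  "partial_zbar f z = 1 / 2 * (partial_x f z + \<i> * partial_y f z)"

(* The angle of 0 is read as Arg 0 = 0; this affects a single point. *)
definition partial_r :: "(complex \<Rightarrow> complex) \<Rightarrow> complex \<Rightarrow> complex" where
  "partial_r f z = partial_z f z * cis (Arg z) + partial_zbar f z * cis (- Arg z)"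


definition ennreal_powr :: "ennreal \<Rightarrow> real \<Rightarrow> ennreal" where
  "ennreal_powr x s = (if x = top then top else ennreal (enn2real x powr s))"

(* Norms take values in [0, \<infinity>].  They are \<infinity> for functions that are not measurable, in line
   with esssup, so a function belongs to the space precisely when its norm is finite. *)
definition Lp_norm :: "real \<Rightarrow> 'a measure \<Rightarrow> ('a \<Rightarrow> complex) \<Rightarrow> ennreal" where
  "Lp_norm p M g =
     (if g \<in> borel_measurable M
      then ennreal_powr (\<integral>\<^sup>+ x. ennreal (cmod (g x) powr p) \<partial>M) (1 / p)
      else top)"

definition angle_measure :: "real measure" where
  "angle_measure = scale_measure (ennreal (1 / (2 * pi))) (lebesgue_on {0..2 * pi})"

definition disc_measure :: "complex measure" where
  "disc_measure = scale_measure (ennreal (1 / pi)) (lebesgue_on (ball 0 1))"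

definition Lp_circle_norm :: "real \<Rightarrow> (complex \<Rightarrow> complex) \<Rightarrow> ennreal" where
  "Lp_circle_norm p G = Lp_norm p angle_measure (\<lambda>\<theta>. G (cis \<theta>))"

definition Linf_circle_norm :: "(complex \<Rightarrow> complex) \<Rightarrow> ennreal" where
  "Linf_circle_norm G = esssup angle_measure (\<lambda>\<theta>. ennreal (cmod (G (cis \<theta>))))"

definition bergman_norm :: "real \<Rightarrow> (complex \<Rightarrow> complex) \<Rightarrow> ennreal" where
  "bergman_norm p g = Lp_norm p disc_measure g"


definition lesssim :: "ennreal \<Rightarrow> ennreal \<Rightarrow> bool"  (infix "\<lesssim>" 50) where
  "X \<lesssim> Y \<longleftrightarrow> (\<exists>M1 M2 :: real. M1 \<ge> 1 \<and> M2 \<ge> 0 \<and> X \<le> ennreal M1 * Y + ennreal M2)"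

end

theory Submission
  imports Defs
begin

text \<open>The constants in \<open>\<lesssim>\<close> may depend on the mapping, so the assertion is that the three Bergman norms
are finite. Put \<open>\<rho> = 1 - (cmod z)\<^sup>2\<close> and let \<open>G\<close> be the derivative of the boundary function \<open>t \<mapsto> F (cis t)\<close>.

Differentiating \<open>f = K[F]\<close> in the angular direction puts an angular derivative on the kernel, and an
integration by parts moves it to \<open>F\<close>: the angular derivative of \<open>f\<close> is an integral of the kernel
against \<open>G\<close>. The radial derivative of the kernel has no such form, but it is one up to a small error. With
\<open>w = z * cis (- t)\<close>, the lemma \<open>poisson_kernel_radial_identity\<close> says that the derivative of the kernel
in the direction \<open>w\<close> is the angular derivative of a conjugate kernel plus a remainder, and by
\<open>kernels_le_model_kernel\<close> the kernel, the conjugate kernel and the remainder are all bounded by a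
multiple of \<open>\<rho> powr \<alpha> * cmod (1 - w) powr (-(\<alpha> + 1))\<close>. So both polar derivatives of \<open>f\<close> are at most a constant
times the integral of this majorant against \<open>cmod F + cmod G\<close> (lemma
\<open>polar_derivatives_le_model_integral\<close>).

The majorant is integrable over circles when \<open>\<alpha> < 0\<close>, with mass of order \<open>\<rho> powr \<alpha>\<close>. A Schur test
(\<open>model_kernel_integral_bergman\<close>), that is, Hoelder's inequality, Tonelli's theorem and the rotation
invariance of area, bounds the integral of the \<open>p\<close>-th power over the disc by the \<open>p\<close>-th power norm of
\<open>cmod F + cmod G\<close> and the integral of \<open>\<rho> powr (\<alpha> p)\<close>. The latter is finite because \<open>\<alpha> p > -1\<close>, which is the
condition \<open>p < - 1 / \<alpha>\<close>. For \<open>\<alpha> = 0\<close> and \<open>p = 1\<close> the majorant only grows if \<open>\<alpha>\<close> is replaced by a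
negative exponent, up to a constant factor.

The integration by parts rests on the fundamental theorem of calculus for absolutely continuous
functions (\<open>absolutely_continuous_fundamental_theorem\<close>). On short intervals such a function is the
difference of two monotone absolutely continuous ones, namely its positive variation and the rest;
the Radon-Nikodym theorem turns these into indefinite integrals, and Lebesgue's differentiation
theorem identifies the density with the pointwise derivative.\<close>

section \<open>Interval families and the positive variation\<close>

text \<open>The test families in the definition of absolute continuity, relativised to \<open>[x, y]\<close>; a pair
stands for the open interval between its components.\<close>

definition interval_families :: "real \<Rightarrow> real \<Rightarrow> (real \<times> real) set set" where
  "interval_families x y =
     {S. finite S \<and> (\<forall>(u, v)\<in>S. x \<le> u \<and> u < v \<and> v \<le> y) \<and>
         disjoint_family_on (\<lambda>(u, v). {u<..<v}) S}"

text \<open>Increments enter without absolute values. Such sums are additive under cutting and joining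
intervals, and their supremum is the positive variation, whose difference with \<open>g\<close> is monotone.\<close>

definition rise :: "(real \<Rightarrow> real) \<Rightarrow> (real \<times> real) set \<Rightarrow> real" where
  "rise g S = (\<Sum>(u, v)\<in>S. g v - g u)"

lemma interval_familiesD:
  assumes "S \<in> interval_families x y"
  shows "finite S"
    and "(u, v) \<in> S \<Longrightarrow> x \<le> u" and "(u, v) \<in> S \<Longrightarrow> u < v" and "(u, v) \<in> S \<Longrightarrow> v \<le> y"
    and "(u, v) \<in> S \<Longrightarrow> (u', v') \<in> S \<Longrightarrow> u < t \<Longrightarrow> t < v \<Longrightarrow> u' < t \<Longrightarrow> t < v' \<Longrightarrow> u = u' \<and> v = v'"
proof -
  have S: "finite S" "\<forall>(u, v)\<in>S. x \<le> u \<and> u < v \<and> v \<le> y"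
    and disj: "disjoint_family_on (\<lambda>(u, v). {u<..<v}) S"
    using assms by (simp_all add: interval_families_def)
  show "finite S" by (fact S(1))
  show "(u, v) \<in> S \<Longrightarrow> x \<le> u" "(u, v) \<in> S \<Longrightarrow> u < v" "(u, v) \<in> S \<Longrightarrow> v \<le> y"
    using S(2) by auto
  assume *: "(u, v) \<in> S" "(u', v') \<in> S" "u < t" "t < v" "u' < t" "t < v'"
  show "u = u' \<and> v = v'"
  proof (rule ccontr)
    assume "\<not> ?thesis"
    then have "{u<..<v} \<inter> {u'<..<v'} = {}"
      using disjoint_family_onD[OF disj *(1,2)] by simp
    then show False using * by (auto simp: disjoint_iff)
  qed
qed

lemma interval_familiesI:
  assumes "finite S" and "\<And>u v. (u, v) \<in> S \<Longrightarrow> x \<le> u \<and> u < v \<and> v \<le> y"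
    and "\<And>u v u' v' t. (u, v) \<in> S \<Longrightarrow> (u', v') \<in> S \<Longrightarrow> u < t \<Longrightarrow> t < v \<Longrightarrow> u' < t \<Longrightarrow> t < v'
           \<Longrightarrow> u = u' \<and> v = v'"
  shows "S \<in> interval_families x y"
proof -
  have "disjoint_family_on (\<lambda>(u, v). {u<..<v}) S"
  unfolding disjoint_family_on_def
  proof (intro ballI impI)
    fix p q assume pq: "p \<in> S" "q \<in> S" "p \<noteq> q"
    obtain u v u' v' where eq: "p = (u, v)" "q = (u', v')" by (cases p, cases q)
    have "t \<notin> {u<..<v} \<inter> {u'<..<v'}" for t
      using assms(3)[of u v u' v' t] pq eq by auto
    then have "{u<..<v} \<inter> {u'<..<v'} = {}" by blast
    then show "(case p of (u, v) \<Rightarrow> {u<..<v}) \<inter> (case q of (u, v) \<Rightarrow> {u<..<v}) = {}"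
      by (simp only: eq prod.case)
  qed
  then show ?thesis using assms(1,2) by (auto simp: interval_families_def)
qed

lemma interval_families_mono:
  "x' \<le> x \<Longrightarrow> y \<le> y' \<Longrightarrow> interval_families x y \<subseteq> interval_families x' y'"
  unfolding interval_families_def by fastforce

lemma empty_interval_family [simp]: "{} \<in> interval_families x y"
  by (simp add: interval_families_def disjoint_family_on_def)

lemma length_interval_family_le_measure:
  assumes S: "S \<in> interval_families x y" and A: "A \<in> fmeasurable lebesgue"
    and sub: "\<And>u v. (u, v) \<in> S \<Longrightarrow> {u<..<v} \<subseteq> A"
  shows "rise (\<lambda>t. t) S \<le> measure lebesgue A"
proof -
  have fin: "finite S" using S interval_familiesD(1) by blast
  let ?I = "\<lambda>(u::real, v). {u<..<v}"
  have "rise (\<lambda>t. t) S = (\<Sum>p\<in>S. measure lebesgue (?I p))"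
    unfolding rise_def using interval_familiesD[OF S] by (intro sum.cong) (auto simp: less_imp_le)
  also have "\<dots> = measure lebesgue (\<Union>p\<in>S. ?I p)"
  proof (rule measure_finite_Union[symmetric])
    show "?I ` S \<subseteq> sets lebesgue" by auto
    show "disjoint_family_on ?I S" using S by (simp add: interval_families_def)
    show "emeasure lebesgue (?I p) \<noteq> \<infinity>" for p
      using emeasure_lborel_box_finite[of "fst p" "snd p"] by (cases p) (simp add: less_top)
  qed (rule fin)
  also have "\<dots> \<le> measure lebesgue A"
  proof (rule measure_mono_fmeasurable)
    show "(\<Union>p\<in>S. ?I p) \<in> sets lebesgue" by (auto intro!: sets.finite_UN fin split: prod.splits)
  qed (use sub A in auto)
  finally show ?thesis .
qed

lemma length_interval_family:
  assumes S: "S \<in> interval_families x y" and "x \<le> y"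
  shows "rise (\<lambda>t. t) S \<le> y - x"
proof -
  have "rise (\<lambda>t. t) S \<le> measure lebesgue {x..y}"
  proof (rule length_interval_family_le_measure[OF S])
    fix u v assume "(u, v) \<in> S"
    then show "{u<..<v} \<subseteq> {x..y}" using interval_familiesD(2,4)[OF S, of u v] by auto
  qed simp
  then show ?thesis using \<open>x \<le> y\<close> by simp
qed

text \<open>Every interval is cut at \<open>y\<close>. The rise splits exactly because
\<open>g v - g u = (g (min v y) - g (min u y)) + (g (max v y) - g (max u y))\<close>, and one
of the two brackets vanishes for an interval on one side of \<open>y\<close>.\<close>

lemma interval_family_split:
  assumes S: "S \<in> interval_families x z" and "x \<le> y" "y \<le> z"
  obtains S1 S2 where "S1 \<in> interval_families x y" "S2 \<in> interval_families y z"
    "\<And>g. rise g S = rise g S1 + rise g S2"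
proof -
  note D = interval_familiesD[OF S]
  define L where "L = {(u, v)\<in>S. u < y}"
  define R where "R = {(u, v)\<in>S. y < v}"
  define cutl where "cutl = (\<lambda>(u::real, v). (u, min v y))"
  define cutr where "cutr = (\<lambda>(u::real, v::real). (max u y, v))"
  have injl: "inj_on cutl L"
  proof (rule inj_onI, clarify)
    fix u v u' v' assume "(u, v) \<in> L" "(u', v') \<in> L" "cutl (u, v) = cutl (u', v')"
    then have *: "(u, v) \<in> S" "(u', v') \<in> S" "u' = u" by (auto simp: L_def cutl_def)
    then have "u < min v v'" using D(3) by simp
    then obtain t where "u < t" "t < min v v'" using dense by blast
    then show "u = u' \<and> v = v'" using D(5)[OF *(1,2), of t] * by simp
  qed
  have injr: "inj_on cutr R"
  proof (rule inj_onI, clarify)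
    fix u v u' v' assume "(u, v) \<in> R" "(u', v') \<in> R" "cutr (u, v) = cutr (u', v')"
    then have *: "(u, v) \<in> S" "(u', v') \<in> S" "v' = v" by (auto simp: R_def cutr_def)
    then have "max u u' < v" using D(3) by simp
    then obtain t where "max u u' < t" "t < v" using dense by blast
    then show "u = u' \<and> v = v'" using D(5)[OF *(1,2), of t] * by simp
  qed
  have finL: "finite L" and finR: "finite R"
    using D(1) by (auto simp: L_def R_def intro: finite_subset)
  show ?thesis
  proof
    show "cutl ` L \<in> interval_families x y"
    proof (rule interval_familiesI)
      fix u v assume "(u, v) \<in> cutl ` L"
      then show "x \<le> u \<and> u < v \<and> v \<le> y" using D(2,3) by (auto simp: cutl_def L_def min_def)
    next
      fix u v u' v' t assume a: "(u, v) \<in> cutl ` L" "(u', v') \<in> cutl ` L" "u < t" "t < v" "u' < t" "t < v'"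
      then obtain w w' where "(u, w) \<in> S" "(u', w') \<in> S" "v = min w y" "v' = min w' y"
        by (auto simp: cutl_def L_def)
      then show "u = u' \<and> v = v'" using D(5)[of u w u' w' t] a by auto
    qed (use finL in simp)
    show "cutr ` R \<in> interval_families y z"
    proof (rule interval_familiesI)
      fix u v assume "(u, v) \<in> cutr ` R"
      then show "y \<le> u \<and> u < v \<and> v \<le> z" using D(3,4) by (auto simp: cutr_def R_def max_def)
    next
      fix u v u' v' t assume a: "(u, v) \<in> cutr ` R" "(u', v') \<in> cutr ` R" "u < t" "t < v" "u' < t" "t < v'"
      then obtain w w' where "(w, v) \<in> S" "(w', v') \<in> S" "u = max w y" "u' = max w' y"
        by (auto simp: cutr_def R_def)
      then show "u = u' \<and> v = v'" using D(5)[of w v w' v' t] a by auto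
    qed (use finR in simp)
    fix g :: "real \<Rightarrow> real"
    have "rise g S = (\<Sum>(u, v)\<in>S. g (min v y) - g (min u y)) + (\<Sum>(u, v)\<in>S. g (max v y) - g (max u y))"
      unfolding rise_def sum.distrib[symmetric]
      by (intro sum.cong) (auto simp: min_def max_def)
    also have "(\<Sum>(u, v)\<in>S. g (min v y) - g (min u y)) = (\<Sum>(u, v)\<in>L. g (min v y) - g (min u y))"
      using D(1,3) by (intro sum.mono_neutral_right) (force simp: L_def min_def)+
    also have "\<dots> = rise g (cutl ` L)"
      unfolding rise_def sum.reindex[OF injl]
      by (intro sum.cong) (auto simp: cutl_def L_def)
    also have "(\<Sum>(u, v)\<in>S. g (max v y) - g (max u y)) = (\<Sum>(u, v)\<in>R. g (max v y) - g (max u y))"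
      using D(1,3) by (intro sum.mono_neutral_right) (force simp: R_def max_def)+
    also have "\<dots> = rise g (cutr ` R)"
      unfolding rise_def sum.reindex[OF injr]
      by (intro sum.cong) (auto simp: cutr_def R_def)
    finally show "rise g S = rise g (cutl ` L) + rise g (cutr ` R)" .
  qed
qed

text \<open>Families chosen inside the members of a family form one larger family. This lets a bound
for all families act on finer families that are chosen interval by interval.\<close>

lemma interval_family_UN:
  assumes D: "D \<in> interval_families c d"
    and T: "\<And>u v. (u, v) \<in> D \<Longrightarrow> T (u, v) \<in> interval_families u v"
  shows "(\<Union>p\<in>D. T p) \<in> interval_families c d"
    and "rise g (\<Union>p\<in>D. T p) = (\<Sum>p\<in>D. rise g (T p))"
proof -
  note D' = interval_familiesD[OF D]
  have same: "p = q" if "p \<in> D" "q \<in> D" "(u, v) \<in> T p" "(u', v') \<in> T q" "u < t" "t < v" "u' < t" "t < v'"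
    for p q u v u' v' t
  proof -
    obtain a b a' b' where pq: "p = (a, b)" "q = (a', b')" by (cases p; cases q)
    have "a \<le> u" "v \<le> b" "a' \<le> u'" "v' \<le> b'"
      using interval_familiesD(2,4)[OF T] that pq by blast+
    then show ?thesis using D'(5)[of a b a' b' t] that pq by auto
  qed
  have lt: "u < v" if "p \<in> D" "(u, v) \<in> T p" for p u v
    using T that interval_familiesD(3) by (cases p) blast
  show "(\<Union>p\<in>D. T p) \<in> interval_families c d"
  proof (rule interval_familiesI)
    show "finite (\<Union>p\<in>D. T p)"
      using D'(1) interval_familiesD(1)[OF T] by auto
  next
    fix u v assume "(u, v) \<in> (\<Union>p\<in>D. T p)"
    then obtain a b where "(a, b) \<in> D" "(u, v) \<in> T (a, b)" by auto
    then have "c \<le> a" "b \<le> d" "a \<le> u" "u < v" "v \<le> b"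
      using D'(2,4) interval_familiesD(2,3,4)[OF T] by blast+
    then show "c \<le> u \<and> u < v \<and> v \<le> d" by auto
  next
    fix u v u' v' t
    assume "(u, v) \<in> (\<Union>p\<in>D. T p)" "(u', v') \<in> (\<Union>p\<in>D. T p)" and t: "u < t" "t < v" "u' < t" "t < v'"
    then obtain p q where pq: "p \<in> D" "q \<in> D" "(u, v) \<in> T p" "(u', v') \<in> T q" by blast
    then have "p = q" using same t by blast
    then show "u = u' \<and> v = v'"
      using pq t interval_familiesD(5)[OF T] by (cases p) blast
  qed
  show "rise g (\<Union>p\<in>D. T p) = (\<Sum>p\<in>D. rise g (T p))"
    unfolding rise_def
  proof (rule sum.UNION_disjoint)
    show "\<forall>p\<in>D. finite (T p)" using interval_familiesD(1)[OF T] by auto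
    show "\<forall>p\<in>D. \<forall>q\<in>D. p \<noteq> q \<longrightarrow> T p \<inter> T q = {}"
    proof (intro ballI impI, rule ccontr)
      fix p q assume pq: "p \<in> D" "q \<in> D" "p \<noteq> q" "T p \<inter> T q \<noteq> {}"
      then obtain u v where uv: "(u, v) \<in> T p" "(u, v) \<in> T q" by auto
      obtain t where "u < t" "t < v" using lt uv pq dense by blast
      then show False using same uv pq by blast
    qed
  qed (use D'(1) in simp)
qed

definition pos_var :: "(real \<Rightarrow> real) \<Rightarrow> real \<Rightarrow> real \<Rightarrow> real" where
  "pos_var g x y = (SUP S\<in>interval_families x y. rise g S)"

text \<open>The Jordan decomposition \<open>g = V - (V - g)\<close> with \<open>V = pos_var g c\<close>: adding the interval from
\<open>x\<close> to \<open>y\<close> to a family in \<open>[c, x]\<close> shows that \<open>V - g\<close> increases, and cutting at \<open>x\<close> bounds the increments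
of \<open>V\<close> from above.\<close>

lemma pos_var_props:
  assumes B: "\<And>S. S \<in> interval_families c d \<Longrightarrow> rise g S \<le> B"
    and xy: "c \<le> x" "x \<le> y" "y \<le> d"
  shows "pos_var g c x \<le> pos_var g c y"
    and "pos_var g c x + (g y - g x) \<le> pos_var g c y"
    and "pos_var g c y \<le> pos_var g c x + pos_var g x y"
proof -
  have bdd: "bdd_above (rise g ` interval_families u v)" if "c \<le> u" "v \<le> d" for u v
    using B interval_families_mono[OF that] by (intro bdd_aboveI2[where M=B]) auto
  have up: "rise g S \<le> pos_var g u v" if "S \<in> interval_families u v" "c \<le> u" "v \<le> d" for S u v
    unfolding pos_var_def using that bdd by (intro cSUP_upper) auto
  have le: "pos_var g u v \<le> M" if "\<And>S. S \<in> interval_families u v \<Longrightarrow> rise g S \<le> M" for u v M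
    unfolding pos_var_def using that empty_interval_family by (intro cSUP_least) blast+
  show "pos_var g c x \<le> pos_var g c y"
    using interval_families_mono[of c c x y] xy up by (intro le) auto
  show "pos_var g c x + (g y - g x) \<le> pos_var g c y"
  proof (cases "x = y")
    case False
    have "pos_var g c x \<le> pos_var g c y - (g y - g x)"
    proof (rule le)
      fix S assume S: "S \<in> interval_families c x"
      note D = interval_familiesD[OF S]
      have new: "(x, y) \<notin> S" using D(4) xy False by force
      have "insert (x, y) S \<in> interval_families c y"
      proof (rule interval_familiesI)
        fix u v u' v' t
        assume "(u, v) \<in> insert (x, y) S" "(u', v') \<in> insert (x, y) S"
          "u < t" "t < v" "u' < t" "t < v'"
        then show "u = u' \<and> v = v'"
          using D(5)[of u v u' v' t] D(4)[of u v] D(4)[of u' v'] by auto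
      next
        fix u v assume "(u, v) \<in> insert (x, y) S"
        then show "c \<le> u \<and> u < v \<and> v \<le> y"
          using D(2,3,4)[of u v] xy False by auto
      qed (use D(1) in simp)
      then have "rise g (insert (x, y) S) \<le> pos_var g c y" using up xy by blast
      then show "rise g S \<le> pos_var g c y - (g y - g x)"
        using new D(1) by (simp add: rise_def)
    qed
    then show ?thesis by simp
  qed simp
  show "pos_var g c y \<le> pos_var g c x + pos_var g x y"
  proof (rule le)
    fix S assume "S \<in> interval_families c y"
    then obtain S1 S2 where "S1 \<in> interval_families c x" "S2 \<in> interval_families x y"
      "rise g S = rise g S1 + rise g S2"
      using interval_family_split xy by metis
    then show "rise g S \<le> pos_var g c x + pos_var g x y"
      using up[of S1 c x] up[of S2 x y] xy by simp
  qed
qed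

text \<open>Inside each interval of \<open>D\<close> a family is chosen that nearly attains the positive variation
there. The union of these families is no longer than \<open>D\<close>, so the absolute continuity of \<open>g\<close> applies
to it.\<close>

lemma pos_var_absolutely_continuous:
  assumes B: "\<And>S. S \<in> interval_families c d \<Longrightarrow> rise g S \<le> B"
    and \<epsilon>: "\<And>S. S \<in> interval_families c d \<Longrightarrow> rise (\<lambda>t. t) S < \<delta> \<Longrightarrow> rise g S \<le> \<epsilon>"
    and D: "D \<in> interval_families c d" and len: "rise (\<lambda>t. t) D < \<delta>"
  shows "rise (pos_var g c) D \<le> \<epsilon>"
proof (rule field_le_epsilon)
  fix \<eta> :: real assume "\<eta> > 0"
  note D' = interval_familiesD[OF D]
  \<comment> \<open>the allowed total error, shared out evenly; the 1 covers empty \<open>D\<close>\<close>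
  define k where "k = \<eta> / (card D + 1)"
  have "k > 0" using \<open>\<eta> > 0\<close> by (simp add: k_def)
  have "\<exists>S\<in>interval_families (fst p) (snd p). pos_var g (fst p) (snd p) - k < rise g S" for p
  proof (rule ccontr)
    assume "\<not> ?thesis"
    then have "pos_var g (fst p) (snd p) \<le> pos_var g (fst p) (snd p) - k"
      unfolding pos_var_def[of g "fst p" "snd p"]
      by (intro cSUP_least) (use empty_interval_family[of "fst p" "snd p"] in \<open>auto simp: not_less pos_var_def simp del: empty_interval_family\<close>)
    then show False using \<open>k > 0\<close> by simp
  qed
  then obtain T where T: "\<And>p. T p \<in> interval_families (fst p) (snd p)"
    and Tk: "\<And>p. pos_var g (fst p) (snd p) - k < rise g (T p)"
    by metis
  let ?U = "\<Union>p\<in>D. T p"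
  have T': "T (u, v) \<in> interval_families u v" for u v using T[of "(u, v)"] by simp
  have U: "?U \<in> interval_families c d" "rise h ?U = (\<Sum>p\<in>D. rise h (T p))" for h
    using interval_family_UN[OF D, of T] T' by blast+
  have "rise (\<lambda>t. t) ?U \<le> rise (\<lambda>t. t) D"
    unfolding U(2) unfolding rise_def[of _ D]
    proof (rule sum_mono, clarify)
    fix u v assume "(u, v) \<in> D"
    then show "rise (\<lambda>t. t) (T (u, v)) \<le> v - u"
      using length_interval_family[OF T'] D'(3) by (simp add: less_imp_le)
  qed
  then have Ue: "rise g ?U \<le> \<epsilon>" using \<epsilon> U(1) len by simp
  have "rise (pos_var g c) D \<le> (\<Sum>p\<in>D. rise g (T p) + k)"
    unfolding rise_def[of _ D]
  proof (rule sum_mono, clarify)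
    fix u v assume uv: "(u, v) \<in> D"
    then have "pos_var g c v \<le> pos_var g c u + pos_var g u v"
      using D'(2,3,4) by (intro pos_var_props(3)[OF B]) (auto simp: less_imp_le)
    then show "pos_var g c v - pos_var g c u \<le> rise g (T (u, v)) + k"
      using Tk[of "(u, v)"] by simp
  qed
  also have "\<dots> = rise g ?U + card D * k"
    unfolding U(2) by (simp add: sum.distrib)
  also have "\<dots> \<le> \<epsilon> + \<eta>"
    using Ue \<open>\<eta> > 0\<close> by (intro add_mono) (auto simp: k_def field_simps)
  finally show "rise (pos_var g c) D \<le> \<epsilon> + \<eta>" .
qed

section \<open>Absolutely continuous functions as indefinite integrals\<close>

text \<open>The Stieltjes measure of \<open>V\<close> charges no Lebesgue null set: such a set is covered by
countably many nonoverlapping intervals of small total length, and over finitely many of those \<open>V\<close>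
rises only a little. The density is then supplied by the Radon-Nikodym theorem.\<close>

lemma monotone_absolutely_continuous_density:
  fixes V :: "real \<Rightarrow> real"
  assumes cd: "c < d"
    and mono: "\<And>x y. c \<le> x \<Longrightarrow> x \<le> y \<Longrightarrow> y \<le> d \<Longrightarrow> V x \<le> V y"
    and ac: "\<And>\<epsilon>. \<epsilon> > 0 \<Longrightarrow> \<exists>\<delta>>0. \<forall>D\<in>interval_families c d. rise (\<lambda>t. t) D < \<delta> \<longrightarrow> rise V D \<le> \<epsilon>"
  obtains \<phi> :: "real \<Rightarrow> real" where "\<phi> absolutely_integrable_on {c..d}"
    and "\<And>x. c \<le> x \<Longrightarrow> x \<le> d \<Longrightarrow> (\<phi> has_integral (V x - V c)) {c..x}"
proof -
  \<comment> \<open>clamping the argument extends \<open>V\<close> to a monotone function on the line\<close>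
  define W where "W x = V (max c (min d x))" for x
  have Wmono: "W x \<le> W y" if "x \<le> y" for x y
    unfolding W_def using cd that by (intro mono) auto
  have WV: "W x = V x" if "c \<le> x" "x \<le> d" for x
    using that by (simp add: W_def)
  have close: "\<exists>\<delta>>0. \<forall>x y. x \<le> y \<and> y - x < \<delta> \<longrightarrow> W y - W x \<le> \<epsilon>" if \<epsilon>: "\<epsilon> > 0" for \<epsilon>
  proof -
    obtain \<delta> where \<delta>: "\<delta> > 0" "\<And>D. D \<in> interval_families c d \<Longrightarrow> rise (\<lambda>t. t) D < \<delta> \<Longrightarrow> rise V D \<le> \<epsilon>"
      using ac[OF \<epsilon>] by blast
    have "W y - W x \<le> \<epsilon>" if xy: "x \<le> y" "y - x < \<delta>" for x y
    proof -
      define x' y' where "x' = max c (min d x)" and "y' = max c (min d y)"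
      have *: "c \<le> x'" "x' \<le> y'" "y' \<le> d" "y' - x' < \<delta>"
        using cd xy \<delta>(1) by (auto simp: x'_def y'_def)
      show ?thesis
      proof (cases "x' = y'")
        case False
        then have "{(x', y')} \<in> interval_families c d"
          using * by (intro interval_familiesI) auto
        from \<delta>(2)[OF this] * show ?thesis by (simp add: rise_def W_def x'_def y'_def)
      qed (use \<epsilon> in \<open>simp add: W_def x'_def y'_def\<close>)
    qed
    with \<delta>(1) show ?thesis by blast
  qed
  have Wcont: "continuous_on UNIV W"
    unfolding continuous_on_iff
  proof (intro ballI allI impI)
    fix x e :: real assume "e > 0"
    then obtain \<delta> where \<delta>: "\<delta> > 0" "\<And>x y. x \<le> y \<Longrightarrow> y - x < \<delta> \<Longrightarrow> W y - W x \<le> e / 2"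
      using close[of "e / 2"] by auto
    have "dist (W y) (W x) < e" if "dist y x < \<delta>" for y
      using \<delta>(2)[of x y] \<delta>(2)[of y x] Wmono[of x y] Wmono[of y x] that \<open>e > 0\<close>
      by (auto simp: dist_real_def abs_if split: if_splits)
    then show "\<exists>\<delta>>0. \<forall>x'\<in>UNIV. dist x' x < \<delta> \<longrightarrow> dist (W x') (W x) < e"
      using \<delta>(1) by blast
  qed
  define \<nu> where "\<nu> = interval_measure W"
  have Icc: "emeasure \<nu> {u..v} = ennreal (W v - W u)" if "u \<le> v" for u v
    unfolding \<nu>_def by (rule emeasure_interval_measure_Icc[OF that Wmono Wcont])
  have sets\<nu> [measurable_cong, simp]: "sets \<nu> = sets borel" by (simp add: \<nu>_def)
  have null: "emeasure \<nu> ({c..d} \<inter> A) = 0" if A: "A \<in> null_sets lborel" for A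
  proof (rule antisym)
    have A': "{c..d} \<inter> A \<in> null_sets lebesgue"
      using null_set_Int1[OF A, of "{c..d}"] by (auto intro!: null_sets_completionI simp: Int_commute)
    show "emeasure \<nu> ({c..d} \<inter> A) \<le> 0"
    proof (rule ennreal_le_epsilon)
      fix e :: real assume "e > 0"
      then obtain \<delta> where \<delta>: "\<delta> > 0" "\<And>D. D \<in> interval_families c d \<Longrightarrow> rise (\<lambda>t. t) D < \<delta> \<Longrightarrow> rise V D \<le> e"
        using ac by blast
      have "{c..d} \<inter> A \<in> lmeasurable" "{c..d} \<inter> A \<subseteq> cbox c d" "\<delta> / 2 > 0"
        using A' \<delta>(1) by (auto intro: fmeasurableI_null_sets)
      then obtain \<D> where \<D>: "countable \<D>"
        "\<And>K. K \<in> \<D> \<Longrightarrow> K \<subseteq> cbox c d \<and> K \<noteq> {} \<and> (\<exists>u v. K = cbox u v)"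
        "pairwise (\<lambda>A B. interior A \<inter> interior B = {}) \<D>"
        "\<And>K. \<lbrakk>K \<in> \<D>; box c d \<noteq> {}\<rbrakk> \<Longrightarrow> interior K \<noteq> {}"
        "{c..d} \<inter> A \<subseteq> \<Union>\<D>" "\<Union>\<D> \<in> lmeasurable"
        "measure lebesgue (\<Union>\<D>) \<le> measure lebesgue ({c..d} \<inter> A) + \<delta> / 2"
        by (rule measurable_outer_intervals_bounded) blast
      have \<D>sets: "K \<in> sets borel" if "K \<in> \<D>" for K using \<D>(2)[OF that] by auto
      have small: "measure lebesgue (\<Union>\<D>) < \<delta>"
        using \<D>(7) A' \<delta>(1) by (simp add: null_sets_def measure_def)
      have ends: "K = {Inf K..Sup K} \<and> Inf K < Sup K \<and> c \<le> Inf K \<and> Sup K \<le> d" if KD: "K \<in> \<D>" for K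
      proof -
        obtain u v where K: "K = {u..v}" using \<D>(2)[OF KD] by auto
        moreover have "u < v" using \<D>(4)[OF KD] cd K by auto
        moreover have "K \<subseteq> {c..d}" using \<D>(2)[OF KD] by simp
        ultimately show ?thesis by auto
      qed
      \<comment> \<open>finitely many covering intervals form an interval family, to which the hypothesis on \<open>V\<close> applies\<close>
      have fin: "emeasure \<nu> (\<Union>F) \<le> ennreal e" if F: "finite F" "F \<subseteq> \<D>" for F
      proof -
        define D where "D = (\<lambda>K::real set. (Inf K, Sup K)) ` F"
        have inj: "inj_on (\<lambda>K::real set. (Inf K, Sup K)) F"
          using ends F(2) by (intro inj_onI) (metis Pair_inject subsetD)
        have D: "D \<in> interval_families c d"
        proof (rule interval_familiesI)
          show "finite D" using F(1) by (simp add: D_def)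
          show "c \<le> u \<and> u < v \<and> v \<le> d" if "(u, v) \<in> D" for u v
            using that ends F(2) by (auto simp: D_def)
          fix u v u' v' t
          assume "(u, v) \<in> D" "(u', v') \<in> D" and t: "u < t" "t < v" "u' < t" "t < v'"
          then obtain K L where KL: "K \<in> F" "L \<in> F" "u = Inf K" "v = Sup K" "u' = Inf L" "v' = Sup L"
            by (auto simp: D_def)
          have "K \<in> \<D>" "L \<in> \<D>" using KL F by auto
          then have "t \<in> interior K" "t \<in> interior L"
            using ends[of K] ends[of L] t KL by (metis greaterThanLessThan_iff interior_atLeastAtMost_real)+
          then have "K = L"
            using \<D>(3) \<open>K \<in> \<D>\<close> \<open>L \<in> \<D>\<close> by (auto simp: pairwise_def)
          then show "u = u' \<and> v = v'" using KL by simp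
        qed
        have "rise (\<lambda>t. t) D \<le> measure lebesgue (\<Union>\<D>)"
        proof (rule length_interval_family_le_measure[OF D \<D>(6)])
          fix u v assume "(u, v) \<in> D"
          then obtain K where "K \<in> F" "u = Inf K" "v = Sup K" by (auto simp: D_def)
          then show "{u<..<v} \<subseteq> \<Union>\<D>"
            using ends[of K] F(2) greaterThanLessThan_subseteq_atLeastAtMost_iff by blast
        qed
        then have riseV: "rise V D \<le> e" using \<delta>(2)[OF D] small by simp
        have "emeasure \<nu> (\<Union>F) \<le> (\<Sum>K\<in>F. emeasure \<nu> K)"
          using emeasure_subadditive_finite[of F "\<lambda>K. K" \<nu>] F \<D>sets by auto
        also have "\<dots> = (\<Sum>K\<in>F. ennreal (V (Sup K) - V (Inf K)))"
        proof (rule sum.cong[OF refl])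
          fix K assume "K \<in> F"
          then have K: "K = {Inf K..Sup K}" "Inf K < Sup K" "c \<le> Inf K" "Sup K \<le> d"
            using ends F(2) by blast+
          have "emeasure \<nu> K = emeasure \<nu> {Inf K..Sup K}" using K(1) by simp
          also have "\<dots> = ennreal (V (Sup K) - V (Inf K))"
            using K(2-4) by (subst Icc) (auto simp: WV)
          finally show "emeasure \<nu> K = ennreal (V (Sup K) - V (Inf K))" .
        qed
        also have "\<dots> = ennreal (\<Sum>K\<in>F. V (Sup K) - V (Inf K))"
        proof (rule sum_ennreal)
          fix K assume "K \<in> F"
          then have "Inf K < Sup K" "c \<le> Inf K" "Sup K \<le> d" using ends F(2) by blast+
          then show "0 \<le> V (Sup K) - V (Inf K)" using mono[of "Inf K" "Sup K"] by simp
        qed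
        also have "(\<Sum>K\<in>F. V (Sup K) - V (Inf K)) = rise V D"
          unfolding rise_def D_def by (simp add: sum.reindex[OF inj])
        finally show ?thesis using riseV by (meson ennreal_leI order_trans)
      qed
      have "emeasure \<nu> (\<Union>\<D>) \<le> ennreal e"
      proof (cases "\<D> = {}")
        case False
        define G where "G n = \<Union>(from_nat_into \<D> ` {..<n})" for n
        have sub: "from_nat_into \<D> ` {..<n} \<subseteq> \<D>" for n
          using from_nat_into[OF False] by blast
        have "(SUP n. emeasure \<nu> (G n)) = emeasure \<nu> (\<Union>n. G n)"
        proof (rule SUP_emeasure_incseq)
          show "range G \<subseteq> sets \<nu>"
            using sub \<D>sets by (auto simp: G_def intro!: sets.finite_UN)
          show "incseq G" by (auto simp: incseq_def G_def) (meson lessThan_iff less_le_trans)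
        qed
        also have "(\<Union>n. G n) = \<Union>\<D>"
        proof -
          have "(\<Union>n. G n) = \<Union>(range (from_nat_into \<D>))" by (auto simp: G_def)
          then show ?thesis using range_from_nat_into[OF False \<D>(1)] by simp
        qed
        finally have "emeasure \<nu> (\<Union>\<D>) = (SUP n. emeasure \<nu> (G n))" by simp
        also have "\<dots> \<le> ennreal e"
          using sub by (intro SUP_least) (auto simp: G_def intro!: fin)
        finally show ?thesis .
      qed simp
      moreover have "emeasure \<nu> ({c..d} \<inter> A) \<le> emeasure \<nu> (\<Union>\<D>)"
        using \<D>(5) \<D>(1) \<D>sets by (intro emeasure_mono) auto
      ultimately show "emeasure \<nu> ({c..d} \<inter> A) \<le> 0 + ennreal e" by simp
    qed
  qed simp
  define N where "N = density \<nu> (indicator {c..d})"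
  have N: "emeasure N A = emeasure \<nu> ({c..d} \<inter> A)" if "A \<in> sets borel" for A
    unfolding N_def using that by (intro emeasure_restricted) auto
  have "absolutely_continuous lborel N"
    unfolding absolutely_continuous_def
    using null N by (auto simp: null_sets_def N_def)
  then obtain \<psi> where \<psi>: "\<psi> \<in> borel_measurable lborel" "density lborel \<psi> = N"
    using sigma_finite_measure.Radon_Nikodym[OF sigma_finite_lborel, of N] by (auto simp: N_def)
  have [measurable]: "\<psi> \<in> borel_measurable borel" using \<psi>(1) by simp
  define \<phi> where "\<phi> x = enn2real (\<psi> x)" for x
  have \<psi>Icc: "(\<integral>\<^sup>+x. \<psi> x * indicator {c..x'} x \<partial>lborel) = ennreal (V x' - V c)" if "c \<le> x'" "x' \<le> d" for x'
  proof -
    have "(\<integral>\<^sup>+x. \<psi> x * indicator {c..x'} x \<partial>lborel) = emeasure N {c..x'}"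
      by (simp add: \<psi>(2)[symmetric] emeasure_density)
    also have "\<dots> = emeasure \<nu> {c..x'}" using that by (simp add: N Int_absorb1)
    finally show ?thesis using that by (simp add: Icc WV)
  qed
  have integ: "integrable lborel (\<lambda>x. \<phi> x * indicator {c..x'} x)"
    "integral\<^sup>L lborel (\<lambda>x. \<phi> x * indicator {c..x'} x) = V x' - V c" if x': "c \<le> x'" "x' \<le> d" for x'
  proof -
    have "AE x in lborel. \<psi> x * indicator {c..x'} x \<noteq> \<infinity>"
      using \<psi>Icc[OF x'] by (intro nn_integral_noteq_infinite) auto
    then have "(\<integral>\<^sup>+x. ennreal (\<phi> x * indicator {c..x'} x) \<partial>lborel) = (\<integral>\<^sup>+x. \<psi> x * indicator {c..x'} x \<partial>lborel)"
      by (intro nn_integral_cong_AE) (auto simp: \<phi>_def indicator_def less_top elim!: eventually_mono)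
    then have *: "(\<integral>\<^sup>+x. ennreal (\<phi> x * indicator {c..x'} x) \<partial>lborel) = ennreal (V x' - V c)"
      using \<psi>Icc[OF x'] by simp
    show int: "integrable lborel (\<lambda>x. \<phi> x * indicator {c..x'} x)"
      using * by (intro integrableI_nonneg) (auto simp: \<phi>_def)
    show "integral\<^sup>L lborel (\<lambda>x. \<phi> x * indicator {c..x'} x) = V x' - V c"
      using * mono[of c x'] x'
      by (subst integral_eq_nn_integral) (auto simp: \<phi>_def)
  qed
  show thesis
  proof
    show "\<phi> absolutely_integrable_on {c..d}"
      using integ(1)[of d] cd unfolding set_integrable_def
      by (auto simp: mult.commute intro: integrable_completion[THEN iffD2])
    fix x assume "c \<le> x" "x \<le> d"
    then have "((\<lambda>t. \<phi> t * indicator {c..x} t) has_integral (V x - V c)) UNIV"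
      using has_integral_integral_lborel[OF integ(1)[of x]] integ(2)[of x] by simp
    then show "(\<phi> has_integral (V x - V c)) {c..x}"
      by (subst has_integral_restrict_UNIV[symmetric])
         (auto elim!: has_integral_eq_rhs has_integral_eq[rotated] simp: indicator_def)
  qed
qed

lemma short_absolutely_continuous_density:
  fixes g :: "real \<Rightarrow> real"
  assumes cd: "c < d"
    and bound: "\<And>S. S \<in> interval_families c d \<Longrightarrow> rise g S \<le> B"
    and ac: "\<And>\<epsilon>. \<epsilon> > 0 \<Longrightarrow> \<exists>\<delta>>0. \<forall>D\<in>interval_families c d. rise (\<lambda>t. t) D < \<delta> \<longrightarrow> \<bar>rise g D\<bar> \<le> \<epsilon>"
  obtains \<phi> :: "real \<Rightarrow> real" where "\<phi> absolutely_integrable_on {c..d}"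
    and "\<And>x. c \<le> x \<Longrightarrow> x \<le> d \<Longrightarrow> (\<phi> has_integral (g x - g c)) {c..x}"
proof -
  define V where "V = pos_var g c"
  define U where "U x = V x - g x" for x
  have V: "V x \<le> V y" "V x + (g y - g x) \<le> V y" if "c \<le> x" "x \<le> y" "y \<le> d" for x y
    using pos_var_props(1,2)[OF bound] that unfolding V_def by blast+
  have acV: "\<exists>\<delta>>0. \<forall>D\<in>interval_families c d. rise (\<lambda>t. t) D < \<delta> \<longrightarrow> rise V D \<le> \<epsilon>"
    "\<exists>\<delta>>0. \<forall>D\<in>interval_families c d. rise (\<lambda>t. t) D < \<delta> \<longrightarrow> rise U D \<le> \<epsilon>"
    if "\<epsilon> > 0" for \<epsilon>
  proof -
    have e2: "\<epsilon> / 2 > 0" using that by simp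
    obtain \<delta> where \<delta>: "\<delta> > 0"
      "\<And>D. D \<in> interval_families c d \<Longrightarrow> rise (\<lambda>t. t) D < \<delta> \<Longrightarrow> \<bar>rise g D\<bar> \<le> \<epsilon> / 2"
      using ac[OF e2] by blast
    have "rise V D \<le> \<epsilon> \<and> rise U D \<le> \<epsilon>"
      if D: "D \<in> interval_families c d" "rise (\<lambda>t. t) D < \<delta>" for D
    proof -
      have "rise V D \<le> \<epsilon> / 2"
        unfolding V_def using \<delta>(2) D by (intro pos_var_absolutely_continuous[OF bound]) force+
      moreover have "rise U D = rise V D - rise g D"
        unfolding rise_def U_def by (simp add: sum_subtractf[symmetric] algebra_simps split_beta)
      ultimately show ?thesis using \<delta>(2)[OF D] \<open>\<epsilon> > 0\<close> by linarith
    qed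
    then show "\<exists>\<delta>>0. \<forall>D\<in>interval_families c d. rise (\<lambda>t. t) D < \<delta> \<longrightarrow> rise V D \<le> \<epsilon>"
      "\<exists>\<delta>>0. \<forall>D\<in>interval_families c d. rise (\<lambda>t. t) D < \<delta> \<longrightarrow> rise U D \<le> \<epsilon>"
      using \<delta>(1) by blast+
  qed
  obtain \<phi> where \<phi>: "\<phi> absolutely_integrable_on {c..d}"
    "\<And>x. c \<le> x \<Longrightarrow> x \<le> d \<Longrightarrow> (\<phi> has_integral (V x - V c)) {c..x}"
    using monotone_absolutely_continuous_density[OF cd V(1) acV(1)] by metis
  have "U x \<le> U y" if "c \<le> x" "x \<le> y" "y \<le> d" for x y
    using V(2)[OF that] by (simp add: U_def)
  note Umono = this
  obtain \<psi> where \<psi>: "\<psi> absolutely_integrable_on {c..d}"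
    "\<And>x. c \<le> x \<Longrightarrow> x \<le> d \<Longrightarrow> (\<psi> has_integral (U x - U c)) {c..x}"
    using monotone_absolutely_continuous_density[OF cd Umono acV(2)] by metis
  show thesis
  proof
    show "(\<lambda>x. \<phi> x - \<psi> x) absolutely_integrable_on {c..d}"
      using \<phi>(1) \<psi>(1) by (rule set_integral_diff)
    fix x assume "c \<le> x" "x \<le> d"
    from has_integral_diff[OF \<phi>(2)[OF this] \<psi>(2)[OF this]]
    show "((\<lambda>x. \<phi> x - \<psi> x) has_integral (g x - g c)) {c..x}" by (simp add: U_def)
  qed
qed

text \<open>Lebesgue's differentiation theorem in one variable. The proposition
\<open>integrable_ccontinuous_explicit\<close> deals with averages over intervals to the right of a point;
averages to the left are averages to the right for the reflected function.\<close>

lemma indefinite_integral_has_derivative_AE: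
  fixes f :: "real \<Rightarrow> 'a::euclidean_space"
  assumes f: "f integrable_on {c..d}"
  obtains N where "negligible N"
    and "\<And>x. c < x \<Longrightarrow> x < d \<Longrightarrow> x \<notin> N \<Longrightarrow>
           ((\<lambda>y. integral {c..y} f) has_vector_derivative f x) (at x)"
proof -
  define h where "h x = (if x \<in> {c..d} then f x else 0)" for x
  have hU: "h integrable_on UNIV"
    using f unfolding h_def by (subst integrable_restrict_UNIV)
  have h: "h integrable_on cbox a b" for a b
    using integrable_on_subcbox[OF hU] by blast
  have h': "(\<lambda>x. h (- x)) integrable_on cbox a b" for a b
    using h[of "- b" "- a"] Henstock_Kurzweil_Integration.integrable_reflect_real[where f=h and a="- b" and b="- a"] by simp
  obtain N1 where N1: "negligible N1"
    "\<And>x e. \<lbrakk>x \<notin> N1; 0 < e\<rbrakk> \<Longrightarrow> \<exists>k>0. \<forall>t. 0 < t \<and> t < k \<longrightarrow>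
       norm (integral (cbox x (x + t *\<^sub>R One)) h /\<^sub>R t ^ DIM(real) - h x) < e"
    using integrable_ccontinuous_explicit[OF h] by blast
  obtain N2 where N2: "negligible N2"
    "\<And>x e. \<lbrakk>x \<notin> N2; 0 < e\<rbrakk> \<Longrightarrow> \<exists>k>0. \<forall>t. 0 < t \<and> t < k \<longrightarrow>
       norm (integral (cbox x (x + t *\<^sub>R One)) (\<lambda>x. h (- x)) /\<^sub>R t ^ DIM(real) - h (- x)) < e"
    using integrable_ccontinuous_explicit[OF h'] by blast
  show thesis
  proof
    show "negligible (N1 \<union> uminus ` N2)"
      using N1(1) N2(1)
      by (auto intro!: negligible_Un negligible_differentiable_image_negligible derivative_intros)
    fix x assume x: "c < x" "x < d" "x \<notin> N1 \<union> uminus ` N2"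
    then have xN: "x \<notin> N1" "- x \<notin> N2" by (auto simp: image_iff)
    have fx: "h x = f x" using x by (simp add: h_def)
    have eq: "integral {u..v} h = integral {u..v} f" if "c \<le> u" "v \<le> d" for u v
      using that by (intro integral_cong) (auto simp: h_def)
    have fsub: "f integrable_on {u..v}" if "c \<le> u" "v \<le> d" for u v
      using integrable_on_subinterval[OF f] that by auto
    show "((\<lambda>y. integral {c..y} f) has_vector_derivative f x) (at x)"
      unfolding has_vector_derivative_def has_derivative_at_within
    proof (intro conjI)
      show "bounded_linear (\<lambda>t. t *\<^sub>R f x)" by (rule bounded_linear_scaleR_left)
      show "((\<lambda>y. (integral {c..y} f - integral {c..x} f - (y - x) *\<^sub>R f x) /\<^sub>R norm (y - x)) \<longlongrightarrow> 0) (at x)"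
      proof (rule LIM_I)
        fix e :: real assume "e > 0"
        obtain k1 where k1: "k1 > 0" "\<And>t. 0 < t \<Longrightarrow> t < k1 \<Longrightarrow> norm (integral {x..x + t} h /\<^sub>R t - h x) < e"
          using N1(2)[OF xN(1) \<open>e > 0\<close>] by auto
        obtain k2 where k2: "k2 > 0" "\<And>t. 0 < t \<Longrightarrow> t < k2 \<Longrightarrow>
            norm (integral {- x..- x + t} (\<lambda>x. h (- x)) /\<^sub>R t - h x) < e"
          using N2(2)[OF xN(2) \<open>e > 0\<close>] by auto
        define k where "k = min (min k1 k2) (min (x - c) (d - x))"
        have "k > 0" using k1 k2 x by (simp add: k_def)
        have "norm ((integral {c..y} f - integral {c..x} f - (y - x) *\<^sub>R f x) /\<^sub>R norm (y - x)) < e"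
          if y: "y \<noteq> x" "norm (y - x) < k" for y
        proof (cases "x < y")
          case True
          have "integral {c..y} f = integral {c..x} f + integral {x..y} f"
            using True x y by (intro Henstock_Kurzweil_Integration.integral_combine[symmetric] fsub) (auto simp: k_def)
          then have "(integral {c..y} f - integral {c..x} f - (y - x) *\<^sub>R f x) /\<^sub>R norm (y - x)
            = integral {x..y} h /\<^sub>R (y - x) - h x"
            using True x y eq[of x y] by (simp add: fx k_def scaleR_diff_right)
          then show ?thesis using k1(2)[of "y - x"] True y by (simp add: k_def)
        next
          case False
          then have yx: "y < x" using y by simp
          have "integral {c..x} f = integral {c..y} f + integral {y..x} f"
            using yx x y by (intro Henstock_Kurzweil_Integration.integral_combine[symmetric] fsub) (auto simp: k_def)
          moreover have "integral {- x..- x + (x - y)} (\<lambda>x. h (- x)) = integral {y..x} h"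
            using Henstock_Kurzweil_Integration.integral_reflect_real[of x y h] by simp
          moreover have "integral {y..x} h = integral {y..x} f" using yx x y eq[of y x] by (simp add: k_def)
          moreover have "(A - (A + I) - (y - x) *\<^sub>R z) /\<^sub>R norm (y - x) = - (I /\<^sub>R (x - y) - z)" for A I z :: 'a
          proof -
            obtain r where "r > 0" and y_eq: "y = x - r" using yx by (metis diff_gt_0_iff_gt diff_diff_eq2 add_diff_cancel_left')
            then show ?thesis unfolding y_eq by (simp add: scaleR_diff_right)
          qed
          ultimately have "(integral {c..y} f - integral {c..x} f - (y - x) *\<^sub>R f x) /\<^sub>R norm (y - x)
            = - (integral {- x..- x + (x - y)} (\<lambda>x. h (- x)) /\<^sub>R (x - y) - h x)"
            by (simp only: fx)
          then show ?thesis using k2(2)[of "x - y"] yx y by (simp add: k_def norm_minus_commute)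
        qed
        then show "\<exists>s>0. \<forall>y. y \<noteq> x \<and> norm (y - x) < s \<longrightarrow>
            norm ((integral {c..y} f - integral {c..x} f - (y - x) *\<^sub>R f x) /\<^sub>R norm (y - x) - 0) < e"
          using \<open>k > 0\<close> by auto
      qed
    qed
  qed
qed

section \<open>The fundamental theorem of calculus and integration by parts\<close>

lemma absolutely_continuous_onE:
  assumes "absolutely_continuous_on I g" and "\<epsilon> > 0"
  obtains \<delta> where "\<delta> > 0"
    and "\<And>S. finite S \<Longrightarrow> (\<And>u v. (u, v) \<in> S \<Longrightarrow> u < v \<and> {u..v} \<subseteq> I) \<Longrightarrow>
      disjoint_family_on (\<lambda>(u, v). {u<..<v}) S \<Longrightarrow> (\<Sum>(u, v)\<in>S. v - u) < \<delta> \<Longrightarrow>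
      (\<Sum>(u, v)\<in>S. norm (g v - g u)) < \<epsilon>"
proof -
  have "\<exists>\<delta>>0. \<forall>S. finite S \<and> (\<forall>(a, b)\<in>S. a < b \<and> {a..b} \<subseteq> I) \<and>
        disjoint_family_on (\<lambda>(a, b). {a<..<b}) S \<and> (\<Sum>(a, b)\<in>S. b - a) < \<delta>
        \<longrightarrow> (\<Sum>(a, b)\<in>S. norm (g b - g a)) < \<epsilon>"
    using assms unfolding absolutely_continuous_on_def by simp
  then obtain \<delta> where \<delta>: "\<delta> > 0" "\<forall>S. finite S \<and> (\<forall>(a, b)\<in>S. a < b \<and> {a..b} \<subseteq> I) \<and>
        disjoint_family_on (\<lambda>(a, b). {a<..<b}) S \<and> (\<Sum>(a, b)\<in>S. b - a) < \<delta>
        \<longrightarrow> (\<Sum>(a, b)\<in>S. norm (g b - g a)) < \<epsilon>"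
    by (elim exE conjE)
  show thesis
    by (rule that[OF \<delta>(1)], rule \<delta>(2)[rule_format]) auto
qed

lemma absolutely_continuous_on_interval_families:
  assumes g: "absolutely_continuous_on I g" and "\<epsilon> > 0"
  obtains \<delta> where "\<delta> > 0"
    and "\<And>c d S. {c..d} \<subseteq> I \<Longrightarrow> S \<in> interval_families c d \<Longrightarrow> rise (\<lambda>t. t) S < \<delta> \<Longrightarrow>
           (\<Sum>(u, v)\<in>S. norm (g v - g u)) < \<epsilon>"
proof -
  obtain \<delta> where \<delta>: "\<delta> > 0" "\<And>S. finite S \<Longrightarrow> (\<And>u v. (u, v) \<in> S \<Longrightarrow> u < v \<and> {u..v} \<subseteq> I) \<Longrightarrow>
      disjoint_family_on (\<lambda>(u, v). {u<..<v}) S \<Longrightarrow> (\<Sum>(u, v)\<in>S. v - u) < \<delta> \<Longrightarrow>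
      (\<Sum>(u, v)\<in>S. norm (g v - g u)) < \<epsilon>"
    by (rule absolutely_continuous_onE[OF g \<open>\<epsilon> > 0\<close>]) blast
  show thesis
  proof (rule that[OF \<delta>(1)])
    fix c d S assume cd: "{c..d} \<subseteq> I" and S: "S \<in> interval_families c d" "rise (\<lambda>t. t) S < \<delta>"
    have "u < v \<and> {u..v} \<subseteq> I" if "(u, v) \<in> S" for u v
    proof -
      have "c \<le> u" "u < v" "v \<le> d" using interval_familiesD(2-4)[OF S(1) that] by blast+
      then show ?thesis using cd by auto
    qed
    with S show "(\<Sum>(u, v)\<in>S. norm (g v - g u)) < \<epsilon>"
      by (intro \<delta>(2)) (auto simp: interval_families_def rise_def)
  qed
qed

lemma absolutely_continuous_imp_continuous_on:
  assumes g: "absolutely_continuous_on {a..b} g"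
  shows "continuous_on {a..b} g"
  unfolding continuous_on_iff
proof (intro ballI allI impI)
  fix x e :: real assume x: "x \<in> {a..b}" and "e > 0"
  obtain \<delta> where \<delta>: "\<delta> > 0" "\<And>c d S. {c..d} \<subseteq> {a..b} \<Longrightarrow> S \<in> interval_families c d \<Longrightarrow>
      rise (\<lambda>t. t) S < \<delta> \<Longrightarrow> (\<Sum>(u, v)\<in>S. norm (g v - g u)) < e"
    by (rule absolutely_continuous_on_interval_families[OF g \<open>e > 0\<close>]) blast
  have *: "norm (g v - g u) < e" if "a \<le> u" "u < v" "v \<le> b" "v - u < \<delta>" for u v
    using \<delta>(2)[of u v "{(u, v)}"] that
    by (auto simp: rise_def interval_families_def disjoint_family_on_def)
  have "dist (g y) (g x) < e" if "y \<in> {a..b}" "dist y x < \<delta>" for y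
    using *[of x y] *[of y x] that x \<open>e > 0\<close>
    by (cases x y rule: linorder_cases) (auto simp: dist_norm norm_minus_commute)
  then show "\<exists>\<delta>>0. \<forall>x'\<in>{a..b}. dist x' x < \<delta> \<longrightarrow> dist (g x') (g x) < e"
    using \<delta>(1) by blast
qed

text \<open>Almost everywhere differentiability together with the evaluation formula, as one property of
an interval: it is inherited by the union of two adjacent intervals, so it only has to be shown on
short ones. The derivative is the total function \<open>vector_derivative\<close>, which fixes the integrand
independently of the interval.\<close>

definition fundamental_theorem_on :: "(real \<Rightarrow> complex) \<Rightarrow> real \<Rightarrow> real \<Rightarrow> bool" where
  "fundamental_theorem_on g c d \<longleftrightarrow>
     (\<exists>N. negligible N \<and> (\<forall>x. c < x \<and> x < d \<and> x \<notin> N \<longrightarrow> g differentiable (at x))) \<and>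
     (\<lambda>t. vector_derivative g (at t)) absolutely_integrable_on {c..d} \<and>
     ((\<lambda>t. vector_derivative g (at t)) has_integral (g d - g c)) {c..d}"

lemma fundamental_theorem_on_combine:
  assumes "fundamental_theorem_on g c d" "fundamental_theorem_on g d e" "c \<le> d" "d \<le> e"
  shows "fundamental_theorem_on g c e"
proof -
  let ?D = "\<lambda>t. vector_derivative g (at t)"
  obtain N N' where "negligible N" "\<forall>x. c < x \<and> x < d \<and> x \<notin> N \<longrightarrow> g differentiable (at x)"
    "negligible N'" "\<forall>x. d < x \<and> x < e \<and> x \<notin> N' \<longrightarrow> g differentiable (at x)"
    using assms unfolding fundamental_theorem_on_def by blast
  then have "negligible (insert d (N \<union> N')) \<and>
      (\<forall>x. c < x \<and> x < e \<and> x \<notin> insert d (N \<union> N') \<longrightarrow> g differentiable (at x))"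
    using assms(3,4) by (auto simp: not_less) (meson linorder_cases)
  then have "\<exists>M. negligible M \<and> (\<forall>x. c < x \<and> x < e \<and> x \<notin> M \<longrightarrow> g differentiable (at x))"
    by (rule exI)
  moreover have "?D absolutely_integrable_on {c..e}"
  proof -
    have "?D absolutely_integrable_on {c..d} \<union> {d..e}"
      using assms unfolding fundamental_theorem_on_def by (intro set_integrable_Un) auto
    also have "{c..d} \<union> {d..e} = {c..e}" using assms by auto
    finally show ?thesis .
  qed
  moreover have "(?D has_integral (g d - g c) + (g e - g d)) {c..e}"
    using assms unfolding fundamental_theorem_on_def
    by (intro has_integral_combine[of c d e]) auto
  ultimately show ?thesis unfolding fundamental_theorem_on_def by simp
qed

text \<open>Real and imaginary part are indefinite integrals by the Jordan decomposition; the resulting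
complex density is the derivative at almost every point by Lebesgue's differentiation theorem.\<close>

lemma fundamental_theorem_on_short:
  assumes cd: "c < d"
    and bound: "\<And>S. S \<in> interval_families c d \<Longrightarrow> (\<Sum>(u, v)\<in>S. norm (g v - g u)) \<le> B"
    and ac: "\<And>\<epsilon>. \<epsilon> > 0 \<Longrightarrow> \<exists>\<delta>>0. \<forall>S\<in>interval_families c d. rise (\<lambda>t. t) S < \<delta> \<longrightarrow>
               (\<Sum>(u, v)\<in>S. norm (g v - g u)) \<le> \<epsilon>"
  shows "fundamental_theorem_on g c d"
proof -
  have part: "\<exists>\<phi>::real \<Rightarrow> real. \<phi> absolutely_integrable_on {c..d} \<and>
      (\<forall>x. c \<le> x \<and> x \<le> d \<longrightarrow> (\<phi> has_integral (h (g x) - h (g c))) {c..x})"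
    if h: "\<And>z w. \<bar>h z - h w\<bar> \<le> norm (z - w)" for h :: "complex \<Rightarrow> real"
  proof -
    have le: "\<bar>rise (\<lambda>x. h (g x)) S\<bar> \<le> (\<Sum>(u, v)\<in>S. norm (g v - g u))" for S
      unfolding rise_def by (rule order_trans[OF sum_abs]) (auto intro!: sum_mono h)
    have b: "rise (\<lambda>x. h (g x)) S \<le> B" if "S \<in> interval_families c d" for S
      using bound[OF that] le[of S] by simp
    have a: "\<exists>\<delta>>0. \<forall>S\<in>interval_families c d. rise (\<lambda>t. t) S < \<delta> \<longrightarrow> \<bar>rise (\<lambda>x. h (g x)) S\<bar> \<le> \<epsilon>"
      if "\<epsilon> > 0" for \<epsilon>
      using ac[OF that] le by (meson order_trans)
    show ?thesis
      using short_absolutely_continuous_density[OF cd b a] by metis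
  qed
  obtain \<phi> where \<phi>: "\<phi> absolutely_integrable_on {c..d}"
    "\<And>x. c \<le> x \<Longrightarrow> x \<le> d \<Longrightarrow> (\<phi> has_integral (Re (g x) - Re (g c))) {c..x}"
    using part[of Re] abs_Re_le_cmod by (metis minus_complex.simps(1))
  obtain \<psi> where \<psi>: "\<psi> absolutely_integrable_on {c..d}"
    "\<And>x. c \<le> x \<Longrightarrow> x \<le> d \<Longrightarrow> (\<psi> has_integral (Im (g x) - Im (g c))) {c..x}"
    using part[of Im] abs_Im_le_cmod by (metis minus_complex.simps(2))
  define f where "f x = of_real (\<phi> x) + \<i> * of_real (\<psi> x)" for x
  have f_int: "(f has_integral (g x - g c)) {c..x}" if "c \<le> x" "x \<le> d" for x
  proof -
    have "(f has_integral (of_real (Re (g x) - Re (g c)) + \<i> * of_real (Im (g x) - Im (g c)))) {c..x}"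
      unfolding f_def using that
      by (intro has_integral_add has_integral_mult_right has_integral_of_real \<phi>(2) \<psi>(2))
    also have "of_real (Re (g x) - Re (g c)) + \<i> * of_real (Im (g x) - Im (g c)) = g x - g c"
      by (simp add: complex_eq_iff)
    finally show ?thesis .
  qed
  have f_abs: "f absolutely_integrable_on {c..d}"
    unfolding f_def using \<phi>(1) \<psi>(1)
    by (intro set_integral_add set_integrable_mult_right) (auto simp: set_integrable_def scaleR_conv_of_real
        simp flip: of_real_mult intro: integrable_of_real)
  have "f integrable_on {c..d}" using f_int[of d] cd by (intro has_integral_integrable[of f "g d - g c"]) simp
  then obtain N where N: "negligible N" "\<And>x. c < x \<Longrightarrow> x < d \<Longrightarrow> x \<notin> N \<Longrightarrow>
      ((\<lambda>y. integral {c..y} f) has_vector_derivative f x) (at x)"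
    using indefinite_integral_has_derivative_AE by blast
  have deriv: "(g has_vector_derivative f x) (at x)" if x: "c < x" "x < d" "x \<notin> N" for x
  proof -
    have "((\<lambda>y. g c + integral {c..y} f) has_vector_derivative f x) (at x)"
      using has_vector_derivative_add[OF has_vector_derivative_const N(2)[OF x], of "g c"] by simp
    then show ?thesis
    proof (rule has_vector_derivative_transform_within_open[where S="{c<..<d}"])
      fix y assume "y \<in> {c<..<d}"
      then show "g c + integral {c..y} f = g y"
        using integral_unique[OF f_int[of y]] by simp
    qed (use x in auto)
  qed
  have eq: "vector_derivative g (at t) = f t" if "t \<in> {c..d} - (N \<union> {c, d})" for t
    using deriv[of t] that by (intro vector_derivative_at) auto
  have neg: "negligible (N \<union> {c, d})" using N(1) by simp
  have "(\<lambda>t. vector_derivative g (at t)) absolutely_integrable_on {c..d}"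
    by (rule absolutely_integrable_spike[OF f_abs neg]) (use eq in auto)
  moreover have "((\<lambda>t. vector_derivative g (at t)) has_integral (g d - g c)) {c..d}"
    using cd by (intro has_integral_spike[OF neg _ f_int[of d]] eq) auto
  moreover have "\<forall>x. c < x \<and> x < d \<and> x \<notin> N \<longrightarrow> g differentiable (at x)"
    using deriv by (meson differentiableI_vector)
  ultimately show ?thesis unfolding fundamental_theorem_on_def using N(1) by blast
qed

text \<open>Let \<open>\<delta>\<close> belong to \<open>\<epsilon> = 1\<close>. On an interval shorter than \<open>\<delta>\<close> every family has total length below
\<open>\<delta>\<close>, so the variation is at most 1 there; finitely many such intervals cover \<open>[a, x]\<close>.\<close>

theorem absolutely_continuous_fundamental_theorem:
  assumes g: "absolutely_continuous_on {a..b} g" and ab: "a < x" "x \<le> b"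
  shows "fundamental_theorem_on g a x"
proof -
  obtain \<delta> where \<delta>: "\<delta> > 0" "\<And>c d S. {c..d} \<subseteq> {a..b} \<Longrightarrow> S \<in> interval_families c d \<Longrightarrow>
      rise (\<lambda>t. t) S < \<delta> \<Longrightarrow> (\<Sum>(u, v)\<in>S. norm (g v - g u)) < 1"
    by (rule absolutely_continuous_on_interval_families[OF g zero_less_one]) blast
  have short: "fundamental_theorem_on g c d" if cd: "c < d" "a \<le> c" "d \<le> b" "d - c < \<delta>" for c d
  proof (rule fundamental_theorem_on_short[OF cd(1)])
    have sub: "{c..d} \<subseteq> {a..b}" using cd by auto
    fix S assume S: "S \<in> interval_families c d"
    have "rise (\<lambda>t. t) S \<le> d - c" using length_interval_family[OF S] cd by simp
    then show "(\<Sum>(u, v)\<in>S. norm (g v - g u)) \<le> 1"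
      using \<delta>(2)[OF sub S] cd by simp
  next
    fix \<epsilon> :: real assume "\<epsilon> > 0"
    have sub: "{c..d} \<subseteq> {a..b}" using cd by auto
    obtain \<delta>' where "\<delta>' > 0" "\<And>c d S. {c..d} \<subseteq> {a..b} \<Longrightarrow> S \<in> interval_families c d \<Longrightarrow>
      rise (\<lambda>t. t) S < \<delta>' \<Longrightarrow> (\<Sum>(u, v)\<in>S. norm (g v - g u)) < \<epsilon>"
      by (rule absolutely_continuous_on_interval_families[OF g \<open>\<epsilon> > 0\<close>]) blast
    then show "\<exists>\<delta>>0. \<forall>S\<in>interval_families c d. rise (\<lambda>t. t) S < \<delta> \<longrightarrow>
               (\<Sum>(u, v)\<in>S. norm (g v - g u)) \<le> \<epsilon>"
      using sub by (intro exI[of _ \<delta>']) (auto simp: less_imp_le)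
  qed
  have main: "a < x \<Longrightarrow> x \<le> b \<Longrightarrow> x - a < real (Suc n) * (\<delta> / 2) \<Longrightarrow> fundamental_theorem_on g a x" for n x
  proof (induction n arbitrary: x)
    case 0
    then show ?case using \<delta>(1) by (intro short) auto
  next
    case (Suc n)
    show ?case
    proof (cases "x - \<delta> / 2 \<le> a")
      case True
      then show ?thesis using Suc.prems \<delta>(1) by (intro short) auto
    next
      case False
      have "fundamental_theorem_on g a (x - \<delta> / 2)"
        using False Suc.prems \<delta>(1) by (intro Suc.IH) (auto simp: algebra_simps)
      moreover have "fundamental_theorem_on g (x - \<delta> / 2) x"
        using False Suc.prems \<delta>(1) by (intro short) auto
      ultimately show ?thesis
        by (rule fundamental_theorem_on_combine) (use False \<delta>(1) in auto)
    qed
  qed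
  obtain n where "x - a < real n * (\<delta> / 2)"
    using reals_Archimedean3[of "\<delta> / 2"] \<delta>(1) by (meson half_gt_zero)
  then have "x - a < real (Suc n) * (\<delta> / 2)"
    using \<delta>(1) by (simp add: algebra_simps)
  from main[OF ab this] show ?thesis .
qed

lemma absolutely_continuous_C1_mult:
  fixes h :: "real \<Rightarrow> real"
  assumes g: "absolutely_continuous_on {a..b} g"
    and h: "\<And>t. t \<in> {a..b} \<Longrightarrow> (h has_real_derivative h' t) (at t)"
    and h': "continuous_on {a..b} h'"
  shows "absolutely_continuous_on {a..b} (\<lambda>t. of_real (h t) * g t)"
proof -
  obtain L where L: "L > 0" "\<And>t. t \<in> {a..b} \<Longrightarrow> \<bar>h' t\<bar> \<le> L"
    using compact_imp_bounded[OF compact_continuous_image[OF h' compact_Icc]]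
    unfolding bounded_pos by auto
  have "continuous_on {a..b} h"
    using h by (meson DERIV_isCont continuous_at_imp_continuous_on)
  from compact_imp_bounded[OF compact_continuous_image[OF this compact_Icc]]
  obtain M where M: "M > 0" "\<And>t. t \<in> {a..b} \<Longrightarrow> \<bar>h t\<bar> \<le> M"
    unfolding bounded_pos by auto
  from compact_imp_bounded[OF compact_continuous_image[OF absolutely_continuous_imp_continuous_on[OF g] compact_Icc]]
  obtain G where G: "G > 0" "\<And>t. t \<in> {a..b} \<Longrightarrow> norm (g t) \<le> G"
    unfolding bounded_pos by auto
  have hLip: "\<bar>h v - h u\<bar> \<le> L * (v - u)" if uv: "u < v" "{u..v} \<subseteq> {a..b}" for u v
  proof -
    have "norm (h v - h u) \<le> L * norm (v - u)"
    proof (rule field_differentiable_bound[where S="{u..v}" and f'=h'])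
      show "(h has_field_derivative h' z) (at z within {u..v})" if "z \<in> {u..v}" for z
        using h[of z] uv that by (auto intro: has_field_derivative_at_within)
      show "norm (h' z) \<le> L" if "z \<in> {u..v}" for z using L(2)[of z] uv that by auto
    qed (use uv in auto)
    then show ?thesis using uv by simp
  qed
  have step: "norm (of_real (h v) * g v - of_real (h u) * g u) \<le> M * norm (g v - g u) + G * L * (v - u)"
    if uv: "u < v" "{u..v} \<subseteq> {a..b}" for u v
  proof -
    have "of_real (h v) * g v - of_real (h u) * g u = of_real (h v) * (g v - g u) + of_real (h v - h u) * g u"
      by (simp add: algebra_simps)
    then have "norm (of_real (h v) * g v - of_real (h u) * g u) \<le> \<bar>h v\<bar> * norm (g v - g u) + \<bar>h v - h u\<bar> * norm (g u)"
      by (metis norm_mult norm_of_real norm_triangle_ineq)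
    also have "\<dots> \<le> M * norm (g v - g u) + (L * (v - u)) * G"
      using uv M(2)[of v] G(2)[of u] hLip[OF uv] L(1) M(1) by (intro add_mono mult_mono) auto
    finally show ?thesis by (simp add: algebra_simps)
  qed
  show ?thesis
    unfolding absolutely_continuous_on_def
  proof (intro allI impI)
    fix \<epsilon> :: real assume "\<epsilon> > 0"
    then have "\<epsilon> / (2 * M) > 0" using M(1) by simp
    obtain \<delta> where \<delta>: "\<delta> > 0" "\<And>S. finite S \<Longrightarrow> (\<And>u v. (u, v) \<in> S \<Longrightarrow> u < v \<and> {u..v} \<subseteq> {a..b}) \<Longrightarrow>
      disjoint_family_on (\<lambda>(u, v). {u<..<v}) S \<Longrightarrow> (\<Sum>(u, v)\<in>S. v - u) < \<delta> \<Longrightarrow>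
      (\<Sum>(u, v)\<in>S. norm (g v - g u)) < \<epsilon> / (2 * M)"
      by (rule absolutely_continuous_onE[OF g \<open>\<epsilon> / (2 * M) > 0\<close>]) blast
    define \<eta> where "\<eta> = min \<delta> (\<epsilon> / (2 * (G * L)))"
    have "\<eta> > 0" using \<delta>(1) \<open>\<epsilon> > 0\<close> G(1) L(1) by (simp add: \<eta>_def)
    moreover have "(\<Sum>(u, v)\<in>S. norm (of_real (h v) * g v - of_real (h u) * g u)) < \<epsilon>"
      if S: "finite S" "\<forall>(u, v)\<in>S. u < v \<and> {u..v} \<subseteq> {a..b}"
        "disjoint_family_on (\<lambda>(u, v). {u<..<v}) S" "(\<Sum>(u, v)\<in>S. v - u) < \<eta>" for S
    proof -
      have "(\<Sum>(u, v)\<in>S. norm (of_real (h v) * g v - of_real (h u) * g u))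
          \<le> (\<Sum>(u, v)\<in>S. M * norm (g v - g u) + G * L * (v - u))"
        using S(2) by (intro sum_mono) (auto intro!: step)
      also have "\<dots> = M * (\<Sum>(u, v)\<in>S. norm (g v - g u)) + G * L * (\<Sum>(u, v)\<in>S. v - u)"
        by (simp add: sum.distrib sum_distrib_left split_beta)
      also have "\<dots> < M * (\<epsilon> / (2 * M)) + G * L * (\<epsilon> / (2 * (G * L)))"
        using S \<delta>(2)[OF S(1) _ S(3)] M(1) G(1) L(1)
        by (intro add_strict_mono mult_strict_left_mono) (auto simp: \<eta>_def)
      also have "\<dots> = \<epsilon>" using M(1) G(1) L(1) by (simp add: field_simps)
      finally show ?thesis .
    qed
    ultimately show "\<exists>\<delta>>0. \<forall>S. finite S \<and> (\<forall>(u, v)\<in>S. u < v \<and> {u..v} \<subseteq> {a..b}) \<and>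
        disjoint_family_on (\<lambda>(u, v). {u<..<v}) S \<and> (\<Sum>(u, v)\<in>S. v - u) < \<delta> \<longrightarrow>
        (\<Sum>(u, v)\<in>S. norm (of_real (h v) * g v - of_real (h u) * g u)) < \<epsilon>"
      by blast
  qed
qed

text \<open>The fundamental theorem for the product \<open>h g\<close>, which is again absolutely continuous. Equal
boundary values, as for periodic functions, leave no boundary term.\<close>

lemma absolutely_continuous_integration_by_parts:
  fixes h :: "real \<Rightarrow> real"
  assumes ab: "a < b" and g: "absolutely_continuous_on {a..b} g"
    and h: "\<And>t. t \<in> {a..b} \<Longrightarrow> (h has_real_derivative h' t) (at t)"
    and h': "continuous_on {a..b} h'"
    and ends: "of_real (h a) * g a = of_real (h b) * g b"
  shows "((\<lambda>t. of_real (h' t) * g t + of_real (h t) * vector_derivative g (at t)) has_integral 0) {a..b}"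
proof -
  have "fundamental_theorem_on (\<lambda>t. of_real (h t) * g t) a b"
    using absolutely_continuous_fundamental_theorem[OF absolutely_continuous_C1_mult[OF g h h'] ab] by simp
  then have *: "((\<lambda>t. vector_derivative (\<lambda>t. of_real (h t) * g t) (at t)) has_integral 0) {a..b}"
    using ends by (simp add: fundamental_theorem_on_def)
  obtain N where N: "negligible N" "\<And>t. a < t \<Longrightarrow> t < b \<Longrightarrow> t \<notin> N \<Longrightarrow> g differentiable (at t)"
    using absolutely_continuous_fundamental_theorem[OF g ab] unfolding fundamental_theorem_on_def by auto
  have "negligible (N \<union> {a, b})" using N(1) by simp
  then show ?thesis
  proof (rule has_integral_spike[OF _ _ *])
    fix t assume t: "t \<in> {a..b} - (N \<union> {a, b})"
    then have "(g has_vector_derivative vector_derivative g (at t)) (at t)"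
      using N(2)[of t] by (simp add: vector_derivative_works)
    moreover have "((\<lambda>t. of_real (h t)) has_vector_derivative (of_real (h' t) :: complex)) (at t)"
      using h[of t] t by (intro has_vector_derivative_of_real) (auto simp: has_real_derivative_iff_has_vector_derivative)
    ultimately have "((\<lambda>t. of_real (h t) * g t) has_vector_derivative
        (of_real (h t) * vector_derivative g (at t) + of_real (h' t) * g t)) (at t)"
      by (intro has_vector_derivative_mult)
    from vector_derivative_at[OF this]
    show "of_real (h' t) * g t + of_real (h t) * vector_derivative g (at t) = vector_derivative (\<lambda>t. of_real (h t) * g t) (at t)"
      by simp
  qed
qed

section \<open>Rotations and boundary weights in the disc\<close>

lemma nn_integral_lborel_complex:
  assumes h [measurable]: "h \<in> borel_measurable borel"
  shows "(\<integral>\<^sup>+z. h z \<partial>lborel) = (\<integral>\<^sup>+y. \<integral>\<^sup>+x. h (Complex x y) \<partial>lborel \<partial>lborel)"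
    and "(\<integral>\<^sup>+z. h z \<partial>lborel) = (\<integral>\<^sup>+x. \<integral>\<^sup>+y. h (Complex x y) \<partial>lborel \<partial>lborel)"
proof -
  have C: "(\<lambda>(x, y). Complex x y) = (\<lambda>p. of_real (fst p) + \<i> * of_real (snd p))"
    by (auto simp: complex_eq_iff)
  have C_meas [measurable]: "(\<lambda>(x, y). Complex x y) \<in> borel_measurable (lborel \<Otimes>\<^sub>M lborel)"
    unfolding C by measurable
  have distr: "lborel = distr (lborel \<Otimes>\<^sub>M lborel) borel (\<lambda>(x, y). Complex x y)"
  proof (rule lborel_eqI)
    fix l u :: complex assume lu: "\<And>b. b \<in> Basis \<Longrightarrow> l \<bullet> b \<le> u \<bullet> b"
    have le: "Re l \<le> Re u" "Im l \<le> Im u" using lu[of 1] lu[of \<i>] by (auto simp: Basis_complex_def)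
    have "(\<lambda>(x, y). Complex x y) -` box l u \<inter> space (lborel \<Otimes>\<^sub>M lborel) = {Re l<..<Re u} \<times> {Im l<..<Im u}"
      by (auto simp: in_box_complex_iff space_pair_measure)
    then show "emeasure (distr (lborel \<Otimes>\<^sub>M lborel) borel (\<lambda>(x, y). Complex x y)) (box l u) = (\<Prod>b\<in>Basis. (u - l) \<bullet> b)"
      using le by (subst emeasure_distr)
        (auto simp: lborel.emeasure_pair_measure_Times Basis_complex_def ennreal_mult)
  qed simp
  have "(\<integral>\<^sup>+z. h z \<partial>lborel) = (\<integral>\<^sup>+z. h z \<partial>distr (lborel \<Otimes>\<^sub>M lborel) borel (\<lambda>(x, y). Complex x y))"
    by (subst distr) simp
  also have "\<dots> = (\<integral>\<^sup>+p. h (case p of (x, y) \<Rightarrow> Complex x y) \<partial>(lborel \<Otimes>\<^sub>M lborel))"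
    by (rule nn_integral_distr[OF C_meas]) simp
  finally have *: "(\<integral>\<^sup>+z. h z \<partial>lborel) = (\<integral>\<^sup>+(x, y). h (Complex x y) \<partial>(lborel \<Otimes>\<^sub>M lborel))"
    by (simp add: case_prod_unfold)
  have m: "(\<lambda>(x, y). h (Complex x y)) \<in> borel_measurable (lborel \<Otimes>\<^sub>M lborel)"
    using measurable_compose[OF C_meas h] by (simp add: split_beta)
  show "(\<integral>\<^sup>+z. h z \<partial>lborel) = (\<integral>\<^sup>+y. \<integral>\<^sup>+x. h (Complex x y) \<partial>lborel \<partial>lborel)"
    using lborel_pair.nn_integral_snd[OF m] by (simp add: *)
  show "(\<integral>\<^sup>+z. h z \<partial>lborel) = (\<integral>\<^sup>+x. \<integral>\<^sup>+y. h (Complex x y) \<partial>lborel \<partial>lborel)"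
    using lborel.nn_integral_fst[OF m] by (simp add: *)
qed

lemma measurable_Complex [measurable]:
  assumes [measurable]: "f \<in> borel_measurable M" "g \<in> borel_measurable M"
  shows "(\<lambda>x. Complex (f x) (g x)) \<in> borel_measurable M"
proof -
  have "(\<lambda>x. Complex (f x) (g x)) = (\<lambda>x. of_real (f x) + \<i> * of_real (g x))"
    by (auto simp: complex_eq_iff)
  then show ?thesis by simp
qed

lemma nn_integral_shear:
  fixes h :: "complex \<Rightarrow> ennreal" and t :: real
  assumes h [measurable]: "h \<in> borel_measurable borel"
  shows "(\<integral>\<^sup>+z. h (Complex (Re z + t * Im z) (Im z)) \<partial>lborel) = (\<integral>\<^sup>+z. h z \<partial>lborel)"
    and "(\<integral>\<^sup>+z. h (Complex (Re z) (Im z + t * Re z)) \<partial>lborel) = (\<integral>\<^sup>+z. h z \<partial>lborel)"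
proof -
  have "(\<integral>\<^sup>+x. h (Complex (x + t * y) y) \<partial>lborel) = (\<integral>\<^sup>+x. h (Complex x y) \<partial>lborel)" for y
    using nn_integral_real_affine[of "\<lambda>x. h (Complex x y)" 1 "t * y"] by (simp add: add.commute)
  then show "(\<integral>\<^sup>+z. h (Complex (Re z + t * Im z) (Im z)) \<partial>lborel) = (\<integral>\<^sup>+z. h z \<partial>lborel)"
    by (simp add: nn_integral_lborel_complex(1))
  have "(\<integral>\<^sup>+y. h (Complex x (y + t * x)) \<partial>lborel) = (\<integral>\<^sup>+y. h (Complex x y) \<partial>lborel)" for x
    using nn_integral_real_affine[of "\<lambda>y. h (Complex x y)" 1 "t * x"] by (simp add: add.commute)
  then show "(\<integral>\<^sup>+z. h (Complex (Re z) (Im z + t * Re z)) \<partial>lborel) = (\<integral>\<^sup>+z. h z \<partial>lborel)"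
    by (simp add: nn_integral_lborel_complex(2))
qed

text \<open>A rotation by \<open>s\<close> is a product of three shears, with parameters \<open>- tan (s / 2)\<close>, \<open>sin s\<close> and
\<open>- tan (s / 2)\<close>. A shear preserves area by Tonelli's theorem and translation invariance on lines.\<close>

lemma nn_integral_rotate_small:
  fixes h :: "complex \<Rightarrow> ennreal"
  assumes h [measurable]: "h \<in> borel_measurable borel" and s: "\<bar>s\<bar> < pi"
  shows "(\<integral>\<^sup>+z. h (cis s * z) \<partial>lborel) = (\<integral>\<^sup>+z. h z \<partial>lborel)"
proof -
  define t where "t = tan (s / 2)"
  define X where "X = (\<lambda>z. Complex (Re z + (- t) * Im z) (Im z))"
  define Y where "Y = (\<lambda>z. Complex (Re z) (Im z + sin s * Re z))"
  have [measurable]: "X \<in> borel_measurable borel" "Y \<in> borel_measurable borel"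
    unfolding X_def Y_def by measurable
  have c: "cos (s / 2) > 0" using s by (intro cos_gt_zero_pi) auto
  have sin_s: "sin s = 2 * sin (s / 2) * cos (s / 2)" using sin_double[of "s / 2"] by simp
  have cos_s: "cos s = 2 * (cos (s / 2))\<^sup>2 - 1" "cos s = 1 - 2 * (sin (s / 2))\<^sup>2"
    using cos_double_cos[of "s / 2"] cos_double_sin[of "s / 2"] by simp_all
  have 1: "sin s * t = 1 - cos s"
    using c by (simp add: t_def tan_def sin_s cos_s(2) power2_eq_square)
  have 2: "t * (1 + cos s) = sin s"
    using c by (simp add: t_def tan_def sin_s cos_s(1) power2_eq_square)
  have rot: "cis s * z = X (Y (X z))" for z
  proof -
    have "Re z + (- t) * Im z + (- t) * (Im z + sin s * (Re z + (- t) * Im z))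
        = (1 - sin s * t) * Re z - (t * (1 + (1 - sin s * t))) * Im z"
      by (simp add: algebra_simps)
    also have "\<dots> = cos s * Re z - sin s * Im z" by (simp add: 1 2)
    finally have re: "Re (X (Y (X z))) = Re (cis s * z)" by (simp add: X_def Y_def)
    have "Im z + sin s * (Re z + (- t) * Im z) = sin s * Re z + (1 - sin s * t) * Im z"
      by (simp add: algebra_simps)
    also have "\<dots> = sin s * Re z + cos s * Im z" by (simp add: 1)
    finally have "Im (X (Y (X z))) = Im (cis s * z)" by (simp add: X_def Y_def add.commute)
    with re show ?thesis by (simp add: complex_eq_iff)
  qed
  have "(\<integral>\<^sup>+z. h (cis s * z) \<partial>lborel) = (\<integral>\<^sup>+z. h (X (Y (X z))) \<partial>lborel)" by (simp add: rot)
  also have "\<dots> = (\<integral>\<^sup>+z. h (X (Y z)) \<partial>lborel)"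
    using nn_integral_shear(1)[of "\<lambda>z. h (X (Y z))" "- t"] by (simp add: X_def)
  also have "\<dots> = (\<integral>\<^sup>+z. h (X z) \<partial>lborel)"
    using nn_integral_shear(2)[of "\<lambda>z. h (X z)" "sin s"] by (simp add: Y_def)
  also have "\<dots> = (\<integral>\<^sup>+z. h z \<partial>lborel)"
    using nn_integral_shear(1)[of h "- t"] by (simp add: X_def)
  finally show ?thesis .
qed

lemma nn_integral_rotate:
  fixes h :: "complex \<Rightarrow> ennreal"
  assumes h [measurable]: "h \<in> borel_measurable borel" and s: "\<bar>s\<bar> < 4 * pi"
  shows "(\<integral>\<^sup>+z. h (cis s * z) \<partial>lborel) = (\<integral>\<^sup>+z. h z \<partial>lborel)"
proof -
  \<comment> \<open>a quarter of the angle lies in the range where the tangent of its half is defined\<close>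
  define w where "w = cis (s / 4)"
  have *: "(\<integral>\<^sup>+z. k (w * z) \<partial>lborel) = (\<integral>\<^sup>+z. k z \<partial>lborel)"
    if "k \<in> borel_measurable borel" for k :: "complex \<Rightarrow> ennreal"
    unfolding w_def using s that by (intro nn_integral_rotate_small) auto
  have "cis s = w * w * w * w" by (simp add: w_def cis_mult)
  then have "(\<integral>\<^sup>+z. h (cis s * z) \<partial>lborel) = (\<integral>\<^sup>+z. h (w * (w * (w * (w * z)))) \<partial>lborel)"
    by (simp add: mult_ac)
  also have "\<dots> = (\<integral>\<^sup>+z. h z \<partial>lborel)"
    using *[of "\<lambda>z. h (w * (w * (w * z)))"] *[of "\<lambda>z. h (w * (w * z))"] *[of "\<lambda>z. h (w * z)"] *[of h]
    by simp
  finally show ?thesis .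
qed

text \<open>Dyadic annuli: where \<open>1 - cmod z\<close> lies between \<open>2^-(n + 1)\<close> and \<open>2^-n\<close>, the weight is at most
\<open>c n = 2^(-s (n + 1))\<close>, and the region \<open>A n\<close> has area at most \<open>2 \<pi> 2^-n\<close>. The products form a convergent
geometric series because \<open>s > -1\<close>.\<close>

lemma disc_boundary_weight_finite:
  fixes s :: real
  assumes s: "-1 < s" "s \<le> 0"
  shows "(\<integral>\<^sup>+z. ennreal ((1 - (cmod z)\<^sup>2) powr s) * indicator (ball 0 1) z \<partial>lborel) < \<infinity>"
proof -
  define A where "A n = ball (0::complex) 1 - ball 0 (1 - (1 / 2) ^ n)" for n :: nat
  define c where "c n = (2 powr (- s)) ^ (n + 1)" for n :: nat
  have point: "ennreal ((1 - (cmod z)\<^sup>2) powr s) * indicator (ball 0 1) z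
      \<le> (\<Sum>n. ennreal (c n) * indicator (A n) z)" for z
  proof (cases "z \<in> ball 0 1")
    case True
    define d where "d = 1 - cmod z"
    have d: "0 < d" "d \<le> 1" using True by (auto simp: d_def)
    have "\<exists>n. (1 / 2) ^ n < d" using real_arch_pow_inv[of d "1 / 2"] d by auto
    then obtain n where n: "(1 / 2) ^ n < d" "\<And>m. m < n \<Longrightarrow> \<not> (1 / 2) ^ m < d"
      using exists_least_iff[of "\<lambda>n. (1 / 2) ^ n < d"] by auto
    have "n \<noteq> 0" using n(1) d by (intro notI) auto
    then obtain m where m: "n = Suc m" by (cases n) auto
    have lo: "(1 / 2) ^ (m + 1) < d" and hi: "d \<le> (1 / 2) ^ m" using n(1) n(2)[of m] m by auto
    have zA: "z \<in> A m" using True hi by (auto simp: A_def d_def)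
    have "d \<le> 1 - (cmod z)\<^sup>2"
      using True by (simp add: d_def power2_eq_square mult_left_le)
    then have "(1 - (cmod z)\<^sup>2) powr s \<le> ((1 / 2) ^ (m + 1)) powr s"
      using lo s by (intro powr_mono2') (auto simp: order.strict_trans2)
    also have "(1 / 2) ^ (m + 1) = 2 powr (- real (m + 1))"
      by (simp only: powr_minus powr_realpow zero_less_numeral power_one_over inverse_eq_divide)
    also have "(2 powr (- real (m + 1))) powr s = c m"
      by (simp add: c_def powr_power powr_powr algebra_simps del: power_Suc)
    finally have "ennreal ((1 - (cmod z)\<^sup>2) powr s) * indicator (ball 0 1) z \<le> ennreal (c m) * indicator (A m) z"
      using True zA by (simp add: ennreal_leI)
    also have "\<dots> \<le> (\<Sum>n. ennreal (c n) * indicator (A n) z)"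
    proof -
      have "f m \<le> suminf f" for f :: "nat \<Rightarrow> ennreal"
        using sum_le_suminf[of f "{m}"] by simp
      then show ?thesis .
    qed
    finally show ?thesis .
  qed simp
  have A: "emeasure lborel (A n) \<le> ennreal (2 * pi * (1 / 2) ^ n)" for n
  proof -
    have q: "0 \<le> (1 / 2 :: real) ^ n" "(1 / 2 :: real) ^ n \<le> 1" by (auto simp: power_le_one)
    have "ball (0::complex) (1 - (1 / 2) ^ n) \<subseteq> ball 0 1" by (rule subset_ball) simp
    then have "emeasure lborel (A n) = emeasure lborel (ball (0::complex) 1) - emeasure lborel (ball (0::complex) (1 - (1 / 2) ^ n))"
      unfolding A_def using q emeasure_lborel_ball_finite[of "0::complex" "1 - (1 / 2) ^ n"] by (intro emeasure_Diff) (auto simp: less_top)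
    also have "\<dots> = ennreal (pi - pi * (1 - (1 / 2) ^ n)\<^sup>2)"
      using q by (simp add: emeasure_ball unit_ball_vol_2 ennreal_minus)
    also have "\<dots> \<le> ennreal (2 * pi * (1 / 2) ^ n)"
      by (intro ennreal_leI) (simp add: power2_eq_square algebra_simps)
    finally show ?thesis .
  qed
  have [measurable]: "A n \<in> sets borel" for n by (simp add: A_def)
  have "(\<integral>\<^sup>+z. ennreal ((1 - (cmod z)\<^sup>2) powr s) * indicator (ball 0 1) z \<partial>lborel)
      \<le> (\<integral>\<^sup>+z. (\<Sum>n. ennreal (c n) * indicator (A n) z) \<partial>lborel)"
    by (intro nn_integral_mono point)
  also have "\<dots> = (\<Sum>n. ennreal (c n) * emeasure lborel (A n))"
    by (simp add: nn_integral_suminf nn_integral_cmult)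
  also have "\<dots> \<le> (\<Sum>n. ennreal (c n * (2 * pi * (1 / 2) ^ n)))"
    using A by (intro suminf_le) (auto simp: ennreal_mult c_def intro!: mult_left_mono)
  also have "\<dots> < \<infinity>"
  proof -
    have "2 powr (- s) / 2 < (1::real)"
      using s powr_less_mono[of "- s" 1 2] by simp
    then have "summable (\<lambda>n. (2 powr (- s) / 2) ^ n)" by (intro summable_geometric) auto
    then have "summable (\<lambda>n. (2 powr (- s) * 2 * pi) * (2 powr (- s) / 2) ^ n)" by (rule summable_mult)
    also have "(\<lambda>n. (2 powr (- s) * 2 * pi) * (2 powr (- s) / 2) ^ n) = (\<lambda>n. c n * (2 * pi * (1 / 2) ^ n))"
      by (simp add: c_def power_divide fun_eq_iff)
    finally show ?thesis
      using ennreal_suminf_neq_top by (fastforce simp: c_def less_top)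
  qed
  finally show ?thesis .
qed

section \<open>Singular integrals over the circle\<close>

text \<open>A linear lower bound for the sine from its third order Taylor remainder and \<open>\<pi> < 4\<close>.\<close>

lemma abs_sin_ge_third:
  fixes u :: real
  assumes "\<bar>u\<bar> \<le> pi / 2"
  shows "\<bar>u\<bar> / 3 \<le> \<bar>sin u\<bar>"
proof -
  have u2: "\<bar>u\<bar> \<le> 2" using assms pi_less_4 by simp
  have "\<bar>sin u - (\<Sum>m<3. sin_coeff m * u ^ m)\<bar> \<le> inverse (fact 3) * \<bar>u\<bar> ^ 3"
    by (rule Maclaurin_sin_bound)
  then have "\<bar>sin u - u\<bar> \<le> \<bar>u\<bar> ^ 3 / 6"
    by (simp add: numeral_3_eq_3 lessThan_Suc sin_coeff_def fact_numeral)
  also have "\<bar>u\<bar> ^ 3 / 6 \<le> \<bar>u\<bar> * 2\<^sup>2 / 6"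
    using mult_left_mono[OF power_mono[OF u2, of 2] abs_ge_zero[of u]]
    by (simp add: power3_eq_cube power2_eq_square mult.assoc)
  finally show ?thesis by (simp add: abs_if split: if_splits)
qed

lemma norm_cis_diff: "norm (cis t - cis \<theta>) = 2 * \<bar>sin ((t - \<theta>) / 2)\<bar>"
proof -
  have "(norm (cis t - cis \<theta>))\<^sup>2 = (cos t - cos \<theta>)\<^sup>2 + (sin t - sin \<theta>)\<^sup>2"
    by (simp add: cmod_power2)
  also have "\<dots> = ((cos t)\<^sup>2 + (sin t)\<^sup>2) + ((cos \<theta>)\<^sup>2 + (sin \<theta>)\<^sup>2) - 2 * (cos t * cos \<theta> + sin t * sin \<theta>)"
    by (simp add: power2_eq_square algebra_simps)
  also have "\<dots> = 2 - 2 * cos (t - \<theta>)"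
    by (simp add: cos_diff)
  also have "\<dots> = (2 * \<bar>sin ((t - \<theta>) / 2)\<bar>)\<^sup>2"
  proof -
    have "t - \<theta> = 2 * ((t - \<theta>) / 2)" by (simp only: mult_2 field_sum_of_halves)
    then have "cos (t - \<theta>) = cos (2 * ((t - \<theta>) / 2))" by (rule arg_cong)
    also have "\<dots> = 1 - 2 * (sin ((t - \<theta>) / 2))\<^sup>2" by (rule cos_double_sin)
    finally show ?thesis by (simp add: power_mult_distrib)
  qed
  finally show ?thesis by (rule power2_eq_imp_eq) auto
qed

text \<open>The distance from \<open>cis t\<close> to \<open>z\<close> is at least \<open>1 - cmod z\<close>, which is the distance from \<open>z\<close> to its
radial projection \<open>cis (Arg z)\<close>. Hence it is at least half the distance between the two boundary
points.\<close>

lemma norm_one_minus_rotate_ge: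
  assumes z: "cmod z \<le> 1"
  shows "\<bar>sin ((t - Arg z) / 2)\<bar> \<le> cmod (1 - z * cis (- t))"
proof -
  define \<theta> where "\<theta> = Arg z"
  have z_eq: "z = of_real (cmod z) * cis \<theta>"
    by (simp add: \<theta>_def rcis_cmod_Arg flip: rcis_def)
  have "cis t * (1 - z * cis (- t)) = cis t - z"
    by (simp add: algebra_simps cis_mult flip: mult.assoc)
  then have eq: "cmod (1 - z * cis (- t)) = cmod (cis t - z)"
    by (metis mult_1 norm_cis norm_mult)
  have "cmod (z - cis \<theta>) = cmod (of_real (cmod z - 1) * cis \<theta>)"
    by (subst z_eq) (simp add: algebra_simps)
  also have "\<dots> = 1 - cmod z" using z by (simp add: norm_mult del: of_real_diff)
  also have "\<dots> \<le> cmod (cis t - z)" using norm_triangle_ineq2[of "cis t" z] by simp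
  finally have "cmod (cis t - cis \<theta>) \<le> 2 * cmod (cis t - z)"
    using norm_triangle_ineq[of "cis t - z" "z - cis \<theta>"] by simp
  then show ?thesis by (simp add: norm_cis_diff eq \<theta>_def)
qed

text \<open>The constant must not depend on the singular point: near it the integral is a translate of
a fixed one, and at distance at least 1 the integrand is at most 1.\<close>

lemma singular_integral_bound:
  fixes \<gamma> :: real
  assumes \<gamma>: "0 \<le> \<gamma>" "\<gamma> < 1"
  obtains C :: real where "C > 0"
    and "\<And>a. (\<integral>\<^sup>+t. ennreal (\<bar>t - a\<bar> powr (- \<gamma>)) * indicator {0..2 * pi} t \<partial>lborel) \<le> ennreal C"
proof -
  define j where "j x = ennreal (indicator {0..1} x * x powr (- \<gamma>))" for x :: real
  have [measurable]: "j \<in> borel_measurable borel" unfolding j_def by measurable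
  have "((\<lambda>x. x powr (- \<gamma>)) has_integral (1 powr (- \<gamma> + 1) / (- \<gamma> + 1))) {0..1}"
    using \<gamma> by (intro has_integral_powr_from_0) auto
  then have "((\<lambda>x. x powr (- \<gamma>)) has_integral (1 / (1 - \<gamma>))) {0..1}" by simp
  from nn_integral_has_integral_lebesgue[OF _ this]
  have J: "(\<integral>\<^sup>+x. j x \<partial>lborel) = ennreal (1 / (1 - \<gamma>))" by (simp add: j_def)
  have shift: "(\<integral>\<^sup>+t. j (c * (t - a)) \<partial>lborel) = ennreal (1 / (1 - \<gamma>))" if "\<bar>c\<bar> = 1" for c a
    using nn_integral_real_affine[of j c "- (c * a)"] that J by (auto simp: algebra_simps)
  define C where "C = 2 * pi + 2 / (1 - \<gamma>)"
  show thesis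
  proof
    show "C > 0" using \<gamma> by (simp add: C_def add_pos_pos)
    fix a
    have "(\<integral>\<^sup>+t. ennreal (\<bar>t - a\<bar> powr (- \<gamma>)) * indicator {0..2 * pi} t \<partial>lborel)
       \<le> (\<integral>\<^sup>+t. indicator {0..2 * pi} t + (j (1 * (t - a)) + j ((- 1) * (t - a))) \<partial>lborel)"
    proof (rule nn_integral_mono)
      fix t :: real
      show "ennreal (\<bar>t - a\<bar> powr (- \<gamma>)) * indicator {0..2 * pi} t
          \<le> indicator {0..2 * pi} t + (j (1 * (t - a)) + j ((- 1) * (t - a)))"
      proof (cases "\<bar>t - a\<bar> \<le> 1")
        case True
        have "ennreal (\<bar>t - a\<bar> powr (- \<gamma>)) \<le> j (1 * (t - a)) + j ((- 1) * (t - a))"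
          using True by (cases "t \<ge> a") (auto simp: j_def abs_if indicator_def)
        then show ?thesis
          by (auto simp: indicator_def add_increasing)
      next
        case False
        then have "\<bar>t - a\<bar> powr (- \<gamma>) \<le> 1"
          using \<gamma> powr_mono2'[of "- \<gamma>" 1 "\<bar>t - a\<bar>"] by simp
        then show ?thesis
          by (auto simp: indicator_def intro!: add_increasing2)
      qed
    qed
    also have "\<dots> = ennreal (2 * pi) + (ennreal (1 / (1 - \<gamma>)) + ennreal (1 / (1 - \<gamma>)))"
      using shift[of 1 a] shift[of "- 1" a] by (simp add: nn_integral_add)
    also have "\<dots> = ennreal C"
      using \<gamma> by (simp add: C_def flip: ennreal_plus)
    finally show "(\<integral>\<^sup>+t. ennreal (\<bar>t - a\<bar> powr (- \<gamma>)) * indicator {0..2 * pi} t \<partial>lborel) \<le> ennreal C" .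
  qed
qed

text \<open>For \<open>t\<close> in \<open>[0, 2 \<pi>]\<close> the point \<open>cis t\<close> can be close to \<open>z\<close> only if \<open>t\<close> is close to \<open>\<theta> = Arg z\<close> or to
\<open>\<theta> + 2 \<pi>\<close>. The bound is therefore a sum of two one-dimensional singular integrals, uniformly in \<open>z\<close>.\<close>

lemma circle_singular_integral_bound:
  fixes \<gamma> :: real
  assumes \<gamma>: "0 \<le> \<gamma>" "\<gamma> < 1"
  obtains C :: real where "C > 0"
    and "\<And>z. cmod z \<le> 1 \<Longrightarrow>
      (\<integral>\<^sup>+t. ennreal (cmod (1 - z * cis (- t)) powr (- \<gamma>)) * indicator {0..2 * pi} t \<partial>lborel) \<le> ennreal C"
proof -
  obtain C where C: "C > 0"
    "\<And>a. (\<integral>\<^sup>+t. ennreal (\<bar>t - a\<bar> powr (- \<gamma>)) * indicator {0..2 * pi} t \<partial>lborel) \<le> ennreal C"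
    using singular_integral_bound[OF \<gamma>] by blast
  define K where "K = (1 / 6) powr (- \<gamma>)"
  have K: "K > 0" by (simp add: K_def)
  show thesis
  proof
    show "K * (C + C) > 0" using C(1) K by simp
    fix z :: complex assume z: "cmod z \<le> 1"
    define \<theta> where "\<theta> = Arg z"
    have \<theta>: "- pi < \<theta>" "\<theta> \<le> pi" using Arg_bounded[of z] by (auto simp: \<theta>_def)
    define e where "e a t = ennreal (\<bar>t - a\<bar> powr (- \<gamma>)) * indicator {0..2 * pi} t" for a t :: real
    have [measurable]: "e a \<in> borel_measurable borel" for a unfolding e_def by measurable
    have "(\<integral>\<^sup>+t. ennreal (cmod (1 - z * cis (- t)) powr (- \<gamma>)) * indicator {0..2 * pi} t \<partial>lborel)
        \<le> (\<integral>\<^sup>+t. ennreal K * (e \<theta> t + e (\<theta> + 2 * pi) t) \<partial>lborel)"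
    proof (rule nn_integral_mono_AE)
      \<comment> \<open>at the singular points themselves \<open>powr\<close> has the value 0, so the pointwise bound fails there\<close>
      have "AE t in lborel. t \<noteq> \<theta>" "AE t in lborel. t \<noteq> \<theta> + 2 * pi"
        by (rule AE_lborel_singleton)+
      then show "AE t in lborel. ennreal (cmod (1 - z * cis (- t)) powr (- \<gamma>)) * indicator {0..2 * pi} t
          \<le> ennreal K * (e \<theta> t + e (\<theta> + 2 * pi) t)"
      proof eventually_elim
        case (elim t)
        define u where "u = (t - \<theta>) / 2"
        have sin_le: "\<bar>sin u\<bar> \<le> cmod (1 - z * cis (- t))"
          using norm_one_minus_rotate_ge[OF z, of t] by (simp add: u_def \<theta>_def)
        have bd: "ennreal (cmod (1 - z * cis (- t)) powr (- \<gamma>)) \<le> ennreal K * ennreal (\<bar>t - a\<bar> powr (- \<gamma>))"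
          if "t \<noteq> a" "\<bar>t - a\<bar> / 6 \<le> \<bar>sin u\<bar>" for a
        proof -
          have "cmod (1 - z * cis (- t)) powr (- \<gamma>) \<le> (\<bar>t - a\<bar> / 6) powr (- \<gamma>)"
            using that sin_le \<gamma> by (intro powr_mono2') auto
          also have "\<dots> = K * \<bar>t - a\<bar> powr (- \<gamma>)"
            unfolding K_def by (subst powr_mult[symmetric]) auto
          finally show ?thesis using K by (simp add: ennreal_leI flip: ennreal_mult)
        qed
        show ?case
        proof (cases "t \<in> {0..2 * pi}")
          case t: True
          show ?thesis
          proof (cases "u \<le> pi / 2")
            case True
            moreover have "- (pi / 2) \<le> u" using t \<theta> by (simp add: u_def)
            ultimately have "\<bar>u\<bar> / 3 \<le> \<bar>sin u\<bar>" by (intro abs_sin_ge_third) (simp add: abs_le_iff)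
            then show ?thesis
              using bd[of \<theta>] elim t by (simp add: e_def u_def distrib_left add_increasing2)
          next
            case False
            moreover have "u \<le> 3 * pi / 2" using t \<theta> by (simp add: u_def)
            ultimately have "\<bar>u - pi\<bar> / 3 \<le> \<bar>sin (u - pi)\<bar>"
              by (intro abs_sin_ge_third) linarith
            moreover have "\<bar>u - pi\<bar> = \<bar>t - (\<theta> + 2 * pi)\<bar> / 2" by (simp add: u_def abs_if field_simps)
            ultimately show ?thesis
              using bd[of "\<theta> + 2 * pi"] elim t by (simp add: e_def distrib_left add_increasing)
          qed
        qed simp
      qed
    qed
    also have "\<dots> = ennreal K * ((\<integral>\<^sup>+t. e \<theta> t \<partial>lborel) + (\<integral>\<^sup>+t. e (\<theta> + 2 * pi) t \<partial>lborel))"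
      by (simp add: nn_integral_cmult nn_integral_add)
    also have "\<dots> \<le> ennreal K * (ennreal C + ennreal C)"
      unfolding e_def by (intro mult_left_mono add_mono C(2)) auto
    also have "\<dots> = ennreal (K * (C + C))"
      using K C(1) by (simp add: ennreal_mult flip: ennreal_plus)
    finally show "(\<integral>\<^sup>+t. ennreal (cmod (1 - z * cis (- t)) powr (- \<gamma>)) * indicator {0..2 * pi} t \<partial>lborel)
        \<le> ennreal (K * (C + C))" .
  qed
qed

section \<open>A Schur test on the disc\<close>

text \<open>A common majorant for the kernels below. For \<open>-1 < \<beta> < 0\<close> the exponent of \<open>cmod (1 - w)\<close> lies
above \<open>-1\<close>, so the mean of the kernel over the circle of radius \<open>r\<close> is of order \<open>(1 - r\<^sup>2) powr \<beta>\<close>.\<close>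

definition model_kernel :: "real \<Rightarrow> complex \<Rightarrow> real" where
  "model_kernel \<beta> w = (1 - (cmod w)\<^sup>2) powr \<beta> * cmod (1 - w) powr (- (\<beta> + 1))"

lemma model_kernel_nonneg [simp]: "0 \<le> model_kernel \<beta> w"
  by (simp add: model_kernel_def)

lemma borel_measurable_cis [measurable]: "cis \<in> borel_measurable borel"
  by (intro borel_measurable_continuous_onI continuous_intros)

lemma borel_measurable_model_kernel [measurable]: "model_kernel \<beta> \<in> borel_measurable borel"
  unfolding model_kernel_def by measurable

text \<open>Cutting at height \<open>l\<close> and then choosing the best \<open>l\<close> yields Hoelder's inequality up to a factor
of 2.\<close>

lemma split_at_level:
  fixes x l p :: real
  assumes "0 \<le> x" "0 < l" "1 \<le> p"
  shows "x \<le> l + l powr (1 - p) * x powr p"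
proof (cases "x \<le> l")
  case False
  then have "x powr (1 - p) \<le> l powr (1 - p)" using assms by (intro powr_mono2') auto
  then have "x powr (1 - p) * x powr p \<le> l powr (1 - p) * x powr p" by (intro mult_right_mono) auto
  moreover have "x powr (1 - p) * x powr p = x" using False assms by (simp flip: powr_add)
  ultimately show ?thesis using assms by simp
qed (use assms in \<open>simp add: add_increasing2\<close>)

text \<open>Write \<open>\<rho> = 1 - (cmod z)\<^sup>2\<close>. The kernel has mass at most \<open>C \<rho> powr \<beta>\<close> in \<open>t\<close>, so by Hoelder's inequality
the \<open>p\<close>-th power of the integral is at most a constant times \<open>\<rho> powr (\<beta> (p - 1))\<close> times the integral \<open>J\<close> of
the kernel against \<open>H powr p\<close>. Tonelli's theorem then leaves the integral \<open>A\<close> of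
\<open>\<rho> powr (\<beta> (p - 1))\<close> times the kernel over the disc. By rotation invariance \<open>A\<close> does not depend on \<open>t\<close>;
averaging over \<open>t\<close> and using the mass bound once more gives a multiple of the integral of
\<open>\<rho> powr (\<beta> p)\<close>, which is finite exactly when \<open>\<beta> p > -1\<close>.\<close>

theorem model_kernel_integral_bergman:
  fixes H :: "real \<Rightarrow> real" and \<beta> p :: real
  assumes H [measurable]: "H \<in> borel_measurable borel" and H0: "\<And>t. 0 \<le> H t"
    and p: "1 \<le> p" and \<beta>: "- 1 < \<beta>" "\<beta> < 0" "- 1 < \<beta> * p"
    and Hp: "(\<integral>\<^sup>+t. ennreal (H t powr p) * indicator {0..2 * pi} t \<partial>lborel) < \<infinity>"
  defines "I \<equiv> \<lambda>z. \<integral>\<^sup>+t. ennreal (model_kernel \<beta> (z * cis (- t)) * H t) * indicator {0..2 * pi} t \<partial>lborel"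
  shows "\<And>z. z \<in> ball 0 1 \<Longrightarrow> I z < \<infinity>"
    and "(\<integral>\<^sup>+z. ennreal (enn2real (I z) powr p) * indicator (ball 0 1) z \<partial>lborel) < \<infinity>"
proof -
  define T where "T = (indicator {0..2 * pi} :: real \<Rightarrow> ennreal)"
  have [measurable]: "T \<in> borel_measurable borel" by (simp add: T_def)
  define D where "D = (indicator (ball 0 1) :: complex \<Rightarrow> ennreal)"
  have [measurable]: "D \<in> borel_measurable borel"
    unfolding D_def by (intro borel_measurable_indicator) simp
  define k where "k z t = model_kernel \<beta> (z * cis (- t))" for z t
  have [measurable]: "(\<lambda>x. k (f x) (g x)) \<in> borel_measurable M"
    if [measurable]: "f \<in> borel_measurable M" "g \<in> borel_measurable M" for f g and M :: "'z measure"
    unfolding k_def by measurable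
  have k0: "0 \<le> k z t" for z t by (simp add: k_def)
  define \<rho> where "\<rho> z = 1 - (cmod z)\<^sup>2" for z :: complex
  have [measurable]: "\<rho> \<in> borel_measurable borel" unfolding \<rho>_def by measurable
  have \<rho>: "\<rho> z > 0" if "z \<in> ball 0 1" for z
    using that by (simp add: \<rho>_def power_less_one_iff abs_square_less_1)
  have k_eq: "k z t = \<rho> z powr \<beta> * cmod (1 - z * cis (- t)) powr (- (\<beta> + 1))" for z t
    by (simp add: k_def model_kernel_def \<rho>_def norm_mult)
  define J where "J z = (\<integral>\<^sup>+t. ennreal (k z t * H t powr p) * T t \<partial>lborel)" for z
  have [measurable]: "J \<in> borel_measurable borel" unfolding J_def by measurable
  obtain C where C: "C > 0" "\<And>z. cmod z \<le> 1 \<Longrightarrow>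
      (\<integral>\<^sup>+t. ennreal (cmod (1 - z * cis (- t)) powr (- (\<beta> + 1))) * indicator {0..2 * pi} t \<partial>lborel) \<le> ennreal C"
    using circle_singular_integral_bound[of "\<beta> + 1"] \<beta> by auto
  have mass: "(\<integral>\<^sup>+t. ennreal (k z t) * T t \<partial>lborel) \<le> ennreal (C * \<rho> z powr \<beta>)" if z: "z \<in> ball 0 1" for z
  proof -
    have "(\<integral>\<^sup>+t. ennreal (k z t) * T t \<partial>lborel)
        = ennreal (\<rho> z powr \<beta>) * (\<integral>\<^sup>+t. ennreal (cmod (1 - z * cis (- t)) powr (- (\<beta> + 1))) * T t \<partial>lborel)"
      by (subst nn_integral_cmult[symmetric]) (auto simp: k_eq ennreal_mult mult.assoc)
    also have "\<dots> \<le> ennreal (\<rho> z powr \<beta>) * ennreal C"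
      unfolding T_def using z by (intro mult_left_mono C(2)) auto
    finally show ?thesis using C(1) by (simp add: ennreal_mult mult.commute)
  qed
  have J_fin: "J z < \<infinity>" if z: "z \<in> ball 0 1" for z
  proof -
    define B where "B = \<rho> z powr \<beta> * (1 - cmod z) powr (- (\<beta> + 1))"
    have "k z t \<le> B" for t
    proof -
      have "1 - cmod z \<le> cmod (1 - z * cis (- t))"
        using norm_triangle_ineq2[of 1 "z * cis (- t)"] by (simp add: norm_mult)
      then show ?thesis
        unfolding k_eq B_def using z \<beta> by (intro mult_left_mono powr_mono2') auto
    qed
    then have "J z \<le> (\<integral>\<^sup>+t. ennreal B * (ennreal (H t powr p) * T t) \<partial>lborel)"
      unfolding J_def
      by (intro nn_integral_mono) (auto simp: B_def simp flip: ennreal_mult mult.assoc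
            intro!: mult_right_mono ennreal_leI)
    also have "\<dots> = ennreal B * (\<integral>\<^sup>+t. ennreal (H t powr p) * T t \<partial>lborel)"
      by (intro nn_integral_cmult) measurable
    also have "\<dots> < \<infinity>" using Hp by (simp add: T_def ennreal_mult_less_top)
    finally show ?thesis .
  qed
  have level: "I z \<le> ennreal (l * (C * \<rho> z powr \<beta>)) + ennreal (l powr (1 - p)) * J z"
    if z: "z \<in> ball 0 1" and l: "l > 0" for z l
  proof -
    have "I z \<le> (\<integral>\<^sup>+t. ennreal l * (ennreal (k z t) * T t)
        + ennreal (l powr (1 - p)) * (ennreal (k z t * H t powr p) * T t) \<partial>lborel)"
      unfolding I_def k_def[symmetric] T_def[symmetric]
    proof (rule nn_integral_mono)
      fix t
      have "k z t * H t \<le> k z t * (l + l powr (1 - p) * H t powr p)"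
        using split_at_level[OF H0 l p] k0 by (intro mult_left_mono) auto
      then have "ennreal (k z t * H t) \<le> ennreal (l * k z t + l powr (1 - p) * (k z t * H t powr p))"
        by (intro ennreal_leI) (simp add: algebra_simps)
      also have "\<dots> = ennreal l * ennreal (k z t) + ennreal (l powr (1 - p)) * ennreal (k z t * H t powr p)"
        using l k0 by (simp add: ennreal_mult)
      finally have "ennreal (k z t * H t) * T t \<le>
          (ennreal l * ennreal (k z t) + ennreal (l powr (1 - p)) * ennreal (k z t * H t powr p)) * T t"
        by (rule mult_right_mono) simp
      then show "ennreal (k z t * H t) * T t \<le> ennreal l * (ennreal (k z t) * T t)
          + ennreal (l powr (1 - p)) * (ennreal (k z t * H t powr p) * T t)"
        by (simp add: algebra_simps)
    qed
    also have "\<dots> = ennreal l * (\<integral>\<^sup>+t. ennreal (k z t) * T t \<partial>lborel) + ennreal (l powr (1 - p)) * J z"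
      unfolding J_def by (subst nn_integral_add) (auto simp: nn_integral_cmult)
    also have "ennreal l * (\<integral>\<^sup>+t. ennreal (k z t) * T t \<partial>lborel) \<le> ennreal l * ennreal (C * \<rho> z powr \<beta>)"
      by (intro mult_left_mono mass z) simp
    finally show ?thesis using l C(1) by (simp add: ennreal_mult add_mono)
  qed
  show I_fin: "I z < \<infinity>" if z: "z \<in> ball 0 1" for z
    using level[OF z zero_less_one] J_fin[OF z]
    by (auto simp: ennreal_mult_less_top intro: le_less_trans)
  have pow: "ennreal (enn2real (I z) powr p) \<le> ennreal (2 powr p * C powr (p - 1)) *
      (ennreal (\<rho> z powr (\<beta> * (p - 1))) * (J z + 1))" if z: "z \<in> ball 0 1" for z
  proof -
    define P where "P = C * \<rho> z powr \<beta>"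
    \<comment> \<open>adding 1 keeps \<open>q\<close> positive, so that the optimal level exists\<close>
    define q where "q = enn2real (J z) + 1"
    have P: "P > 0" using C(1) \<rho>[OF z] by (simp add: P_def)
    have q: "q > 0" by (simp add: q_def add_nonneg_pos)
    have Jq: "J z \<le> ennreal q" "J z + 1 = ennreal q"
    proof -
      have "J z = ennreal (enn2real (J z))" using J_fin[OF z] by simp
      then show "J z \<le> ennreal q" "J z + 1 = ennreal q"
        unfolding q_def by (metis ennreal_leI enn2real_nonneg le_add_same_cancel1 zero_le_one,
          metis ennreal_1 ennreal_plus enn2real_nonneg zero_le_one)
    qed
    define m where "m = q powr (1 / p) * P powr (1 - 1 / p)"
    \<comment> \<open>this level makes both terms of the bound equal to \<open>m\<close>\<close>
    define l where "l = (q / P) powr (1 / p)"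
    have l: "l > 0" using P q by (simp add: l_def)
    have lP: "l * P = m"
    proof -
      have "l * P = q powr (1 / p) * (P powr (- (1 / p)) * P powr 1)"
        using P q by (simp add: l_def powr_divide powr_minus_divide)
      also have "P powr (- (1 / p)) * P powr 1 = P powr (1 - 1 / p)"
        unfolding powr_add[symmetric] by simp
      finally show ?thesis by (simp add: m_def)
    qed
    have lq: "l powr (1 - p) * q = m"
    proof -
      have e: "1 / p * (1 - p) = 1 / p - 1" using p by (simp add: field_simps)
      have "l powr (1 - p) * q = (q / P) powr (1 / p - 1) * q"
        by (simp only: l_def powr_powr e)
      also have "\<dots> = (q powr (1 / p - 1) * q powr 1) * P powr (- (1 / p - 1))"
      proof -
        have "(q / P) powr x * q = (q powr x * q powr 1) * P powr (- x)" for x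
          using P q by (simp add: powr_divide powr_minus_divide)
        then show ?thesis .
      qed
      also have "q powr (1 / p - 1) * q powr 1 = q powr (1 / p)"
        unfolding powr_add[symmetric] by simp
      finally show ?thesis by (simp add: m_def)
    qed
    have "I z \<le> ennreal (l * P) + ennreal (l powr (1 - p)) * ennreal q"
      using level[OF z l] Jq(1) unfolding P_def[symmetric]
      by (meson add_left_mono mult_left_mono order_trans zero_le)
    also have "\<dots> = ennreal (2 * m)"
      using q l P by (simp add: lP lq m_def flip: ennreal_mult ennreal_plus)
    finally have "enn2real (I z) \<le> 2 * m"
      by (intro enn2real_leI) (auto simp: m_def)
    then have "enn2real (I z) powr p \<le> (2 * m) powr p" using p by (intro powr_mono2) auto
    also have "\<dots> = 2 powr p * (q powr (1 / p * p) * P powr ((1 - 1 / p) * p))"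
      by (simp add: m_def powr_mult powr_powr)
    also have "\<dots> = 2 powr p * (q * P powr (p - 1))"
      using p q by (simp add: algebra_simps)
    also have "P powr (p - 1) = C powr (p - 1) * \<rho> z powr (\<beta> * (p - 1))"
      using C(1) by (simp add: P_def powr_mult powr_powr)
    finally have "ennreal (enn2real (I z) powr p) \<le> ennreal (2 powr p * (q * (C powr (p - 1) * \<rho> z powr (\<beta> * (p - 1)))))"
      by (rule ennreal_leI)
    also have "\<dots> = ennreal (2 powr p * C powr (p - 1)) * (ennreal (\<rho> z powr (\<beta> * (p - 1))) * ennreal q)"
      using q by (simp add: mult_ac flip: ennreal_mult)
    finally show ?thesis by (simp add: Jq(2))
  qed
  have s: "- 1 < \<beta> * (p - 1)" "\<beta> * (p - 1) \<le> 0"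
    using \<beta> p by (auto simp: algebra_simps mult_le_0_iff)
  have W: "(\<integral>\<^sup>+z. ennreal (\<rho> z powr s) * D z \<partial>lborel) < \<infinity>" if "-1 < s" "s \<le> 0" for s
    using disc_boundary_weight_finite[OF that] by (simp add: \<rho>_def D_def)
  define A where "A = (\<integral>\<^sup>+z. ennreal (\<rho> z powr (\<beta> * (p - 1)) * model_kernel \<beta> z) * D z \<partial>lborel)"
  have rot: "(\<integral>\<^sup>+z. ennreal (\<rho> z powr (\<beta> * (p - 1)) * k z t) * D z \<partial>lborel) = A" if t: "t \<in> {0..2 * pi}" for t
  proof -
    have "\<bar>- t\<bar> < 4 * pi" using t pi_gt_zero unfolding atLeastAtMost_iff by linarith
    from nn_integral_rotate[of "\<lambda>z. ennreal (\<rho> z powr (\<beta> * (p - 1)) * model_kernel \<beta> z) * D z", OF _ this]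
    show ?thesis
      unfolding A_def k_def by (simp add: mult.commute \<rho>_def D_def norm_mult indicator_def)
  qed
  \<comment> \<open>averaging the constant \<open>A\<close> over all rotations\<close>
  have "(\<integral>\<^sup>+t. A * T t \<partial>lborel)
      = (\<integral>\<^sup>+t. (\<integral>\<^sup>+z. ennreal (\<rho> z powr (\<beta> * (p - 1)) * k z t) * D z * T t \<partial>lborel) \<partial>lborel)"
    by (intro nn_integral_cong) (auto simp: rot T_def nn_integral_multc indicator_def)
  also have "\<dots> = (\<integral>\<^sup>+z. (\<integral>\<^sup>+t. ennreal (\<rho> z powr (\<beta> * (p - 1)) * k z t) * D z * T t \<partial>lborel) \<partial>lborel)"
    by (rule lborel_pair.Fubini') measurable
  also have "\<dots> \<le> (\<integral>\<^sup>+z. ennreal C * (ennreal (\<rho> z powr (\<beta> * p)) * D z) \<partial>lborel)"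
  proof (rule nn_integral_mono)
    fix z :: complex
    show "(\<integral>\<^sup>+t. ennreal (\<rho> z powr (\<beta> * (p - 1)) * k z t) * D z * T t \<partial>lborel)
        \<le> ennreal C * (ennreal (\<rho> z powr (\<beta> * p)) * D z)"
    proof (cases "z \<in> ball 0 1")
      case True
      then have D1: "D z = 1" by (simp add: D_def)
      have "(\<integral>\<^sup>+t. ennreal (\<rho> z powr (\<beta> * (p - 1)) * k z t) * D z * T t \<partial>lborel)
          = ennreal (\<rho> z powr (\<beta> * (p - 1))) * (\<integral>\<^sup>+t. ennreal (k z t) * T t \<partial>lborel)"
        by (subst nn_integral_cmult[symmetric]) (auto simp: D1 k0 ennreal_mult mult.assoc)
      also have "\<dots> \<le> ennreal (\<rho> z powr (\<beta> * (p - 1))) * ennreal (C * \<rho> z powr \<beta>)"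
        by (intro mult_left_mono mass True) simp
      also have "\<dots> = ennreal (C * (\<rho> z powr (\<beta> * (p - 1)) * \<rho> z powr \<beta>))"
        using C(1) by (simp add: mult_ac flip: ennreal_mult)
      also have "\<rho> z powr (\<beta> * (p - 1)) * \<rho> z powr \<beta> = \<rho> z powr (\<beta> * p)"
        by (simp add: algebra_simps flip: powr_add)
      finally show ?thesis using C(1) by (simp add: D1 ennreal_mult)
    qed (simp add: D_def)
  qed
  also have "\<dots> = ennreal C * (\<integral>\<^sup>+z. ennreal (\<rho> z powr (\<beta> * p)) * D z \<partial>lborel)"
    by (intro nn_integral_cmult) measurable
  also have "\<dots> < \<infinity>"
    using W[of "\<beta> * p"] \<beta> p by (simp add: ennreal_mult_less_top mult_le_0_iff)
  finally have "A * (\<integral>\<^sup>+t. T t \<partial>lborel) < \<infinity>"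
    by (simp add: nn_integral_cmult)
  then have "A < \<infinity>"
    using pi_gt_zero by (auto simp: T_def ennreal_mult_less_top)
  have "(\<integral>\<^sup>+z. ennreal (\<rho> z powr (\<beta> * (p - 1))) * J z * D z \<partial>lborel)
      = (\<integral>\<^sup>+z. (\<integral>\<^sup>+t. ennreal (\<rho> z powr (\<beta> * (p - 1)) * k z t) * D z * (ennreal (H t powr p) * T t) \<partial>lborel) \<partial>lborel)"
    unfolding J_def
    by (intro nn_integral_cong, subst nn_integral_cmult[symmetric], measurable,
        subst nn_integral_multc[symmetric], measurable,
        intro nn_integral_cong) (simp add: k0 ennreal_mult mult_ac)
  also have "\<dots> = (\<integral>\<^sup>+t. (\<integral>\<^sup>+z. ennreal (\<rho> z powr (\<beta> * (p - 1)) * k z t) * D z * (ennreal (H t powr p) * T t) \<partial>lborel) \<partial>lborel)"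
    by (rule lborel_pair.Fubini') measurable
  also have "\<dots> = (\<integral>\<^sup>+t. A * (ennreal (H t powr p) * T t) \<partial>lborel)"
    by (intro nn_integral_cong, subst nn_integral_multc, measurable) (auto simp: rot T_def indicator_def)
  also have "\<dots> = A * (\<integral>\<^sup>+t. ennreal (H t powr p) * T t \<partial>lborel)"
    by (intro nn_integral_cmult) measurable
  also have "\<dots> < \<infinity>"
    using \<open>A < \<infinity>\<close> Hp by (simp add: T_def ennreal_mult_less_top)
  finally have main: "(\<integral>\<^sup>+z. ennreal (\<rho> z powr (\<beta> * (p - 1))) * J z * D z \<partial>lborel) < \<infinity>" .
  have "(\<integral>\<^sup>+z. ennreal (enn2real (I z) powr p) * D z \<partial>lborel)
      \<le> (\<integral>\<^sup>+z. ennreal (2 powr p * C powr (p - 1)) *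
          (ennreal (\<rho> z powr (\<beta> * (p - 1))) * J z * D z + ennreal (\<rho> z powr (\<beta> * (p - 1))) * D z) \<partial>lborel)"
  proof (rule nn_integral_mono)
    fix z
    show "ennreal (enn2real (I z) powr p) * D z \<le> ennreal (2 powr p * C powr (p - 1)) *
          (ennreal (\<rho> z powr (\<beta> * (p - 1))) * J z * D z + ennreal (\<rho> z powr (\<beta> * (p - 1))) * D z)"
      using pow[of z] by (cases "z \<in> ball 0 1") (auto simp: D_def distrib_left)
  qed
  also have "\<dots> = ennreal (2 powr p * C powr (p - 1)) *
      ((\<integral>\<^sup>+z. ennreal (\<rho> z powr (\<beta> * (p - 1))) * J z * D z \<partial>lborel) + (\<integral>\<^sup>+z. ennreal (\<rho> z powr (\<beta> * (p - 1))) * D z \<partial>lborel))"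
    by (subst nn_integral_cmult, measurable, subst nn_integral_add, measurable)
  also have "\<dots> < \<infinity>"
    using main W[OF s] by (simp add: ennreal_mult_less_top)
  finally show "(\<integral>\<^sup>+z. ennreal (enn2real (I z) powr p) * indicator (ball 0 1) z \<partial>lborel) < \<infinity>"
    by (simp add: D_def)
qed

section \<open>The Poisson type kernel\<close>

text \<open>The differential of \<open>poisson_kernel \<alpha>\<close> at \<open>w\<close>, applied to the direction \<open>v\<close>.\<close>

definition poisson_kernel_deriv :: "real \<Rightarrow> complex \<Rightarrow> complex \<Rightarrow> real" where
  "poisson_kernel_deriv \<alpha> w v = poisson_const \<alpha> *
     ((\<alpha> + 2) * (1 - (cmod w)\<^sup>2) powr (\<alpha> + 1) * cmod (1 - w) powr (- (\<alpha> + 4)) * ((1 - w) \<bullet> v)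
      - 2 * (\<alpha> + 1) * (1 - (cmod w)\<^sup>2) powr \<alpha> * cmod (1 - w) powr (- (\<alpha> + 2)) * (w \<bullet> v))"

lemma powr_square_eq:
  fixes x s :: real
  assumes "0 \<le> x"
  shows "(x\<^sup>2) powr s = x powr (2 * s)"
proof -
  have "x\<^sup>2 = x powr 2" using assms by (cases "x = 0") auto
  then have "(x\<^sup>2) powr s = (x powr 2) powr s" by (rule arg_cong)
  then show ?thesis by (simp only: powr_powr)
qed

lemma disc_weight_pos:
  assumes "cmod w < 1"
  shows "0 < 1 - (cmod w)\<^sup>2" and "0 < cmod (1 - w)" and "1 - (cmod w)\<^sup>2 \<le> 2 * cmod (1 - w)" and "cmod (1 - w) < 2"
proof -
  show "0 < 1 - (cmod w)\<^sup>2" using assms by (simp add: abs_square_less_1)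
  show "0 < cmod (1 - w)" using assms by auto
  have "1 - (cmod w)\<^sup>2 = (1 + cmod w) * (1 - cmod w)" by (simp add: power2_eq_square algebra_simps)
  also have "\<dots> \<le> 2 * cmod (1 - w)"
    using assms norm_triangle_ineq2[of 1 w] by (intro mult_mono) auto
  finally show "1 - (cmod w)\<^sup>2 \<le> 2 * cmod (1 - w)" .
  show "cmod (1 - w) < 2" using assms norm_triangle_ineq4[of 1 w] by simp
qed

lemma poisson_kernel_has_derivative_along:
  assumes \<gamma>: "(\<gamma> has_vector_derivative v) (at t within S)" and w: "cmod (\<gamma> t) < 1"
  shows "((\<lambda>s. poisson_kernel \<alpha> (\<gamma> s)) has_real_derivative poisson_kernel_deriv \<alpha> (\<gamma> t) v) (at t within S)"
proof -
  note \<gamma>' = \<gamma>[unfolded has_vector_derivative_def]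
  have \<rho>: "((\<lambda>s. 1 - (cmod (\<gamma> s))\<^sup>2) has_real_derivative (- 2 * (\<gamma> t \<bullet> v))) (at t within S)"
    unfolding has_field_derivative_def power2_norm_eq_inner
    by (rule has_derivative_eq_rhs, (rule derivative_intros \<gamma>')+)
       (auto simp: fun_eq_iff inner_commute)
  have q: "((\<lambda>s. (cmod (1 - \<gamma> s))\<^sup>2) has_real_derivative (- 2 * ((1 - \<gamma> t) \<bullet> v))) (at t within S)"
    unfolding has_field_derivative_def power2_norm_eq_inner
    by (rule has_derivative_eq_rhs, (rule derivative_intros \<gamma>')+)
       (auto simp: fun_eq_iff inner_commute)
  have pos: "0 < 1 - (cmod (\<gamma> t))\<^sup>2" "0 < (cmod (1 - \<gamma> t))\<^sup>2"
    using disc_weight_pos[OF w] by auto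
  have powr_d: "((\<lambda>s. u s powr r) has_real_derivative (r * u t powr (r - 1) * u')) (at t within S)"
    if "(u has_real_derivative u') (at t within S)" "u t > 0" for u u' r
    using DERIV_chain2[OF has_real_derivative_powr[OF that(2)] that(1)] by simp
  have eq: "cmod u powr (- (r * 2)) = ((cmod u)\<^sup>2) powr (- r)" for u r
    using powr_square_eq[of "cmod u" "- r"] by (simp add: mult.commute)
  define A where "A = 1 - (cmod (\<gamma> t))\<^sup>2"
  define Q where "Q = (cmod (1 - \<gamma> t))\<^sup>2"
  define b where "b = \<alpha> / 2 + 1"
  have K: "poisson_kernel \<alpha> (\<gamma> s)
      = poisson_const \<alpha> * ((1 - (cmod (\<gamma> s))\<^sup>2) powr (\<alpha> + 1) * ((cmod (1 - \<gamma> s))\<^sup>2) powr (- b))" for s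
  proof -
    have "((cmod (1 - \<gamma> s))\<^sup>2) powr (- b) = cmod (1 - \<gamma> s) powr (- (\<alpha> + 2))"
    proof -
      have "2 * (- b) = - (\<alpha> + 2)" by (simp add: b_def)
      then show ?thesis using powr_square_eq[of "cmod (1 - \<gamma> s)" "- b"] by (simp only: norm_ge_zero)
    qed
    then show ?thesis by (simp only: poisson_kernel_def powr_minus divide_inverse)
  qed
  have "((\<lambda>s. poisson_kernel \<alpha> (\<gamma> s)) has_real_derivative
      poisson_const \<alpha> * ((\<alpha> + 1) * A powr (\<alpha> + 1 - 1) * (- 2 * (\<gamma> t \<bullet> v)) * Q powr (- b)
        + (- b * Q powr (- b - 1) * (- 2 * ((1 - \<gamma> t) \<bullet> v))) * A powr (\<alpha> + 1))) (at t within S)"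
    unfolding K A_def Q_def by (intro DERIV_cmult DERIV_mult powr_d \<rho> q pos)
  moreover have "poisson_const \<alpha> * ((\<alpha> + 1) * A powr (\<alpha> + 1 - 1) * (- 2 * (\<gamma> t \<bullet> v)) * Q powr (- b)
        + (- b * Q powr (- b - 1) * (- 2 * ((1 - \<gamma> t) \<bullet> v))) * A powr (\<alpha> + 1)) = poisson_kernel_deriv \<alpha> (\<gamma> t) v"
  proof -
    have "Q powr (- b) = cmod (1 - \<gamma> t) powr (- (\<alpha> + 2))"
      unfolding Q_def eq[symmetric] by (simp add: b_def)
    moreover have "Q powr (- b - 1) = cmod (1 - \<gamma> t) powr (- (\<alpha> + 4))"
    proof -
      have "- b - 1 = - (b + 1)" by simp
      then show ?thesis
        unfolding Q_def by (simp only: eq[symmetric]) (simp add: b_def algebra_simps)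
    qed
    moreover have "k * ((\<alpha> + 1) * x * (- 2 * i) * x' + (- b * y' * (- 2 * j)) * y)
        = k * ((\<alpha> + 2) * y * y' * j - 2 * (\<alpha> + 1) * x * x' * i)" for k x x' y y' i j
      by (simp add: b_def algebra_simps)
    moreover have "\<alpha> + 1 - 1 = \<alpha>" by simp
    ultimately show ?thesis
      unfolding poisson_kernel_deriv_def A_def by (simp only:)
  qed
  ultimately show ?thesis by simp
qed

lemma poisson_kernel_deriv_linear:
  "poisson_kernel_deriv \<alpha> w (of_real a * v + of_real b * u)
     = a * poisson_kernel_deriv \<alpha> w v + b * poisson_kernel_deriv \<alpha> w u"
proof -
  have "x \<bullet> (of_real a * v + of_real b * u) = a * (x \<bullet> v) + b * (x \<bullet> u)" for x :: complex
    by (simp add: inner_add_right flip: scaleR_conv_of_real)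
  then show ?thesis
    unfolding poisson_kernel_deriv_def by (simp add: algebra_simps)
qed

lemma continuous_on_poisson_kernel_deriv:
  "continuous_on ({w. cmod w < 1} \<times> UNIV) (\<lambda>(w, v). poisson_kernel_deriv \<alpha> w v)"
proof -
  have "1 - (cmod w)\<^sup>2 \<noteq> 0" "1 - w \<noteq> 0" if "cmod w < 1" for w
    using disc_weight_pos[OF that] by auto
  then show ?thesis
    unfolding poisson_kernel_deriv_def split_beta
    by (intro continuous_intros) auto
qed

lemma continuous_on_poisson_kernel:
  "continuous_on {w. cmod w < 1} (poisson_kernel \<alpha>)"
proof -
  have "1 - (cmod w)\<^sup>2 \<noteq> 0" "1 - w \<noteq> 0" "cmod (1 - w) powr (\<alpha> + 2) \<noteq> 0" if "cmod w < 1" for w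
    using disc_weight_pos[OF that] by auto
  then show ?thesis
    unfolding poisson_kernel_def
    by (intro continuous_intros) auto
qed

text \<open>For \<open>\<alpha> = 0\<close> this is the conjugate Poisson kernel.\<close>

definition conjugate_kernel :: "real \<Rightarrow> complex \<Rightarrow> real" where
  "conjugate_kernel \<alpha> w = (1 - (cmod w)\<^sup>2) powr \<alpha> * (2 * Im w) * cmod (1 - w) powr (- (\<alpha> + 2))"

text \<open>The differential of \<open>conjugate_kernel \<alpha>\<close> at \<open>w\<close> in the angular direction \<open>\<i> w\<close>.\<close>

definition conjugate_kernel_angular :: "real \<Rightarrow> complex \<Rightarrow> real" where
  "conjugate_kernel_angular \<alpha> w = (1 - (cmod w)\<^sup>2) powr \<alpha> *
     (2 * Re w * cmod (1 - w) powr (- (\<alpha> + 2))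
      - 2 * (\<alpha> + 2) * (Im w)\<^sup>2 * cmod (1 - w) powr (- (\<alpha> + 4)))"

text \<open>The defect in the Cauchy-Riemann equation that holds between the Poisson kernel and its
conjugate when \<open>\<alpha> = 0\<close>.\<close>

definition radial_remainder :: "real \<Rightarrow> complex \<Rightarrow> real" where
  "radial_remainder \<alpha> w = \<alpha> / 2 * (1 - (cmod w)\<^sup>2) powr \<alpha> * cmod (1 - w) powr (- (\<alpha> + 2)) *
     (1 - (cmod w)\<^sup>2 - (cmod (1 - w))\<^sup>2)"

text \<open>With \<open>\<rho> = 1 - (cmod w)\<^sup>2\<close>, the radial derivative of the kernel is as large as
\<open>\<rho> powr \<alpha> * cmod (1 - w) powr (-(\<alpha> + 2))\<close>; its mass over a circle is of order \<open>1 / \<rho>\<close>, which is not integrable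
over the disc. Up to a remainder that is smaller by a factor \<open>cmod (1 - w)\<close> it is an
angular derivative, which integration by parts moves to the boundary function. Over the common factor the identity is one between polynomials in
the real and imaginary part of \<open>w\<close>.\<close>

lemma poisson_kernel_radial_identity:
  assumes w: "cmod w < 1"
  shows "poisson_kernel_deriv \<alpha> w w
    = poisson_const \<alpha> * (conjugate_kernel_angular \<alpha> w + radial_remainder \<alpha> w)"
proof -
  define \<rho> where "\<rho> = 1 - (cmod w)\<^sup>2"
  define d where "d = cmod (1 - w)"
  have pos: "\<rho> > 0" "d > 0" using disc_weight_pos[OF w] by (auto simp: \<rho>_def d_def)
  define X where "X = \<rho> powr \<alpha> * d powr (- (\<alpha> + 4))"
  have p1: "\<rho> powr (\<alpha> + 1) = \<rho> powr \<alpha> * \<rho>" using pos by (simp add: powr_add)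
  have p2: "d powr (- (\<alpha> + 2)) = d powr (- (\<alpha> + 4)) * d\<^sup>2"
  proof -
    have "d powr (- (\<alpha> + 2)) = d powr (- (\<alpha> + 4) + 2)" by (simp add: algebra_simps)
    also have "\<dots> = d powr (- (\<alpha> + 4)) * d powr 2" by (rule powr_add)
    finally show ?thesis using pos by simp
  qed
  define x y where "x = Re w" and "y = Im w"
  have r: "\<rho> = 1 - x\<^sup>2 - y\<^sup>2" by (simp add: \<rho>_def x_def y_def cmod_power2)
  have dq: "d\<^sup>2 = (1 - x)\<^sup>2 + y\<^sup>2" by (simp add: d_def x_def y_def cmod_power2)
  have in1: "w \<bullet> w = x\<^sup>2 + y\<^sup>2" by (simp add: inner_complex_def x_def y_def power2_eq_square)
  have in2: "(1 - w) \<bullet> w = (1 - x) * x - y\<^sup>2" by (simp add: inner_complex_def x_def y_def power2_eq_square)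
  have poly: "(\<alpha> + 2) * \<rho> * ((1 - x) * x - y\<^sup>2) - 2 * (\<alpha> + 1) * d\<^sup>2 * (x\<^sup>2 + y\<^sup>2)
      = (2 * x * d\<^sup>2 - 2 * (\<alpha> + 2) * y\<^sup>2) + \<alpha> / 2 * d\<^sup>2 * (\<rho> - d\<^sup>2)"
    unfolding r dq by algebra
  have "poisson_kernel_deriv \<alpha> w w = poisson_const \<alpha> * (X * ((\<alpha> + 2) * \<rho> * ((1 - x) * x - y\<^sup>2) - 2 * (\<alpha> + 1) * d\<^sup>2 * (x\<^sup>2 + y\<^sup>2)))"
    unfolding poisson_kernel_deriv_def in1 in2 \<rho>_def[symmetric] d_def[symmetric] p1 p2 X_def
    by (simp add: algebra_simps)
  also have "\<dots> = poisson_const \<alpha> * (X * ((2 * x * d\<^sup>2 - 2 * (\<alpha> + 2) * y\<^sup>2) + \<alpha> / 2 * d\<^sup>2 * (\<rho> - d\<^sup>2)))"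
    by (simp only: poly)
  also have "\<dots> = poisson_const \<alpha> * (conjugate_kernel_angular \<alpha> w + radial_remainder \<alpha> w)"
    unfolding conjugate_kernel_angular_def radial_remainder_def \<rho>_def[symmetric] d_def[symmetric] p2 X_def
      x_def[symmetric] y_def[symmetric]
    by (simp add: algebra_simps)
  finally show ?thesis .
qed

lemma rotation_has_vector_derivative:
  "((\<lambda>t. z * cis (- t)) has_vector_derivative (- \<i> * (z * cis (- t)))) (at t within S)"
proof -
  have "((\<lambda>t. cis (- t)) has_vector_derivative ((- 1) *\<^sub>R (\<i> * cis (- t)))) (at t within S)"
    unfolding cis_conv_exp
    by (auto intro!: derivative_eq_intros has_vector_derivative_real_field)
  from has_vector_derivative_mult_right[OF this, of z] show ?thesis
    by (simp add: mult_ac)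
qed

text \<open>As \<open>t\<close> grows, \<open>z * cis (- t)\<close> turns clockwise, hence the sign.\<close>

lemma conjugate_kernel_along_circle:
  assumes z: "cmod z < 1"
  shows "((\<lambda>t. conjugate_kernel \<alpha> (z * cis (- t))) has_real_derivative
     - conjugate_kernel_angular \<alpha> (z * cis (- t))) (at t)"
proof -
  define w where "w t = z * cis (- t)" for t
  have nw: "cmod (w t) = cmod z" for t by (simp add: w_def norm_mult)
  have w': "(w has_vector_derivative (- \<i> * w t)) (at t)"
    unfolding w_def by (rule rotation_has_vector_derivative)
  have Re: "((\<lambda>t. Re (w t)) has_real_derivative Im (w t)) (at t)"
  proof -
    have "Re (- \<i> * w t) = Im (w t)" by simp
    then show ?thesis
      using bounded_linear.has_vector_derivative[OF bounded_linear_Re w']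
      by (simp only: has_real_derivative_iff_has_vector_derivative)
  qed
  have Im: "((\<lambda>t. Im (w t)) has_real_derivative (- Re (w t))) (at t)"
  proof -
    have "Im (- \<i> * w t) = - Re (w t)" by simp
    then show ?thesis
      using bounded_linear.has_vector_derivative[OF bounded_linear_Im w']
      by (simp only: has_real_derivative_iff_has_vector_derivative)
  qed
  have q_eq: "(cmod (1 - w t))\<^sup>2 = 1 - 2 * Re (w t) + (cmod z)\<^sup>2" for t
    unfolding nw[of t, symmetric] cmod_power2 by (simp add: power2_eq_square algebra_simps)
  define Q where "Q t = 1 - 2 * Re (w t) + (cmod z)\<^sup>2" for t
  define b where "b = \<alpha> / 2 + 1"
  have Qpos: "Q t > 0"
    unfolding Q_def q_eq[symmetric] using disc_weight_pos(2)[of "w t"] z nw[of t] by simp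
  have Q': "(Q has_real_derivative (- 2 * Im (w t))) (at t)"
  proof -
    have "(Q has_real_derivative (0 - 2 * Im (w t) + 0)) (at t)"
      unfolding Q_def by (intro DERIV_add DERIV_diff DERIV_const DERIV_cmult Re)
    then show ?thesis by simp
  qed
  have Qp: "((\<lambda>s. Q s powr (- b)) has_real_derivative (- b * Q t powr (- b - 1) * (- 2 * Im (w t)))) (at t)"
    using DERIV_chain2[OF has_real_derivative_powr[OF Qpos, of "- b"] Q'] by simp
  have eq: "cmod u powr (- (r * 2)) = ((cmod u)\<^sup>2) powr (- r)" for u r
    using powr_square_eq[of "cmod u" "- r"] by (simp add: mult.commute)
  have e1: "Q s powr (- b) = cmod (1 - w s) powr (- (\<alpha> + 2))" for s
    unfolding Q_def q_eq[symmetric] eq[symmetric] by (simp add: b_def)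
  have e2: "Q s powr (- b - 1) = cmod (1 - w s) powr (- (\<alpha> + 4))" for s
  proof -
    have "- b - 1 = - (b + 1)" by simp
    then show ?thesis
      unfolding Q_def q_eq[symmetric] by (simp only: eq[symmetric]) (simp add: b_def algebra_simps)
  qed
  have K: "conjugate_kernel \<alpha> (w s) = (1 - (cmod z)\<^sup>2) powr \<alpha> * ((2 * Im (w s)) * Q s powr (- b))" for s
    by (simp add: conjugate_kernel_def e1 nw)
  have "((\<lambda>s. conjugate_kernel \<alpha> (w s)) has_real_derivative
     (1 - (cmod z)\<^sup>2) powr \<alpha> * ((2 * (- Re (w t))) * Q t powr (- b)
        + (- b * Q t powr (- b - 1) * (- 2 * Im (w t))) * (2 * Im (w t)))) (at t)"
    unfolding K by (intro DERIV_cmult DERIV_mult Im Qp)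
  moreover have "(1 - (cmod z)\<^sup>2) powr \<alpha> * ((2 * (- Re (w t))) * Q t powr (- b)
        + (- b * Q t powr (- b - 1) * (- 2 * Im (w t))) * (2 * Im (w t))) = - conjugate_kernel_angular \<alpha> (w t)"
  proof -
    have "k * ((2 * (- x)) * D + (- b * E * (- 2 * y)) * (2 * y)) = - (k * (2 * x * D - 2 * (\<alpha> + 2) * y\<^sup>2 * E))"
      for k x y D E
      by (simp add: b_def power2_eq_square algebra_simps)
    then show ?thesis
      unfolding e1 e2 conjugate_kernel_angular_def nw by (simp only:)
  qed
  ultimately show ?thesis by (simp add: w_def)
qed

text \<open>With \<open>\<rho> = 1 - (cmod w)\<^sup>2\<close>, each of the three kernels is \<open>\<rho> powr \<alpha> * cmod (1 - w) powr (-(\<alpha> + 2))\<close>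
times a factor of size at most a multiple of \<open>cmod (1 - w)\<close>, because \<open>\<rho> \<le> 2 cmod (1 - w)\<close>. The same inequality shows that lowering \<open>\<alpha>\<close> to \<open>\<beta>\<close>
enlarges the majorant; this is how \<open>\<alpha> = 0\<close> is reduced to a negative exponent.\<close>

lemma kernels_le_model_kernel:
  assumes \<alpha>: "- 1 < \<alpha>" "\<alpha> \<le> 0" and \<beta>: "\<beta> \<le> \<alpha>"
  obtains C where "C > 0"
    and "\<And>w. cmod w < 1 \<Longrightarrow> \<bar>poisson_kernel \<alpha> w\<bar> \<le> C * model_kernel \<beta> w"
    and "\<And>w. cmod w < 1 \<Longrightarrow> \<bar>poisson_const \<alpha> * conjugate_kernel \<alpha> w\<bar> \<le> C * model_kernel \<beta> w"
    and "\<And>w. cmod w < 1 \<Longrightarrow> \<bar>poisson_const \<alpha> * radial_remainder \<alpha> w\<bar> \<le> C * model_kernel \<beta> w"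
proof -
  define c where "c = \<bar>poisson_const \<alpha>\<bar>"
  have c: "c \<ge> 0" by (simp add: c_def)
  have same: "model_kernel \<alpha> w \<le> 2 powr (\<alpha> - \<beta>) * model_kernel \<beta> w" if w: "cmod w < 1" for w
  proof -
    define \<rho> where "\<rho> = 1 - (cmod w)\<^sup>2"
    define d where "d = cmod (1 - w)"
    have pos: "\<rho> > 0" "d > 0" "\<rho> \<le> 2 * d" using disc_weight_pos[OF w] by (auto simp: \<rho>_def d_def)
    have "\<rho> powr \<alpha> * d powr (- (\<alpha> + 1)) = (\<rho> powr (\<alpha> - \<beta>) * d powr (- (\<alpha> - \<beta>))) * (\<rho> powr \<beta> * d powr (- (\<beta> + 1)))"
    proof -
      have "\<rho> powr \<alpha> = \<rho> powr (\<alpha> - \<beta>) * \<rho> powr \<beta>" by (simp flip: powr_add)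
      moreover have "d powr (- (\<alpha> + 1)) = d powr (- (\<alpha> - \<beta>)) * d powr (- (\<beta> + 1))"
        by (simp flip: powr_add)
      ultimately show ?thesis by simp
    qed
    also have "\<rho> powr (\<alpha> - \<beta>) * d powr (- (\<alpha> - \<beta>)) = (\<rho> / d) powr (\<alpha> - \<beta>)"
      using pos powr_divide[of \<rho> d "\<alpha> - \<beta>"] by (simp only: powr_minus divide_inverse less_imp_le)
    also have "(\<rho> / d) powr (\<alpha> - \<beta>) \<le> 2 powr (\<alpha> - \<beta>)"
      using pos \<beta> by (intro powr_mono2) (auto simp: field_simps)
    finally show ?thesis
      by (simp add: model_kernel_def \<rho>_def d_def mult_right_mono)
  qed
  define C where "C = 2 * (c + 1) * 2 powr (\<alpha> - \<beta>)"
  have base: "x \<le> C * model_kernel \<beta> w" if "x \<le> 2 * c * model_kernel \<alpha> w" and w: "cmod w < 1" for x w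
  proof -
    have "x \<le> 2 * (c + 1) * model_kernel \<alpha> w"
      using that(1) by (rule order_trans) (intro mult_right_mono, auto)
    also have "\<dots> \<le> 2 * (c + 1) * (2 powr (\<alpha> - \<beta>) * model_kernel \<beta> w)"
      using c same[OF w] by (intro mult_left_mono) auto
    finally show ?thesis by (simp add: C_def mult.assoc)
  qed
  show thesis
  proof
    show "C > 0" using c by (simp add: C_def)
    fix w :: complex assume w: "cmod w < 1"
    define \<rho> where "\<rho> = 1 - (cmod w)\<^sup>2"
    define d where "d = cmod (1 - w)"
    have pos: "\<rho> > 0" "d > 0" "\<rho> \<le> 2 * d" "d < 2" using disc_weight_pos[OF w] by (auto simp: \<rho>_def d_def)
    have m: "model_kernel \<alpha> w = \<rho> powr \<alpha> * d powr (- (\<alpha> + 2)) * d"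
    proof -
      have "d powr (- (\<alpha> + 1)) = d powr (- (\<alpha> + 2)) * d powr 1"
        unfolding powr_add[symmetric] by (simp add: algebra_simps)
      then show ?thesis using pos by (simp add: model_kernel_def \<rho>_def d_def)
    qed
    define X where "X = \<rho> powr \<alpha> * d powr (- (\<alpha> + 2))"
    have X: "X \<ge> 0" by (simp add: X_def)
    have scale: "c * (X * y) \<le> 2 * c * model_kernel \<alpha> w" if "y \<le> 2 * d" for y
    proof -
      have "c * (X * y) \<le> c * (X * (2 * d))" using c X that by (intro mult_left_mono) auto
      then show ?thesis by (simp add: m X_def algebra_simps)
    qed
    have "\<bar>poisson_kernel \<alpha> w\<bar> = c * (X * \<rho>)"
    proof -
      have "\<rho> powr (\<alpha> + 1) = \<rho> powr \<alpha> * \<rho>" using pos by (simp add: powr_add)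
      moreover have "inverse (d powr (\<alpha> + 2)) = d powr (- (\<alpha> + 2))" by (rule powr_minus[symmetric])
      ultimately have "poisson_kernel \<alpha> w = poisson_const \<alpha> * (X * \<rho>)"
        by (simp only: poisson_kernel_def \<rho>_def[symmetric] d_def[symmetric] X_def divide_inverse mult_ac)
      then show ?thesis using pos X by (simp add: c_def abs_mult)
    qed
    then show "\<bar>poisson_kernel \<alpha> w\<bar> \<le> C * model_kernel \<beta> w"
      using scale[of \<rho>] pos by (intro base w) simp
    have "\<bar>poisson_const \<alpha> * conjugate_kernel \<alpha> w\<bar> = c * (X * (2 * \<bar>Im w\<bar>))"
      by (simp add: conjugate_kernel_def c_def X_def \<rho>_def d_def abs_mult mult_ac)
    moreover have "2 * \<bar>Im w\<bar> \<le> 2 * d" using abs_Im_le_cmod[of "1 - w"] by (simp add: d_def)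
    ultimately show "\<bar>poisson_const \<alpha> * conjugate_kernel \<alpha> w\<bar> \<le> C * model_kernel \<beta> w"
      using scale[of "2 * \<bar>Im w\<bar>"] by (intro base w) simp
    have "\<bar>poisson_const \<alpha> * radial_remainder \<alpha> w\<bar> = c * (X * (\<bar>\<alpha>\<bar> / 2 * \<bar>\<rho> - d\<^sup>2\<bar>))"
      by (simp add: radial_remainder_def c_def X_def \<rho>_def[symmetric] d_def[symmetric] abs_mult mult_ac)
    moreover have "\<bar>\<alpha>\<bar> / 2 * \<bar>\<rho> - d\<^sup>2\<bar> \<le> 1 * (2 * d)"
    proof (rule mult_mono)
      have "d\<^sup>2 \<le> 2 * d" using pos by (simp add: power2_eq_square)
      moreover have "0 \<le> d\<^sup>2" by simp
      ultimately show "\<bar>\<rho> - d\<^sup>2\<bar> \<le> 2 * d" using pos by linarith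
    qed (use \<alpha> in auto)
    ultimately show "\<bar>poisson_const \<alpha> * radial_remainder \<alpha> w\<bar> \<le> C * model_kernel \<beta> w"
      using scale[of "\<bar>\<alpha>\<bar> / 2 * \<bar>\<rho> - d\<^sup>2\<bar>"] by (intro base w) simp
  qed
qed

section \<open>Derivatives of Poisson type integrals\<close>

text \<open>A bridge from gauge integrals, in which integration by parts is phrased, to nonnegative
Lebesgue integrals, in which the estimates are carried out.\<close>

lemma norm_has_integral_le_nn_integral:
  fixes f :: "real \<Rightarrow> complex"
  assumes f: "(f has_integral I) S" and S: "S \<in> sets borel"
    and le: "AE x in lborel. x \<in> S \<longrightarrow> norm (f x) \<le> h x"
    and fin: "(\<integral>\<^sup>+x. ennreal (h x) * indicator S x \<partial>lborel) < \<infinity>"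
  shows "norm I \<le> enn2real (\<integral>\<^sup>+x. ennreal (h x) * indicator S x \<partial>lborel)"
proof -
  let ?f = "\<lambda>x. indicator S x *\<^sub>R f x"
  have m: "?f \<in> borel_measurable lebesgue"
    by (rule has_integral_implies_lebesgue_measurable[OF f])
  have "(\<integral>\<^sup>+x. ennreal (norm (?f x)) \<partial>lebesgue) = (\<integral>\<^sup>+x. ennreal (norm (?f x)) \<partial>lborel)"
    by (rule nn_integral_completion)
  also have "\<dots> \<le> (\<integral>\<^sup>+x. ennreal (h x) * indicator S x \<partial>lborel)"
    using le by (intro nn_integral_mono_AE) (auto elim!: eventually_mono simp: indicator_def intro!: ennreal_leI)
  finally have b: "(\<integral>\<^sup>+x. ennreal (norm (?f x)) \<partial>lebesgue) \<le> (\<integral>\<^sup>+x. ennreal (h x) * indicator S x \<partial>lborel)" .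
  have int: "integrable lebesgue ?f"
    using m le_less_trans[OF b fin] by (intro integrableI_bounded) auto
  then have "f absolutely_integrable_on S" by (simp add: set_integrable_def)
  from set_lebesgue_integral_eq_integral(2)[OF this] integral_unique[OF f]
  have "I = integral\<^sup>L lebesgue ?f" by (simp add: set_lebesgue_integral_def)
  then have "ennreal (norm I) \<le> (\<integral>\<^sup>+x. ennreal (norm (?f x)) \<partial>lebesgue)"
    using integral_norm_bound_ennreal[OF int] by simp
  then have "ennreal (norm I) \<le> (\<integral>\<^sup>+x. ennreal (h x) * indicator S x \<partial>lborel)"
    using b by (rule order_trans)
  then show ?thesis using fin by (metis enn2real_ennreal enn2real_mono norm_ge_zero infinity_ennreal_def)
qed

lemma poisson_integral_eq_integral:
  assumes g: "continuous_on {0..2 * pi} (\<lambda>t. F (cis t))" and z: "cmod z < 1"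
  shows "poisson_integral \<alpha> F z = 1 / (2 * of_real pi) *
     integral {0..2 * pi} (\<lambda>t. of_real (poisson_kernel \<alpha> (z * cis (- t))) * F (cis t))"
    and "continuous_on {0..2 * pi} (\<lambda>t. of_real (poisson_kernel \<alpha> (z * cis (- t))) * F (cis t))"
proof -
  have "continuous_on {0..2 * pi} (\<lambda>t. poisson_kernel \<alpha> (z * cis (- t)))"
    using z by (intro continuous_on_compose2[OF continuous_on_poisson_kernel] continuous_intros)
      (auto simp: norm_mult)
  then show c: "continuous_on {0..2 * pi} (\<lambda>t. of_real (poisson_kernel \<alpha> (z * cis (- t))) * F (cis t))"
    by (intro continuous_intros g)
  show "poisson_integral \<alpha> F z = 1 / (2 * of_real pi) *
     integral {0..2 * pi} (\<lambda>t. of_real (poisson_kernel \<alpha> (z * cis (- t))) * F (cis t))"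
    unfolding poisson_integral_def
    by (subst lebesgue_integral_eq_integral) (auto intro!: continuous_imp_integrable_real c)
qed

text \<open>The derivative of the integral in the direction \<open>v\<close>, with the differentiation performed on the
kernel.\<close>

definition poisson_integral_deriv :: "real \<Rightarrow> (complex \<Rightarrow> complex) \<Rightarrow> complex \<Rightarrow> complex \<Rightarrow> complex" where
  "poisson_integral_deriv \<alpha> F v z = 1 / (2 * of_real pi) *
     integral {0..2 * pi} (\<lambda>t. of_real (poisson_kernel_deriv \<alpha> (z * cis (- t)) (v * cis (- t))) * F (cis t))"

lemma continuous_on_poisson_deriv_integrand:
  fixes F :: "complex \<Rightarrow> complex" and \<zeta> :: "'a::topological_space \<Rightarrow> complex"
  assumes g: "continuous_on {0..2 * pi} (\<lambda>t. F (cis t))"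
    and \<zeta>: "continuous_on U \<zeta>" and U: "\<And>x. x \<in> U \<Longrightarrow> cmod (\<zeta> x) < 1"
  shows "continuous_on (U \<times> {0..2 * pi}) (\<lambda>(x, t).
     of_real (poisson_kernel_deriv \<alpha> (\<zeta> x * cis (- t)) (v * cis (- t))) * F (cis t))"
proof -
  have \<zeta>': "continuous_on (U \<times> {0..2 * pi}) (\<lambda>p. \<zeta> (fst p))"
    by (rule continuous_on_compose2[OF \<zeta>]) (auto intro: continuous_intros)
  have g': "continuous_on (U \<times> {0..2 * pi}) (\<lambda>p. F (cis (snd p)))"
    by (rule continuous_on_compose2[OF g]) (auto intro: continuous_intros)
  have "continuous_on (U \<times> {0..2 * pi})
     (\<lambda>p. (\<lambda>(w, v). poisson_kernel_deriv \<alpha> w v) (\<zeta> (fst p) * cis (- snd p), v * cis (- snd p)))"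
    by (rule continuous_on_compose2[OF continuous_on_poisson_kernel_deriv])
       (auto intro!: continuous_intros \<zeta>' U simp: norm_mult)
  then show ?thesis
    unfolding split_beta by (auto intro!: continuous_intros g')
qed

lemma poisson_integral_has_derivative_along:
  assumes g: "continuous_on {0..2 * pi} (\<lambda>t. F (cis t))" and z: "cmod z < 1"
  shows "((\<lambda>h. poisson_integral \<alpha> F (z + of_real h * v)) has_vector_derivative
           poisson_integral_deriv \<alpha> F v z) (at 0)"
proof -
  define e where "e = (1 - cmod z) / (cmod v + 1)"
  have e: "e > 0" using z by (simp add: e_def add_nonneg_pos)
  have ev: "e * cmod v < 1 - cmod z"
  proof -
    have "e * cmod v < e * (cmod v + 1)" using e by (intro mult_strict_left_mono) auto
    also have "\<dots> = 1 - cmod z" unfolding e_def using norm_ge_zero[of v] by (simp add: add_nonneg_eq_0_iff)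
    finally show ?thesis .
  qed
  define U where "U = {- e<..<e}"
  have U: "cmod (z + of_real h * v) < 1" if "h \<in> U" for h
  proof -
    have "\<bar>h\<bar> * cmod v \<le> e * cmod v" using that by (intro mult_right_mono) (auto simp: U_def)
    then show ?thesis
      using norm_triangle_ineq[of z "of_real h * v"] ev by (simp add: norm_mult)
  qed
  let ?k = "\<lambda>h t. of_real (poisson_kernel \<alpha> ((z + of_real h * v) * cis (- t))) * F (cis t)"
  let ?k' = "\<lambda>h t. of_real (poisson_kernel_deriv \<alpha> ((z + of_real h * v) * cis (- t)) (v * cis (- t))) * F (cis t)"
  have "((\<lambda>h. integral (cbox 0 (2 * pi)) (?k h)) has_vector_derivative integral (cbox 0 (2 * pi)) (?k' 0)) (at 0 within U)"
  proof (rule leibniz_rule_vector_derivative[where U=U])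
    fix h t assume h: "h \<in> U"
    have "((\<lambda>h. (z + of_real h * v) * cis (- t)) has_vector_derivative ((0 + of_real 1 * v) * cis (- t))) (at h within U)"
      by (intro has_vector_derivative_mult_left has_vector_derivative_add has_vector_derivative_const
          has_vector_derivative_of_real DERIV_ident)
    then have path: "((\<lambda>h. (z + of_real h * v) * cis (- t)) has_vector_derivative (v * cis (- t))) (at h within U)"
      by simp
    have "cmod ((z + of_real h * v) * cis (- t)) < 1" using U[OF h] by (simp add: norm_mult)
    from poisson_kernel_has_derivative_along[OF path this]
    show "((\<lambda>h. ?k h t) has_vector_derivative ?k' h t) (at h within U)"
      by (intro has_vector_derivative_mult_left has_vector_derivative_of_real)
  next
    fix h assume "h \<in> U"
    then show "?k h integrable_on cbox 0 (2 * pi)"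
      using poisson_integral_eq_integral(2)[OF g U] by (intro integrable_continuous) simp
  next
    have "continuous_on (U \<times> {0..2 * pi}) (\<lambda>(h, t). ?k' h t)"
      by (rule continuous_on_poisson_deriv_integrand[OF g _ U]) (auto intro!: continuous_intros)
    then show "continuous_on (U \<times> cbox 0 (2 * pi)) (\<lambda>(h, t). ?k' h t)" by simp
  qed (use e in \<open>auto simp: U_def convex_real_interval\<close>)
  then have "((\<lambda>h. 1 / (2 * of_real pi) * integral {0..2 * pi} (?k h)) has_vector_derivative
      poisson_integral_deriv \<alpha> F v z) (at 0 within U)"
    unfolding poisson_integral_deriv_def by (intro has_vector_derivative_mult_right) simp
  then have "((\<lambda>h. 1 / (2 * of_real pi) * integral {0..2 * pi} (?k h)) has_vector_derivative
      poisson_integral_deriv \<alpha> F v z) (at 0)"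
    using e by (subst (asm) at_within_open) (auto simp: U_def)
  then show ?thesis
  proof (rule has_vector_derivative_transform_within_open[where S=U])
    show "open U" "0 \<in> U" using e by (auto simp: U_def)
    show "1 / (2 * of_real pi) * integral {0..2 * pi} (?k h) = poisson_integral \<alpha> F (z + of_real h * v)"
      if "h \<in> U" for h
      by (rule poisson_integral_eq_integral(1)[OF g U[OF that], symmetric])
  qed
qed

lemma continuous_on_poisson_integral_deriv:
  assumes g: "continuous_on {0..2 * pi} (\<lambda>t. F (cis t))"
  shows "continuous_on (ball 0 1) (poisson_integral_deriv \<alpha> F v)"
proof -
  have "continuous_on (ball 0 1 \<times> {0..2 * pi}) (\<lambda>(z, t).
     of_real (poisson_kernel_deriv \<alpha> (z * cis (- t)) (v * cis (- t))) * F (cis t))"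
    by (rule continuous_on_poisson_deriv_integrand[OF g]) auto
  then have "continuous_on (ball 0 1) (\<lambda>z. integral (cbox 0 (2 * pi))
      (\<lambda>t. of_real (poisson_kernel_deriv \<alpha> (z * cis (- t)) (v * cis (- t))) * F (cis t)))"
    by (intro integral_continuous_on_param) simp
  then show ?thesis
    unfolding poisson_integral_deriv_def by (intro continuous_intros) simp
qed

lemma poisson_deriv_integrand_has_integral:
  assumes g: "continuous_on {0..2 * pi} (\<lambda>t. F (cis t))" and z: "cmod z < 1"
  shows "((\<lambda>t. of_real (poisson_kernel_deriv \<alpha> (z * cis (- t)) (v * cis (- t))) * F (cis t))
     has_integral (2 * of_real pi * poisson_integral_deriv \<alpha> F v z)) {0..2 * pi}"
proof -
  let ?h = "\<lambda>t. of_real (poisson_kernel_deriv \<alpha> (z * cis (- t)) (v * cis (- t))) * F (cis t)"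
  have "continuous_on ({0::real} \<times> {0..2 * pi}) (\<lambda>(x, t). ?h t)"
    by (rule continuous_on_poisson_deriv_integrand[OF g, where \<zeta>="\<lambda>_. z"]) (use z in auto)
  then have "continuous_on {0..2 * pi} (\<lambda>t. (\<lambda>(x, t). ?h t) (0::real, t))"
    by (rule continuous_on_compose2) (auto intro: continuous_intros)
  then have "?h integrable_on {0..2 * pi}" by (intro integrable_continuous_interval) simp
  then show ?thesis
    unfolding poisson_integral_deriv_def by (simp add: has_integral_integral)
qed

lemma poisson_integral_deriv_linear:
  assumes g: "continuous_on {0..2 * pi} (\<lambda>t. F (cis t))" and z: "cmod z < 1"
  shows "poisson_integral_deriv \<alpha> F (of_real a * v + of_real b * u) z
     = of_real a * poisson_integral_deriv \<alpha> F v z + of_real b * poisson_integral_deriv \<alpha> F u z"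
proof -
  note P = poisson_deriv_integrand_has_integral[OF g z, of \<alpha>]
  have "((\<lambda>t. of_real a * (of_real (poisson_kernel_deriv \<alpha> (z * cis (- t)) (v * cis (- t))) * F (cis t))
      + of_real b * (of_real (poisson_kernel_deriv \<alpha> (z * cis (- t)) (u * cis (- t))) * F (cis t)))
     has_integral (of_real a * (2 * of_real pi * poisson_integral_deriv \<alpha> F v z)
       + of_real b * (2 * of_real pi * poisson_integral_deriv \<alpha> F u z))) {0..2 * pi}"
    by (intro has_integral_add has_integral_mult_right P)
  also have "(\<lambda>t. of_real a * (of_real (poisson_kernel_deriv \<alpha> (z * cis (- t)) (v * cis (- t))) * F (cis t))
      + of_real b * (of_real (poisson_kernel_deriv \<alpha> (z * cis (- t)) (u * cis (- t))) * F (cis t)))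
    = (\<lambda>t. of_real (poisson_kernel_deriv \<alpha> (z * cis (- t)) ((of_real a * v + of_real b * u) * cis (- t))) * F (cis t))"
  proof
    fix t
    have "(of_real a * v + of_real b * u) * cis (- t) = of_real a * (v * cis (- t)) + of_real b * (u * cis (- t))"
      by (simp add: algebra_simps)
    then show "of_real a * (of_real (poisson_kernel_deriv \<alpha> (z * cis (- t)) (v * cis (- t))) * F (cis t))
      + of_real b * (of_real (poisson_kernel_deriv \<alpha> (z * cis (- t)) (u * cis (- t))) * F (cis t))
      = of_real (poisson_kernel_deriv \<alpha> (z * cis (- t)) ((of_real a * v + of_real b * u) * cis (- t))) * F (cis t)"
      by (simp only: poisson_kernel_deriv_linear) (simp add: algebra_simps)
  qed
  finally have "of_real a * (2 * of_real pi * poisson_integral_deriv \<alpha> F v z)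
       + of_real b * (2 * of_real pi * poisson_integral_deriv \<alpha> F u z)
    = 2 * of_real pi * poisson_integral_deriv \<alpha> F (of_real a * v + of_real b * u) z"
    using P has_integral_unique by blast
  then have "2 * of_real pi * (of_real a * poisson_integral_deriv \<alpha> F v z + of_real b * poisson_integral_deriv \<alpha> F u z)
    = 2 * of_real pi * poisson_integral_deriv \<alpha> F (of_real a * v + of_real b * u) z"
    by (simp add: algebra_simps)
  then show ?thesis by simp
qed

text \<open>The directions \<open>z\<close> and \<open>\<i> z\<close> are radial and angular. In both, the kernel is an angular derivative
up to \<open>radial_remainder\<close>, so integrating by parts around the circle replaces it by kernels below the
model kernel, at the price of the derivative of the boundary function.\<close>

lemma polar_derivatives_le_model_integral:
  fixes H :: "real \<Rightarrow> real"
  assumes ac: "absolutely_continuous_circle F"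
    and \<alpha>: "- 1 < \<alpha>" "\<alpha> \<le> 0" and \<beta>: "\<beta> \<le> \<alpha>"
    and H: "AE t in lborel. t \<in> {0..2 * pi} \<longrightarrow>
        cmod (F (cis t)) + cmod (vector_derivative (\<lambda>t. F (cis t)) (at t)) \<le> H t"
    and H0: "\<And>t. 0 \<le> H t" and H_meas [measurable]: "H \<in> borel_measurable borel"
  defines "I \<equiv> \<lambda>z. \<integral>\<^sup>+t. ennreal (model_kernel \<beta> (z * cis (- t)) * H t) * indicator {0..2 * pi} t \<partial>lborel"
  assumes fin: "\<And>z. z \<in> ball 0 1 \<Longrightarrow> I z < \<infinity>"
  obtains C where "C > 0"
    and "\<And>z. cmod z < 1 \<Longrightarrow> cmod (poisson_integral_deriv \<alpha> F z z) \<le> C * enn2real (I z)"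
    and "\<And>z. cmod z < 1 \<Longrightarrow> cmod (poisson_integral_deriv \<alpha> F (\<i> * z) z) \<le> C * enn2real (I z)"
proof -
  define g where "g t = F (cis t)" for t
  define D where "D t = vector_derivative g (at t)" for t
  define c where "c = poisson_const \<alpha>"
  have g_ac: "absolutely_continuous_on {0..2 * pi} g"
    using ac unfolding absolutely_continuous_circle_def g_def[abs_def] .
  have g_cont: "continuous_on {0..2 * pi} g"
    by (rule absolutely_continuous_imp_continuous_on[OF g_ac])
  have g_per: "g (2 * pi) = g 0" by (simp add: g_def cis_2pi)
  obtain C where C: "C > 0"
    "\<And>w. cmod w < 1 \<Longrightarrow> \<bar>poisson_kernel \<alpha> w\<bar> \<le> C * model_kernel \<beta> w"
    "\<And>w. cmod w < 1 \<Longrightarrow> \<bar>c * conjugate_kernel \<alpha> w\<bar> \<le> C * model_kernel \<beta> w"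
    "\<And>w. cmod w < 1 \<Longrightarrow> \<bar>c * radial_remainder \<alpha> w\<bar> \<le> C * model_kernel \<beta> w"
    using kernels_le_model_kernel[OF \<alpha> \<beta>] unfolding c_def by metis
  have pi1: "(1::real) \<le> 2 * pi" using pi_gt3 by simp
  have bound: "cmod (poisson_integral_deriv \<alpha> F v z) \<le> C * enn2real (I z)"
    if z: "cmod z < 1" and J: "(h has_integral (2 * of_real pi * poisson_integral_deriv \<alpha> F v z)) {0..2 * pi}"
      and h: "\<And>t. h t = of_real (a t) * g t + of_real (b t) * D t"
      and a: "\<And>t. \<bar>a t\<bar> \<le> C * model_kernel \<beta> (z * cis (- t))"
      and b: "\<And>t. \<bar>b t\<bar> \<le> C * model_kernel \<beta> (z * cis (- t))" for z v h a b
  proof -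
    have hC: "(\<integral>\<^sup>+t. ennreal (C * (model_kernel \<beta> (z * cis (- t)) * H t)) * indicator {0..2 * pi} t \<partial>lborel)
        = ennreal C * I z"
      unfolding I_def using C(1) H0
      by (subst nn_integral_cmult[symmetric]) (auto simp: ennreal_mult mult.assoc)
    have fz: "I z < \<infinity>" using fin[of z] z by simp
    have "norm (2 * of_real pi * poisson_integral_deriv \<alpha> F v z)
        \<le> enn2real (\<integral>\<^sup>+t. ennreal (C * (model_kernel \<beta> (z * cis (- t)) * H t)) * indicator {0..2 * pi} t \<partial>lborel)"
    proof (rule norm_has_integral_le_nn_integral[OF J])
      show "AE t in lborel. t \<in> {0..2 * pi} \<longrightarrow> norm (h t) \<le> C * (model_kernel \<beta> (z * cis (- t)) * H t)"
        using H
      proof eventually_elim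
        case (elim t)
        show ?case
        proof
          assume t: "t \<in> {0..2 * pi}"
          have "norm (h t) \<le> \<bar>a t\<bar> * cmod (g t) + \<bar>b t\<bar> * cmod (D t)"
            unfolding h by (rule order_trans[OF norm_triangle_ineq]) (simp add: norm_mult)
          also have "\<dots> \<le> C * model_kernel \<beta> (z * cis (- t)) * cmod (g t) + C * model_kernel \<beta> (z * cis (- t)) * cmod (D t)"
            by (intro add_mono mult_right_mono a b) auto
          also have "\<dots> = C * model_kernel \<beta> (z * cis (- t)) * (cmod (g t) + cmod (D t))"
            by (simp add: algebra_simps)
          also have "\<dots> \<le> C * model_kernel \<beta> (z * cis (- t)) * H t"
            using elim t C(1) unfolding g_def[abs_def] D_def by (intro mult_left_mono) auto
          finally show "norm (h t) \<le> C * (model_kernel \<beta> (z * cis (- t)) * H t)" by (simp add: mult.assoc)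
        qed
      qed
      show "(\<integral>\<^sup>+t. ennreal (C * (model_kernel \<beta> (z * cis (- t)) * H t)) * indicator {0..2 * pi} t \<partial>lborel) < \<infinity>"
        unfolding hC using fz by (simp add: ennreal_mult_less_top)
    qed simp
    also have "\<dots> = C * enn2real (I z)" unfolding hC using C(1) by (simp add: enn2real_mult)
    finally have "2 * pi * cmod (poisson_integral_deriv \<alpha> F v z) \<le> C * enn2real (I z)" by (simp add: norm_mult)
    moreover have "1 * cmod (poisson_integral_deriv \<alpha> F v z) \<le> 2 * pi * cmod (poisson_integral_deriv \<alpha> F v z)"
      by (intro mult_right_mono pi1) simp
    ultimately show ?thesis by simp
  qed
  note P = poisson_deriv_integrand_has_integral[OF g_cont[unfolded g_def[abs_def]]]
  show thesis
  proof (rule that[OF C(1)])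
    fix z :: complex assume z: "cmod z < 1"
    have w: "cmod (z * cis (- t)) < 1" for t using z by (simp add: norm_mult)
    have ang_cont: "continuous_on {0..2 * pi} (\<lambda>t. - conjugate_kernel_angular \<alpha> (z * cis (- t)))"
    proof -
      have "z * cis (- t) \<noteq> 1" for t using w[of t] by auto
      then show ?thesis
        unfolding conjugate_kernel_angular_def norm_mult norm_cis mult_1_right
        by (intro continuous_intros) auto
    qed
    have ends: "z * cis (- (2 * pi)) = z * cis (- 0)"
      by (simp add: cis_cnj[symmetric] cis_2pi)
    \<comment> \<open>adding \<open>c\<close> times this vanishing integral cancels the most singular part of the radial derivative\<close>
    have "((\<lambda>t. of_real (- conjugate_kernel_angular \<alpha> (z * cis (- t))) * g t
        + of_real (conjugate_kernel \<alpha> (z * cis (- t))) * D t) has_integral 0) {0..2 * pi}"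
      unfolding D_def
      by (rule absolutely_continuous_integration_by_parts[OF _ g_ac conjugate_kernel_along_circle[OF z] ang_cont])
         (simp_all only: ends g_per pi_gt_zero zero_less_mult_iff zero_less_numeral simp_thms)
    from has_integral_add[OF P[OF z, of \<alpha> z] has_integral_mult_right[OF this, of "of_real c"]]
    have J: "((\<lambda>t. of_real (poisson_kernel_deriv \<alpha> (z * cis (- t)) (z * cis (- t))) * F (cis t)
        + of_real c * (of_real (- conjugate_kernel_angular \<alpha> (z * cis (- t))) * g t
        + of_real (conjugate_kernel \<alpha> (z * cis (- t))) * D t))
      has_integral (2 * of_real pi * poisson_integral_deriv \<alpha> F z z)) {0..2 * pi}" by simp
    show "cmod (poisson_integral_deriv \<alpha> F z z) \<le> C * enn2real (I z)"
    proof (rule bound[OF z J])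
      fix t
      show "of_real (poisson_kernel_deriv \<alpha> (z * cis (- t)) (z * cis (- t))) * F (cis t)
        + of_real c * (of_real (- conjugate_kernel_angular \<alpha> (z * cis (- t))) * g t
        + of_real (conjugate_kernel \<alpha> (z * cis (- t))) * D t)
        = of_real (c * radial_remainder \<alpha> (z * cis (- t))) * g t
          + of_real (c * conjugate_kernel \<alpha> (z * cis (- t))) * D t"
        unfolding poisson_kernel_radial_identity[OF w] c_def[symmetric] g_def
        by (simp add: algebra_simps)
    qed (intro C w)+
    \<comment> \<open>adding this vanishing integral cancels the angular derivative of the kernel\<close>
    have "((\<lambda>t. of_real (poisson_kernel_deriv \<alpha> (z * cis (- t)) (- \<i> * (z * cis (- t)))) * g t
        + of_real (poisson_kernel \<alpha> (z * cis (- t))) * D t) has_integral 0) {0..2 * pi}"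
      unfolding D_def
    proof (rule absolutely_continuous_integration_by_parts[OF _ g_ac
          poisson_kernel_has_derivative_along[OF rotation_has_vector_derivative w]])
      show "continuous_on {0..2 * pi} (\<lambda>t. poisson_kernel_deriv \<alpha> (z * cis (- t)) (- \<i> * (z * cis (- t))))"
      proof -
        have "continuous_on {0..2 * pi} (\<lambda>t. (\<lambda>(w, v). poisson_kernel_deriv \<alpha> w v) (z * cis (- t), - \<i> * (z * cis (- t))))"
          by (rule continuous_on_compose2[OF continuous_on_poisson_kernel_deriv])
             (use z in \<open>auto intro!: continuous_intros simp: norm_mult\<close>)
        then show ?thesis by simp
      qed
    qed (simp_all only: ends g_per pi_gt_zero zero_less_mult_iff zero_less_numeral simp_thms)
    from has_integral_add[OF P[OF z, of \<alpha> "\<i> * z"] this]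
    have J: "((\<lambda>t. of_real (poisson_kernel_deriv \<alpha> (z * cis (- t)) (\<i> * z * cis (- t))) * F (cis t)
        + (of_real (poisson_kernel_deriv \<alpha> (z * cis (- t)) (- \<i> * (z * cis (- t)))) * g t
        + of_real (poisson_kernel \<alpha> (z * cis (- t))) * D t))
      has_integral (2 * of_real pi * poisson_integral_deriv \<alpha> F (\<i> * z) z)) {0..2 * pi}" by simp
    show "cmod (poisson_integral_deriv \<alpha> F (\<i> * z) z) \<le> C * enn2real (I z)"
    proof (rule bound[OF z J])
      fix t
      have "poisson_kernel_deriv \<alpha> w (- \<i> * w) = - poisson_kernel_deriv \<alpha> w (\<i> * w)" for w
        using poisson_kernel_deriv_linear[of \<alpha> w "- 1" "\<i> * w" 0 0] by simp
      then show "of_real (poisson_kernel_deriv \<alpha> (z * cis (- t)) (\<i> * z * cis (- t))) * F (cis t)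
        + (of_real (poisson_kernel_deriv \<alpha> (z * cis (- t)) (- \<i> * (z * cis (- t)))) * g t
        + of_real (poisson_kernel \<alpha> (z * cis (- t))) * D t)
        = of_real 0 * g t + of_real (poisson_kernel \<alpha> (z * cis (- t))) * D t"
        unfolding g_def by (simp add: mult.assoc)
    qed (use C(1) in \<open>auto intro!: C w simp: less_imp_le\<close>)
  qed
qed

section \<open>Bergman norms of the derivatives\<close>

lemma powr_add_le:
  fixes x y p :: real
  assumes "0 \<le> x" "0 \<le> y" "0 \<le> p"
  shows "(x + y) powr p \<le> 2 powr p * (x powr p + y powr p)"
proof -
  have "(x + y) powr p \<le> (2 * max x y) powr p" using assms by (intro powr_mono2) auto
  also have "\<dots> = 2 powr p * max x y powr p" using assms by (simp add: powr_mult)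
  also have "\<dots> \<le> 2 powr p * (x powr p + y powr p)" by (intro mult_left_mono) (auto simp: max_def)
  finally show ?thesis .
qed

text \<open>This holds also where the derivative does not exist: \<open>vector_derivative\<close> is a choice from the
set of derivatives, and the two sets coincide.\<close>

lemma vector_derivative_periodic:
  fixes g :: "real \<Rightarrow> 'a::real_normed_vector"
  assumes per: "\<And>t. g (t + c) = g t"
  shows "vector_derivative g (at (t + c)) = vector_derivative g (at t)"
proof -
  have shift: "(g has_vector_derivative d) (at (t + a))"
    if "(g has_vector_derivative d) (at t)" and per: "\<And>t. g (t + a) = g t" for d t a
  proof -
    have "((\<lambda>s. s - a) has_vector_derivative 1) (at (t + a))"
      by (auto intro!: derivative_eq_intros)
    from vector_diff_chain_at[OF this, of g d] that(1)
    have "(g \<circ> (\<lambda>s. s - a) has_vector_derivative d) (at (t + a))" by simp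
    moreover have "g \<circ> (\<lambda>s. s - a) = g" using per[of "_ - a"] by (auto simp: fun_eq_iff)
    ultimately show ?thesis by simp
  qed
  have per': "g (s + - c) = g s" for s using per[of "s - c"] by simp
  have "(g has_vector_derivative d) (at (t + c)) \<longleftrightarrow> (g has_vector_derivative d) (at t)" for d
    using shift[of d t c] per shift[of d "t + c" "- c"] per' by auto
  then show ?thesis by (simp add: vector_derivative_def)
qed

text \<open>The derivative is taken at the principal argument, which is \<open>t\<close> or \<open>t - 2 \<pi>\<close>.\<close>

lemma circle_deriv_cis:
  assumes t: "0 < t" "t < 2 * pi"
  shows "circle_deriv F (cis t) = vector_derivative (\<lambda>\<theta>. F (cis \<theta>)) (at t)"
proof -
  have shift: "cis (s + - (2 * pi)) = cis s" for s
    by (simp add: complex_eq_iff cos_diff sin_diff)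
  then have per: "F (cis (s + - (2 * pi))) = F (cis s)" for s by simp
  show ?thesis
  proof (cases "t \<le> pi")
    case True
    then have "Arg (cis t) = t" using t by (intro cis_Arg_unique) (auto simp: sgn_eq)
    then show ?thesis by (simp add: circle_deriv_def)
  next
    case False
    have "cis t = cis (t + - (2 * pi))" by (rule shift[symmetric])
    then have "Arg (cis t) = t + - (2 * pi)" using t False by (intro cis_Arg_unique) (auto simp: sgn_eq)
    then show ?thesis
      using vector_derivative_periodic[of "\<lambda>\<theta>. F (cis \<theta>)" "- (2 * pi)" t, OF per]
      by (simp add: circle_deriv_def)
  qed
qed

text \<open>A Borel function is needed for Tonelli's theorem, whereas the derivative of the boundary
function is only Lebesgue measurable; a Borel function equal to the sum almost everywhere does. The
\<open>p\<close>-th power is integrable because the boundary function is bounded and its derivative lies in \<open>L\<^sup>p\<close>.\<close>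

lemma boundary_majorant:
  assumes ac: "absolutely_continuous_circle F" and p: "1 \<le> p"
    and fin: "Lp_circle_norm p (circle_deriv F) < top"
  obtains H :: "real \<Rightarrow> real" where "H \<in> borel_measurable borel" and "\<And>t. 0 \<le> H t"
    and "AE t in lborel. t \<in> {0..2 * pi} \<longrightarrow>
        cmod (F (cis t)) + cmod (vector_derivative (\<lambda>t. F (cis t)) (at t)) \<le> H t"
    and "(\<integral>\<^sup>+t. ennreal (H t powr p) * indicator {0..2 * pi} t \<partial>lborel) < \<infinity>"
proof -
  define g where "g = (\<lambda>t. F (cis t))"
  define D where "D t = vector_derivative g (at t)" for t
  have g_ac: "absolutely_continuous_on {0..2 * pi} g"
    using ac unfolding absolutely_continuous_circle_def g_def .
  have g_cont: "continuous_on {0..2 * pi} g"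
    by (rule absolutely_continuous_imp_continuous_on[OF g_ac])
  obtain G where G: "G > 0" "\<And>t. t \<in> {0..2 * pi} \<Longrightarrow> cmod (g t) \<le> G"
    using compact_imp_bounded[OF compact_continuous_image[OF g_cont compact_Icc]]
    unfolding bounded_pos by auto
  have "D absolutely_integrable_on {0..2 * pi}"
    using absolutely_continuous_fundamental_theorem[OF g_ac, of "2 * pi"]
    unfolding fundamental_theorem_on_def D_def[abs_def] by simp
  moreover have "g absolutely_integrable_on {0..2 * pi}"
    by (rule absolutely_integrable_continuous_real[OF g_cont])
  ultimately have m: "(\<lambda>t. cmod (indicator {0..2 * pi} t *\<^sub>R g t) + cmod (indicator {0..2 * pi} t *\<^sub>R D t))
      \<in> borel_measurable lebesgue"
    unfolding set_integrable_def
    by (intro borel_measurable_add measurable_compose[OF borel_measurable_integrable borel_measurable_norm])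
  obtain H' where H': "H' \<in> borel_measurable lborel"
    "AE t in lborel. cmod (indicator {0..2 * pi} t *\<^sub>R g t) + cmod (indicator {0..2 * pi} t *\<^sub>R D t) = H' t"
    using completion_ex_borel_measurable_real[OF m] by blast
  define cd where "cd t = ennreal (cmod (circle_deriv F (cis t)) powr p) * indicator {0..2 * pi} t" for t
  have on_circle: "(\<lambda>t. ennreal (cmod (circle_deriv F (cis t)) powr p)) \<in> borel_measurable (lebesgue_on {0..2 * pi})"
  proof -
    have "(\<lambda>t. circle_deriv F (cis t)) \<in> borel_measurable angle_measure"
      using fin unfolding Lp_circle_norm_def Lp_norm_def by (auto split: if_splits)
    then have "(\<lambda>t. circle_deriv F (cis t)) \<in> borel_measurable (lebesgue_on {0..2 * pi})"
      unfolding angle_measure_def by (simp add: measurable_cong_sets[OF sets_scale_measure refl])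
    then show ?thesis by measurable
  qed
  then have cd_meas: "cd \<in> borel_measurable lebesgue"
    unfolding cd_def by (subst (asm) borel_measurable_restrict_space_iff_ennreal) auto
  have cd_fin: "(\<integral>\<^sup>+t. cd t \<partial>lborel) < \<infinity>"
  proof -
    have "(\<integral>\<^sup>+t. ennreal (cmod (circle_deriv F (cis t)) powr p) \<partial>angle_measure) < top"
      using fin unfolding Lp_circle_norm_def Lp_norm_def ennreal_powr_def
      by (auto simp: less_top split: if_splits)
    then have "ennreal (1 / (2 * pi)) *
        (\<integral>\<^sup>+t. ennreal (cmod (circle_deriv F (cis t)) powr p) \<partial>lebesgue_on {0..2 * pi}) < top"
      unfolding angle_measure_def by (simp add: nn_integral_scale_measure on_circle)
    then have "(\<integral>\<^sup>+t. ennreal (cmod (circle_deriv F (cis t)) powr p) \<partial>lebesgue_on {0..2 * pi}) < top"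
      by (auto simp: ennreal_mult_less_top)
    then show ?thesis
      unfolding cd_def by (simp add: nn_integral_restrict_space nn_integral_completion)
  qed
  show thesis
  proof
    show "(\<lambda>t. \<bar>H' t\<bar>) \<in> borel_measurable borel" using H'(1) by simp
    show "0 \<le> \<bar>H' t\<bar>" for t by simp
    show "AE t in lborel. t \<in> {0..2 * pi} \<longrightarrow>
        cmod (F (cis t)) + cmod (vector_derivative (\<lambda>t. F (cis t)) (at t)) \<le> \<bar>H' t\<bar>"
      using H'(2) by eventually_elim (auto simp: g_def D_def)
    have "AE t in lborel. t \<noteq> 0" "AE t in lborel. t \<noteq> 2 * pi" by (rule AE_lborel_singleton)+
    with H'(2) have "AE t in lborel. ennreal (\<bar>H' t\<bar> powr p) * indicator {0..2 * pi} t
        \<le> ennreal (2 powr p * G powr p) * indicator {0..2 * pi} t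
          + ennreal (2 powr p) * (ennreal (cmod (circle_deriv F (cis t)) powr p) * indicator {0..2 * pi} t)"
    proof eventually_elim
      case (elim t)
      show ?case
      proof (cases "t \<in> {0..2 * pi}")
        case True
        have "H' t = cmod (g t) + cmod (D t)" using elim(1) True by simp
        also have "D t = circle_deriv F (cis t)"
          unfolding D_def g_def using elim(2,3) True by (intro circle_deriv_cis[symmetric]) auto
        finally have "\<bar>H' t\<bar> \<le> G + cmod (circle_deriv F (cis t))" using G(2)[OF True] by simp
        then have "\<bar>H' t\<bar> powr p \<le> (G + cmod (circle_deriv F (cis t))) powr p"
          using p by (intro powr_mono2) auto
        also have "\<dots> \<le> 2 powr p * (G powr p + cmod (circle_deriv F (cis t)) powr p)"
          using G(1) p by (intro powr_add_le) auto
        also have "\<dots> = 2 powr p * G powr p + 2 powr p * cmod (circle_deriv F (cis t)) powr p"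
          by (simp add: algebra_simps)
        finally have "ennreal (\<bar>H' t\<bar> powr p) \<le> ennreal (2 powr p * G powr p + 2 powr p * cmod (circle_deriv F (cis t)) powr p)"
          by (rule ennreal_leI)
        then show ?thesis using True by (simp add: ennreal_mult)
      qed simp
    qed
    then have "(\<integral>\<^sup>+t. ennreal (\<bar>H' t\<bar> powr p) * indicator {0..2 * pi} t \<partial>lborel)
      \<le> (\<integral>\<^sup>+t. ennreal (2 powr p * G powr p) * indicator {0..2 * pi} t
          + ennreal (2 powr p) * cd t \<partial>lborel)"
      unfolding cd_def by (rule nn_integral_mono_AE)
    also have "\<dots> = (\<integral>\<^sup>+t. ennreal (2 powr p * G powr p) * indicator {0..2 * pi} t
          + ennreal (2 powr p) * cd t \<partial>lebesgue)"
      by (rule nn_integral_completion[symmetric])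
    also have "\<dots> = (\<integral>\<^sup>+t. ennreal (2 powr p * G powr p) * indicator {0..2 * pi} t \<partial>lebesgue)
          + (\<integral>\<^sup>+t. ennreal (2 powr p) * cd t \<partial>lebesgue)"
    proof (rule nn_integral_add)
      have [measurable]: "{0..2 * pi} \<in> sets lebesgue" by simp
      show "(\<lambda>t. ennreal (2 powr p * G powr p) * indicator {0..2 * pi} t) \<in> borel_measurable lebesgue"
        by measurable
      note [measurable] = cd_meas
      show "(\<lambda>t. ennreal (2 powr p) * cd t) \<in> borel_measurable lebesgue" by measurable
    qed
    also have "\<dots> = ennreal (2 powr p * G powr p) * emeasure lebesgue {0..2 * pi}
          + ennreal (2 powr p) * (\<integral>\<^sup>+t. cd t \<partial>lebesgue)"
      by (simp add: nn_integral_cmult[OF cd_meas] nn_integral_cmult_indicator)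
    also have "\<dots> < \<infinity>"
      using cd_fin unfolding nn_integral_completion by (simp add: ennreal_mult_less_top)
    finally show "(\<integral>\<^sup>+t. ennreal (\<bar>H' t\<bar> powr p) * indicator {0..2 * pi} t \<partial>lborel) < \<infinity>" .
  qed
qed

lemma bergman_norm_finite:
  assumes u: "u \<in> borel_measurable disc_measure" and p: "1 \<le> p"
    and le: "\<And>z. z \<in> ball 0 1 \<Longrightarrow> cmod (u z) \<le> M * (1 + R z)" and M: "0 \<le> M"
    and R: "\<And>z. 0 \<le> R z"
    and fin: "(\<integral>\<^sup>+z. ennreal (R z powr p) * indicator (ball 0 1) z \<partial>lborel) < \<infinity>"
    and R_meas: "(\<lambda>z. ennreal (R z powr p)) \<in> borel_measurable borel"
  shows "bergman_norm p u < top"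
proof -
  have [measurable]: "ball (0::complex) 1 \<in> sets borel" by simp
  note [measurable] = R_meas
  have point: "ennreal (cmod (u z) powr p) * indicator (ball 0 1) z \<le> ennreal (M powr p * 2 powr p) *
      (indicator (ball 0 1) z + ennreal (R z powr p) * indicator (ball 0 1) z)" for z
  proof (cases "z \<in> ball 0 1")
    case True
    have "cmod (u z) powr p \<le> (M * (1 + R z)) powr p"
      using le[OF True] p by (intro powr_mono2) auto
    also have "\<dots> = M powr p * (1 + R z) powr p" using M R[of z] by (simp add: powr_mult)
    also have "\<dots> \<le> M powr p * (2 powr p * (1 powr p + R z powr p))"
      using R[of z] p by (intro mult_left_mono powr_add_le) auto
    finally have "ennreal (cmod (u z) powr p) \<le> ennreal ((M powr p * 2 powr p) * (1 + R z powr p))"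
      by (intro ennreal_leI) (simp add: mult.assoc)
    then show ?thesis using True by (simp add: ennreal_mult)
  qed simp
  have "(\<integral>\<^sup>+z. ennreal (cmod (u z) powr p) * indicator (ball 0 1) z \<partial>lborel)
      \<le> (\<integral>\<^sup>+z. ennreal (M powr p * 2 powr p) *
      (indicator (ball 0 1) z + ennreal (R z powr p) * indicator (ball 0 1) z) \<partial>lborel)"
    by (intro nn_integral_mono point)
  also have "\<dots> = ennreal (M powr p * 2 powr p) * (emeasure lborel (ball (0::complex) 1)
      + (\<integral>\<^sup>+z. ennreal (R z powr p) * indicator (ball 0 1) z \<partial>lborel))"
    by (simp add: nn_integral_cmult nn_integral_add)
  also have "\<dots> < \<infinity>"
    using fin emeasure_lborel_ball_finite[of "0::complex" 1] by (simp add: ennreal_mult_less_top)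
  finally have "(\<integral>\<^sup>+z. ennreal (cmod (u z) powr p) \<partial>lebesgue_on (ball 0 1)) < \<infinity>"
    by (simp add: nn_integral_restrict_space nn_integral_completion)
  moreover have "u \<in> borel_measurable (lebesgue_on (ball 0 1))"
    using u unfolding disc_measure_def by (simp add: measurable_cong_sets[OF sets_scale_measure refl])
  then have "(\<lambda>z. ennreal (cmod (u z) powr p)) \<in> borel_measurable (lebesgue_on (ball 0 1))"
    by measurable
  ultimately have "(\<integral>\<^sup>+z. ennreal (cmod (u z) powr p) \<partial>disc_measure) < top"
    by (simp add: disc_measure_def nn_integral_scale_measure ennreal_mult_less_top)
  then show ?thesis using u by (simp add: bergman_norm_def Lp_norm_def ennreal_powr_def less_top)
qed

text \<open>The condition \<open>p < - 1 / \<alpha>\<close> says \<open>\<alpha> p > -1\<close>, so \<open>\<beta> = \<alpha>\<close> serves for negative \<open>\<alpha>\<close>. For \<open>\<alpha> = 0\<close> and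
\<open>p = 1\<close> any \<open>\<beta>\<close> between \<open>-1\<close> and 0 does.\<close>

lemma exponent_choice:
  assumes "(\<alpha>, p) \<in> Pi2"
  obtains \<beta> where "- 1 < \<alpha>" "\<alpha> \<le> 0" "1 \<le> p" "\<beta> \<le> \<alpha>" "- 1 < \<beta>" "\<beta> < 0" "- 1 < \<beta> * p"
proof (cases "\<alpha> = 0")
  case True
  then have "p = 1" using assms by (auto simp: Pi2_def)
  then show ?thesis using True by (intro that[of "- 1 / 2"]) auto
next
  case False
  then have *: "- 1 < \<alpha>" "\<alpha> < 0" "1 \<le> p" "p < - 1 / \<alpha>" using assms by (auto simp: Pi2_def)
  then have "- 1 < \<alpha> * p" by (simp add: field_simps)
  then show ?thesis using * by (intro that[of \<alpha>]) auto
qed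

theorem theorem1p3:
  fixes \<alpha> p :: real and F f :: "complex \<Rightarrow> complex"
  assumes "(\<alpha>, p) \<in> Pi2"
    and "absolutely_continuous_circle F"
    and "Lp_circle_norm p (circle_deriv F) < top"
    and "\<And>z. z \<in> ball 0 1 \<Longrightarrow> f z = poisson_integral \<alpha> F z"
  shows "bergman_norm p (partial_r f) + bergman_norm p (partial_z f) + bergman_norm p (partial_zbar f)
           \<lesssim> Linf_circle_norm F + Lp_circle_norm p (circle_deriv F)"
proof -
  obtain \<beta> where \<alpha>: "- 1 < \<alpha>" "\<alpha> \<le> 0" and p: "1 \<le> p"
    and \<beta>: "\<beta> \<le> \<alpha>" "- 1 < \<beta>" "\<beta> < 0" "- 1 < \<beta> * p"
    by (rule exponent_choice[OF assms(1)]) blast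
  obtain H :: "real \<Rightarrow> real" where H: "H \<in> borel_measurable borel" "\<And>t. 0 \<le> H t"
    "AE t in lborel. t \<in> {0..2 * pi} \<longrightarrow>
        cmod (F (cis t)) + cmod (vector_derivative (\<lambda>t. F (cis t)) (at t)) \<le> H t"
    "(\<integral>\<^sup>+t. ennreal (H t powr p) * indicator {0..2 * pi} t \<partial>lborel) < \<infinity>"
    by (rule boundary_majorant[OF assms(2) p assms(3)]) blast
  note [measurable] = H(1)
  define I where "I z = (\<integral>\<^sup>+t. ennreal (model_kernel \<beta> (z * cis (- t)) * H t) * indicator {0..2 * pi} t \<partial>lborel)" for z
  define R where "R z = enn2real (I z)" for z
  have I_meas [measurable]: "I \<in> borel_measurable borel" unfolding I_def by measurable
  note core = model_kernel_integral_bergman[OF H(1,2) p \<beta>(2-4) H(4), folded I_def]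
  obtain C where C: "C > 0"
    "\<And>z. cmod z < 1 \<Longrightarrow> cmod (poisson_integral_deriv \<alpha> F z z) \<le> C * R z"
    "\<And>z. cmod z < 1 \<Longrightarrow> cmod (poisson_integral_deriv \<alpha> F (\<i> * z) z) \<le> C * R z"
    unfolding R_def
    by (rule polar_derivatives_le_model_integral[OF assms(2) \<alpha> \<beta>(1) H(3,2,1), folded I_def, OF core(1)]) blast+
  have cont: "continuous_on {0..2 * pi} (\<lambda>t. F (cis t))"
    using absolutely_continuous_imp_continuous_on assms(2) unfolding absolutely_continuous_circle_def by blast
  define X where "X = poisson_integral_deriv \<alpha> F 1"
  define Y where "Y = poisson_integral_deriv \<alpha> F \<i>"
  have XY_cont: "continuous_on (ball 0 1) X" "continuous_on (ball 0 1) Y"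
    unfolding X_def Y_def by (rule continuous_on_poisson_integral_deriv[OF cont])+
  have along: "vector_derivative (\<lambda>h. f (z + of_real h * v)) (at 0) = poisson_integral_deriv \<alpha> F v z"
    if z: "z \<in> ball 0 1" for z v
  proof (rule vector_derivative_at)
    have "cmod z < 1" using z by simp
    define U where "U = (\<lambda>h. z + of_real h * v) -` ball 0 1"
    have "open U" unfolding U_def by (intro continuous_open_vimage continuous_intros) auto
    show "((\<lambda>h. f (z + of_real h * v)) has_vector_derivative poisson_integral_deriv \<alpha> F v z) (at 0)"
    proof (rule has_vector_derivative_transform_within_open[OF
          poisson_integral_has_derivative_along[OF cont \<open>cmod z < 1\<close>] \<open>open U\<close>])
      show "0 \<in> U" using z by (simp add: U_def)
      show "poisson_integral \<alpha> F (z + of_real h * v) = f (z + of_real h * v)" if "h \<in> U" for h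
        using assms(4) that by (simp add: U_def)
    qed
  qed
  have px: "partial_x f z = X z" and py: "partial_y f z = Y z" if "z \<in> ball 0 1" for z
    using along[OF that, of 1] along[OF that, of \<i>]
    by (simp_all add: partial_x_def partial_y_def X_def Y_def mult.commute)
  \<comment> \<open>polar derivatives degenerate at the origin, but the gradient is continuous there\<close>
  obtain B where B: "B > 0" "\<And>z. z \<in> cball 0 (1 / 2) \<Longrightarrow> cmod (X z) \<le> B \<and> cmod (Y z) \<le> B"
  proof -
    have sub: "cball (0::complex) (1 / 2) \<subseteq> ball 0 1" by auto
    have "bounded (X ` cball 0 (1 / 2))" "bounded (Y ` cball 0 (1 / 2))"
      using XY_cont sub by (auto intro!: compact_imp_bounded compact_continuous_image intro: continuous_on_subset)
    then obtain b1 b2 where b: "b1 > 0" "\<And>z. z \<in> cball 0 (1 / 2) \<Longrightarrow> cmod (X z) \<le> b1"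
      "\<And>z. z \<in> cball 0 (1 / 2) \<Longrightarrow> cmod (Y z) \<le> b2"
      unfolding bounded_pos by blast
    show thesis
      by (rule that[of "max b1 b2"]) (use b in \<open>auto simp: le_max_iff_disj\<close>)
  qed
  define M where "M = max B (4 * C)"
  have M: "M \<ge> 0" using B(1) by (simp add: M_def)
  have R0: "0 \<le> R z" for z by (simp add: R_def)
  have XY: "cmod (X z) \<le> M * (1 + R z)" "cmod (Y z) \<le> M * (1 + R z)" if z: "z \<in> ball 0 1" for z
  proof -
    have z1: "cmod z < 1" using z by simp
    have "cmod (X z) \<le> M * (1 + R z) \<and> cmod (Y z) \<le> M * (1 + R z)"
    proof (cases "cmod z \<le> 1 / 2")
      case True
      have "B * 1 \<le> M * (1 + R z)" using B(1) R0[of z] by (intro mult_mono) (auto simp: M_def)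
      then show ?thesis using B(2)[of z] True by auto
    next
      case False
      define P where "P = poisson_integral_deriv \<alpha> F z z"
      define Q where "Q = poisson_integral_deriv \<alpha> F (\<i> * z) z"
      \<comment> \<open>the Cartesian derivatives are recovered from the radial and the angular one\<close>
      note lin = poisson_integral_deriv_linear[OF cont z1, of \<alpha> _ 1 _ \<i>, folded X_def Y_def]
      have "of_real (Re z) * 1 + of_real (Im z) * \<i> = z" "of_real (- Im z) * 1 + of_real (Re z) * \<i> = \<i> * z"
        by (auto simp: complex_eq_iff)
      then have P: "P = of_real (Re z) * X z + of_real (Im z) * Y z"
        and Q: "Q = of_real (- Im z) * X z + of_real (Re z) * Y z"
        unfolding P_def Q_def by (metis lin)+
      have sq: "of_real ((cmod z)\<^sup>2) = (of_real (Re z))\<^sup>2 + (of_real (Im z) :: complex)\<^sup>2"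
        by (simp add: cmod_power2)
      have eX: "of_real ((cmod z)\<^sup>2) * X z = of_real (Re z) * P - of_real (Im z) * Q"
        and eY: "of_real ((cmod z)\<^sup>2) * Y z = of_real (Im z) * P + of_real (Re z) * Q"
        unfolding sq P Q by (simp_all add: power2_eq_square algebra_simps)
      have two: "cmod (of_real a * P) + cmod (of_real b * Q) \<le> cmod z * (2 * C * R z)"
        if "\<bar>a\<bar> \<le> cmod z" "\<bar>b\<bar> \<le> cmod z" for a b
      proof -
        have "cmod (of_real a * P) + cmod (of_real b * Q) \<le> cmod z * (C * R z) + cmod z * (C * R z)"
          unfolding norm_mult norm_of_real P_def Q_def
          using that C(2,3)[OF z1] by (intro add_mono mult_mono) auto
        then show ?thesis by (simp add: algebra_simps)
      qed
      have fin: "cmod W \<le> M * (1 + R z)" if "cmod (of_real ((cmod z)\<^sup>2) * W) \<le> cmod z * (2 * C * R z)" for W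
      proof -
        have "cmod z * (cmod z * cmod W) \<le> cmod z * (2 * C * R z)"
          using that by (simp add: norm_mult power2_eq_square mult.assoc)
        then have "cmod z * cmod W \<le> 2 * C * R z" using False by (subst (asm) mult_le_cancel_left_pos) auto
        moreover have "1 / 2 * cmod W \<le> cmod z * cmod W" using False by (intro mult_right_mono) auto
        ultimately have "cmod W \<le> 4 * C * R z" by simp
        also have "\<dots> \<le> M * (1 + R z)" using R0[of z] C(1) by (intro mult_mono) (auto simp: M_def)
        finally show ?thesis .
      qed
      have "cmod (X z) \<le> M * (1 + R z)"
        by (rule fin) (unfold eX, rule order_trans[OF norm_triangle_ineq4 two], auto simp: abs_Re_le_cmod abs_Im_le_cmod)
      moreover have "cmod (Y z) \<le> M * (1 + R z)"
        by (rule fin) (unfold eY, rule order_trans[OF norm_triangle_ineq two], auto simp: abs_Re_le_cmod abs_Im_le_cmod)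
      ultimately show ?thesis by simp
    qed
    then show "cmod (X z) \<le> M * (1 + R z)" "cmod (Y z) \<le> M * (1 + R z)" by auto
  qed
  define Z where "Z z = 1 / 2 * (X z - \<i> * Y z)" for z
  define Zb where "Zb z = 1 / 2 * (X z + \<i> * Y z)" for z
  define e where "e z = (if z = 0 then 1 else sgn z)" for z :: complex
  have pz: "partial_z f z = Z z" and pzb: "partial_zbar f z = Zb z"
    and pr: "partial_r f z = Z z * e z + Zb z * cnj (e z)" if "z \<in> ball 0 1" for z
  proof -
    show *: "partial_z f z = Z z" "partial_zbar f z = Zb z"
      using that by (simp_all add: partial_z_def partial_zbar_def Z_def Zb_def px py)
    have "cis (Arg z) = e z" by (simp add: e_def cis_Arg Arg_zero)
    then show "partial_r f z = Z z * e z + Zb z * cnj (e z)"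
      by (simp add: partial_r_def * cis_cnj[symmetric])
  qed
  have Zle: "cmod (Z z) \<le> M * (1 + R z)" "cmod (Zb z) \<le> M * (1 + R z)" if "z \<in> ball 0 1" for z
  proof -
    have "cmod (X z - \<i> * Y z) \<le> 2 * (M * (1 + R z))" "cmod (X z + \<i> * Y z) \<le> 2 * (M * (1 + R z))"
      using XY[OF that] norm_triangle_ineq4[of "X z" "\<i> * Y z"] norm_triangle_ineq[of "X z" "\<i> * Y z"]
      by (auto simp: norm_mult)
    then show "cmod (Z z) \<le> M * (1 + R z)" "cmod (Zb z) \<le> M * (1 + R z)"
      by (auto simp: Z_def Zb_def norm_mult)
  qed
  have [measurable]: "e \<in> borel_measurable borel"
    unfolding e_def sgn_div_norm by measurable
  have [measurable]: "X \<in> borel_measurable (lebesgue_on (ball 0 1))" "Y \<in> borel_measurable (lebesgue_on (ball 0 1))"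
    using XY_cont by (auto intro!: continuous_imp_measurable_on_sets_lebesgue)
  have disc_meas: "u \<in> borel_measurable disc_measure"
    if "v \<in> borel_measurable (lebesgue_on (ball 0 1))" "\<And>z. z \<in> ball 0 1 \<Longrightarrow> u z = v z" for u v :: "complex \<Rightarrow> complex"
  proof -
    have "u \<in> borel_measurable (lebesgue_on (ball 0 1))"
      using that by (subst measurable_cong[where g=v]) auto
    then show ?thesis unfolding disc_measure_def by (simp add: measurable_cong_sets[OF sets_scale_measure refl])
  qed
  have e_meas: "e \<in> borel_measurable (lebesgue_on (ball 0 1))"
    by (intro measurable_restrict_space1 measurable_completion) simp
  have Z_meas: "Z \<in> borel_measurable (lebesgue_on (ball 0 1))" "Zb \<in> borel_measurable (lebesgue_on (ball 0 1))"
    unfolding Z_def Zb_def by measurable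
  have cnj_meas: "(\<lambda>z. cnj (e z)) \<in> borel_measurable (lebesgue_on (ball 0 1))"
    by (rule measurable_compose[OF e_meas]) (intro borel_measurable_continuous_onI continuous_intros)
  have ne: "cmod (e z) = 1" for z by (simp add: e_def norm_sgn)
  have R_meas: "(\<lambda>z. ennreal (R z powr p)) \<in> borel_measurable borel"
    unfolding R_def by measurable
  note fin = bergman_norm_finite[OF _ p _ _ R0 core(2)[folded R_def] R_meas]
  have "bergman_norm p (partial_z f) < top"
    by (rule fin[where M=M]) (auto intro!: disc_meas[OF Z_meas(1)] M simp: pz Zle)
  moreover have "bergman_norm p (partial_zbar f) < top"
    by (rule fin[where M=M]) (auto intro!: disc_meas[OF Z_meas(2)] M simp: pzb Zle)
  moreover have "bergman_norm p (partial_r f) < top"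
  proof (rule fin[where M="2 * M"])
    show "partial_r f \<in> borel_measurable disc_measure"
      by (rule disc_meas[of "\<lambda>z. Z z * e z + Zb z * cnj (e z)"])
         (auto intro!: borel_measurable_add borel_measurable_times Z_meas e_meas cnj_meas simp: pr)
    show "cmod (partial_r f z) \<le> 2 * M * (1 + R z)" if z: "z \<in> ball 0 1" for z
    proof -
      have "cmod (partial_r f z) \<le> cmod (Z z * e z) + cmod (Zb z * cnj (e z))"
        unfolding pr[OF z] by (rule norm_triangle_ineq)
      also have "\<dots> \<le> M * (1 + R z) + M * (1 + R z)"
        using Zle[OF z] by (simp add: norm_mult ne)
      finally show ?thesis by simp
    qed
  qed (use M in auto)
  ultimately have "bergman_norm p (partial_r f) + bergman_norm p (partial_z f) + bergman_norm p (partial_zbar f) < top"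
    by simp
  \<comment> \<open>\<open>m\<close> becomes the additive constant of the estimate\<close>
  then obtain m where m: "m \<ge> 0"
    "bergman_norm p (partial_r f) + bergman_norm p (partial_z f) + bergman_norm p (partial_zbar f) = ennreal m"
    by (metis enn2real_nonneg ennreal_enn2real)
  show ?thesis
    unfolding lesssim_def m(2) using m(1) by (intro exI[of _ 1] exI[of _ m]) (auto simp: add_increasing)
qed

end
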